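(* Let $R$ be a probability measure on $C[0,\infty)$ under which the coordinate process $X$ is a positive strict local martingale starting from one. Then there exists a probability measure $Q$ on the canonical space $C[0,\infty)$ such that $X$ is a nonnegative martingale under $Q$ and the following holds: (i) The probability measure $P$ defined by $$P(A):=E^Q\left(X_t1_A\right),\qquad\forall\,A\in\mathcal F_t,\ t\ge 0,$$ is the law of the process $\{1/X_t,\ t\ge 0\}$ under $R$. (ii) $X$ is a strict local martingale (under $R$) if and only if $Q(\tau_0<\infty)>0$, where $\tau_0=\inf\{t\ge 0:\ X_t=0\}$ is the first hitting time of zero.
   Context: A strict local martingale is a local martingale which is not a martingale. $C[0,\infty)$ is the space of continuous real-valued paths on $[0,\infty)$, $X_t(\omega)=\omega(t)$ is the coordinate process, and $\{\mathcal F_t\}$ is the filtration generated by $X$. "Positive" means strictly positive at all times. *)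

theory Defs
  imports "HOL-Probability.Probability"
begin

section \<open>The canonical space of continuous paths\<close>

text \<open>Paths are made extensional, i.e. they take the fixed value \<open>undefined\<close> at negative times,
  so that a path is determined by its values on the half-line.\<close>

definition cont_paths :: "(real \<Rightarrow> real) set" where
  "cont_paths = {\<omega>. continuous_on {0..} \<omega> \<and> \<omega> \<in> extensional {0..}}"

definition coord :: "real \<Rightarrow> (real \<Rightarrow> real) \<Rightarrow> real" where
  "coord t \<omega> = \<omega> t"

text \<open>The raw filtration generated by the coordinate process. The time index ranges over
  \<open>[0, \<infinity>]\<close>, with the full \<open>\<sigma>\<close>-algebra at \<open>\<infinity>\<close>, so that the library's notion of stopping time
  applies directly to times with values in \<open>[0, \<infinity>]\<close>.\<close>

definition path_filtration :: "ennreal \<Rightarrow> (real \<Rightarrow> real) measure" where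
  "path_filtration t = sigma cont_paths
     {coord s -` B \<inter> cont_paths | s B. 0 \<le> s \<and> ennreal s \<le> t \<and> B \<in> sets borel}"

definition path_space :: "(real \<Rightarrow> real) measure" where
  "path_space = path_filtration \<infinity>"

definition path_prob :: "(real \<Rightarrow> real) measure \<Rightarrow> bool" where
  "path_prob M \<longleftrightarrow> prob_space M \<and> sets M = sets path_space"

section \<open>Martingales and local martingales in continuous time\<close>

definition martingale ::
  "'a measure \<Rightarrow> (ennreal \<Rightarrow> 'a measure) \<Rightarrow> (real \<Rightarrow> 'a \<Rightarrow> real) \<Rightarrow> bool" where
  "martingale M F X \<longleftrightarrow>
     filtration (space M) F \<and> (\<forall>t. subalgebra M (F t)) \<and>
     (\<forall>t\<ge>0. X t \<in> borel_measurable (F (ennreal t))) \<and>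
     (\<forall>t\<ge>0. integrable M (X t)) \<and>
     (\<forall>s\<ge>0. \<forall>t\<ge>s. AE \<omega> in M. real_cond_exp M (F (ennreal s)) (X t) \<omega> = X s \<omega>)"

definition stopped ::
  "(real \<Rightarrow> 'a \<Rightarrow> real) \<Rightarrow> ('a \<Rightarrow> ennreal) \<Rightarrow> real \<Rightarrow> 'a \<Rightarrow> real" where
  "stopped X T t \<omega> = X (enn2real (min (ennreal t) (T \<omega>))) \<omega>"

text \<open>The stopped process itself, rather than its increment from time 0, is required to be a
  martingale; the two versions agree when \<open>X 0\<close> is integrable.\<close>

definition local_martingale ::
  "'a measure \<Rightarrow> (ennreal \<Rightarrow> 'a measure) \<Rightarrow> (real \<Rightarrow> 'a \<Rightarrow> real) \<Rightarrow> bool" where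
  "local_martingale M F X \<longleftrightarrow>
     filtration (space M) F \<and> (\<forall>t. subalgebra M (F t)) \<and>
     (\<forall>t\<ge>0. X t \<in> borel_measurable (F (ennreal t))) \<and>
     (\<exists>T :: nat \<Rightarrow> 'a \<Rightarrow> ennreal.
        (\<forall>n. stopping_time F (T n)) \<and>
        (AE \<omega> in M. incseq (\<lambda>n. T n \<omega>) \<and> (\<lambda>n. T n \<omega>) \<longlonglongrightarrow> \<infinity>) \<and>
        (\<forall>n. martingale M F (stopped X (T n))))"

definition strict_local_martingale ::
  "'a measure \<Rightarrow> (ennreal \<Rightarrow> 'a measure) \<Rightarrow> (real \<Rightarrow> 'a \<Rightarrow> real) \<Rightarrow> bool" where
  "strict_local_martingale M F X \<longleftrightarrow> local_martingale M F X \<and> \<not> martingale M F X"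

section \<open>The change of measure and the reciprocal process\<close>

definition density_process_measure ::
  "(real \<Rightarrow> real) measure \<Rightarrow> (real \<Rightarrow> real) measure \<Rightarrow> bool" where
  "density_process_measure Q P \<longleftrightarrow> path_prob P \<and>
     (\<forall>t\<ge>0. \<forall>A\<in>sets (path_filtration (ennreal t)).
        measure P A = (\<integral>\<omega>. coord t \<omega> * indicator A \<omega> \<partial>Q))"

text \<open>The process \<open>1/X\<close> has continuous paths only on the event that \<open>X\<close> is strictly positive
  at all times, so its law is the image of the restriction of \<open>R\<close> to that event; it is meant for
  measures \<open>R\<close> that give the event full mass.\<close>

definition reciprocal_path :: "(real \<Rightarrow> real) \<Rightarrow> (real \<Rightarrow> real)" where
  "reciprocal_path \<omega> = (\<lambda>t\<in>{0..}. 1 / coord t \<omega>)"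

definition reciprocal_law :: "(real \<Rightarrow> real) measure \<Rightarrow> (real \<Rightarrow> real) measure" where
  "reciprocal_law R =
     distr (restrict_space R {\<omega>. \<forall>t\<ge>0. 0 < coord t \<omega>}) path_space reciprocal_path"

definition hitting_time_zero :: "(real \<Rightarrow> real) \<Rightarrow> ennreal" where
  "hitting_time_zero \<omega> = Inf {ennreal t | t. 0 \<le> t \<and> coord t \<omega> = 0}"

end

theory Submission
  imports Defs
begin

text \<open>The measure \<open>Q\<close> is obtained by a change of measure that uses \<open>X\<close> as density. Let \<open>T\<^sub>n\<close> be the
  hitting time of level \<open>4\<^sup>n\<close>, capped at \<open>n\<close>. The stopped process is a bounded martingale, so
  \<open>X\<^bsub>T\<^sub>n\<^esub> dR\<close> is a probability measure, and by optional stopping the joint laws of the stopped reciprocals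
  \<open>1/X\<^bsub>t \<and> T\<^sub>i\<^esub>\<close>, \<open>i \<le> n\<close>, under these measures are consistent in \<open>n\<close>. Kolmogorov's extension theorem,
  applied to the restrictions to rational times, yields one probability space that carries all stopped
  reciprocals. Consecutive ones differ only after \<open>T\<^sub>n\<close>, where the first equals \<open>4\<^sup>-\<^sup>n\<close>, and a maximal inequality
  with Borel-Cantelli shows that they converge locally uniformly; \<open>Q\<close> is the law of the limit \<open>Y\<close>.

  Everything follows from the identity \<open>E (Y\<^sub>t g(Y)) = E\<^sup>R (g(1/X))\<close> for nonnegative \<open>g\<close> depending on the path up
  to time \<open>t\<close>. With \<open>g\<close> an indicator it gives the martingale property and identifies \<open>P\<close>; with
  \<open>g(w) = 1/w(t)\<close> it gives \<open>Q(X\<^sub>t > 0) = E\<^sup>R X\<^sub>t\<close>, which would be one for all \<open>t\<close> if zero were never hit, and a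
  nonnegative supermartingale with constant expectation is a martingale.\<close>


section \<open>Path-determined functionals and stopping times\<close>

text \<open>On \<open>cont_paths\<close> the events \<open>level_time n w \<le> t\<close> decrease
  to the empty set, while their masses under the changed measures need not tend to zero: the lost
  mass belongs to paths that explode before \<open>t\<close>, whose reciprocals reach zero. In
  general the consistent family therefore has no common extension on the space where
  \<open>X\<close> lives. The stopped reciprocals survive the explosion and are glued instead, as
  random elements of \<open>rat => real\<close>; this countable product of lines is Polish, as the
  extension theorem requires, and continuity is recovered from uniform continuity on bounded sets of
  rationals.

  The levels \<open>4 ^ n\<close> are tied to the tolerance \<open>1 / 2 ^ n\<close>: a nonnegative
  martingale standing at \<open>1 / 4 ^ n\<close> climbs to \<open>1 / 2 ^ n\<close> with
  probability at most \<open>1 / 2 ^ n\<close>, so tolerances and error probabilities are both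
  summable. The cap at \<open>n\<close> makes the times bounded. The localizing times of the
  hypothesis are arbitrary; they serve to justify optional stopping at times up to which
  \<open>X\<close> is bounded.\<close>

definition determined_by ::
  "((real \<Rightarrow> real) \<Rightarrow> real) \<Rightarrow> ((real \<Rightarrow> real) \<Rightarrow> 'b) \<Rightarrow> bool" where
  "determined_by S f \<longleftrightarrow>
     (\<forall>w\<in>cont_paths. \<forall>w'\<in>cont_paths. (\<forall>t\<in>{0..S w}. w t = w' t) \<longrightarrow> f w = f w')"

text \<open>Galmarino's criterion is taken as the definition: for the raw filtration, a measurable time
  is a stopping time iff it is determined by the path up to that time.\<close>

definition path_stopping :: "((real \<Rightarrow> real) \<Rightarrow> real) \<Rightarrow> bool" where
  "path_stopping S \<longleftrightarrow>
     S \<in> borel_measurable path_space \<and> (\<forall>w\<in>cont_paths. 0 \<le> S w) \<and> determined_by S S"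

definition stop_path :: "real \<Rightarrow> (real \<Rightarrow> real) \<Rightarrow> (real \<Rightarrow> real)" where
  "stop_path u w = (\<lambda>t\<in>{0..}. w (min t u))"

lemma determined_byI:
  assumes "\<And>w w'. \<lbrakk>w \<in> cont_paths; w' \<in> cont_paths; \<And>t. 0 \<le> t \<Longrightarrow> t \<le> S w \<Longrightarrow> w t = w' t\<rbrakk> \<Longrightarrow> f w = f w'"
  shows "determined_by S f"
  using assms unfolding determined_by_def by (metis atLeastAtMost_iff)

lemma determined_byD:
  assumes "determined_by S f" "w \<in> cont_paths" "w' \<in> cont_paths"
    "\<And>t. 0 \<le> t \<Longrightarrow> t \<le> S w \<Longrightarrow> w t = w' t"
  shows "f w = f w'"
  using assms unfolding determined_by_def by (metis atLeastAtMost_iff)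

section \<open>Measurability on the path space and Galmarino's criterion at fixed times\<close>

lemma space_path_filtration [simp]: "space (path_filtration t) = cont_paths"
  unfolding path_filtration_def by (rule space_measure_of) auto

lemma space_path_space [simp]: "space path_space = cont_paths"
  by (simp add: path_space_def)

lemma measurable_coord_path_filtration:
  assumes "0 \<le> s" "ennreal s \<le> t"
  shows "(\<lambda>w. w s) \<in> borel_measurable (path_filtration t)"
proof (rule measurableI)
  fix B :: "real set" assume B: "B \<in> sets borel"
  have "coord s -` B \<inter> cont_paths \<in> sets (path_filtration t)"
    unfolding path_filtration_def by (rule in_measure_of) (use assms B in auto)
  then show "(\<lambda>w. w s) -` B \<inter> space (path_filtration t) \<in> sets (path_filtration t)"
    by (simp add: coord_def vimage_def)
qed auto

lemma measurable_coord_path_space [measurable]: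
  "0 \<le> s \<Longrightarrow> (\<lambda>w. w s) \<in> borel_measurable path_space"
  unfolding path_space_def by (rule measurable_coord_path_filtration) auto

lemma measurable_into_path_filtration:
  assumes "\<And>x. x \<in> space M \<Longrightarrow> f x \<in> cont_paths"
    and "\<And>s. 0 \<le> s \<Longrightarrow> ennreal s \<le> t \<Longrightarrow> (\<lambda>x. f x s) \<in> borel_measurable M"
  shows "f \<in> measurable M (path_filtration t)"
  unfolding path_filtration_def
proof (rule measurable_measure_of)
  show "f \<in> space M \<rightarrow> cont_paths" using assms by auto
next
  fix A assume "A \<in> {coord s -` B \<inter> cont_paths |s B. 0 \<le> s \<and> ennreal s \<le> t \<and> B \<in> sets borel}"
  then obtain s B where A: "A = coord s -` B \<inter> cont_paths" "0 \<le> s" "ennreal s \<le> t" "B \<in> sets borel"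
    by auto
  have "f -` A \<inter> space M = (\<lambda>x. f x s) -` B \<inter> space M"
    using assms(1) by (auto simp: A coord_def)
  also have "\<dots> \<in> sets M"
    using assms(2)[OF A(2,3)] A(4) by (rule measurable_sets)
  finally show "f -` A \<inter> space M \<in> sets M" .
qed auto

lemma measurable_into_path_space:
  assumes "\<And>x. x \<in> space M \<Longrightarrow> f x \<in> cont_paths"
    and "\<And>s. 0 \<le> s \<Longrightarrow> (\<lambda>x. f x s) \<in> borel_measurable M"
  shows "f \<in> measurable M path_space"
  unfolding path_space_def using assms by (intro measurable_into_path_filtration)

lemma sets_path_filtration_mono:
  assumes "s \<le> t" shows "sets (path_filtration s) \<subseteq> sets (path_filtration t)"
proof -
  have "(\<lambda>w. w) \<in> measurable (path_filtration t) (path_filtration s)"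
    by (intro measurable_into_path_filtration measurable_coord_path_filtration)
       (simp_all add: order_trans[OF _ assms])
  then have "(\<lambda>w. w) -` A \<inter> cont_paths \<in> sets (path_filtration t)"
    if "A \<in> sets (path_filtration s)" for A
    using measurable_sets[OF _ that, of "\<lambda>w. w" "path_filtration t"] by (simp only: space_path_filtration)
  moreover have "(\<lambda>w. w) -` A \<inter> cont_paths = A" if "A \<in> sets (path_filtration s)" for A
    using sets.sets_into_space[OF that] by auto
  ultimately show ?thesis by auto
qed

lemma sets_path_filtration_subset: "sets (path_filtration t) \<subseteq> sets path_space"
  unfolding path_space_def by (rule sets_path_filtration_mono) simp

lemma filtration_path_filtration: "filtration cont_paths path_filtration"
proof
  show "space (path_filtration t) = cont_paths" for t by simp
  show "sets (path_filtration s) \<le> sets (path_filtration t)" if "s \<le> t" for s t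
    using that by (rule sets_path_filtration_mono)
qed

lemma cont_pathsD: "w \<in> cont_paths \<Longrightarrow> continuous_on {0..} w"
  by (simp add: cont_paths_def)

lemma stop_path_in:
  assumes "w \<in> cont_paths" "0 \<le> u" shows "stop_path u w \<in> cont_paths"
proof -
  have "continuous_on {0..} (\<lambda>t. w (min t u))"
    by (rule continuous_on_compose2[OF cont_pathsD[OF assms(1)]])
       (use assms in \<open>auto intro!: continuous_intros\<close>)
  then have "continuous_on {0..} (stop_path u w)"
    by (rule continuous_on_eq) (simp add: stop_path_def)
  then show ?thesis by (simp add: cont_paths_def stop_path_def)
qed

lemma stop_path_apply: "0 \<le> t \<Longrightarrow> stop_path u w t = w (min t u)"
  by (simp add: stop_path_def)

lemma measurable_stop_path:
  assumes "0 \<le> u" shows "stop_path u \<in> measurable (path_filtration (ennreal u)) path_space"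
proof (rule measurable_into_path_space)
  fix s :: real assume "0 \<le> s"
  then show "(\<lambda>x. stop_path u x s) \<in> borel_measurable (path_filtration (ennreal u))"
    using assms by (simp add: stop_path_apply, intro measurable_coord_path_filtration)
      (auto intro: ennreal_leI)
qed (use assms stop_path_in in auto)

text \<open>A functional determined by the path up to \<open>u\<close> is unchanged when the path is
  stopped at \<open>u\<close>, and the stopping map reads only coordinates that belong to
  \<open>path_filtration (ennreal u)\<close>.\<close>

lemma measurable_path_filtration_if_determined:
  assumes f: "f \<in> measurable path_space N" and d: "determined_by (\<lambda>_. u) f" and u: "0 \<le> u"
  shows "f \<in> measurable (path_filtration (ennreal u)) N"
proof -
  have "(\<lambda>w. f (stop_path u w)) \<in> measurable (path_filtration (ennreal u)) N"
    using measurable_stop_path[OF u] f by measurable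
  also have "?this \<longleftrightarrow> ?thesis"
    by (rule measurable_cong)
       (auto intro!: determined_byD[OF d] simp: stop_path_in u stop_path_apply)
  finally show ?thesis .
qed

text \<open>Converse direction of \<open>measurable_path_filtration_if_determined\<close>: the
  generating cylinders read the path only up to \<open>u\<close>, and this property is kept by
  complements and countable unions.\<close>

lemma determined_by_path_filtration:
  assumes "A \<in> sets (path_filtration (ennreal u))" "0 \<le> u"
  shows "determined_by (\<lambda>_. u) (\<lambda>w. w \<in> A)"
proof -
  let ?G = "{coord s -` B \<inter> cont_paths |s B. 0 \<le> s \<and> ennreal s \<le> ennreal u \<and> B \<in> sets borel}"
  have "A \<in> sigma_sets cont_paths ?G"
    using assms unfolding path_filtration_def by (subst (asm) sets_measure_of) auto
  then show ?thesis
  proof induction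
    case (Basic a)
    then obtain s B where a: "a = coord s -` B \<inter> cont_paths" "0 \<le> s" "ennreal s \<le> ennreal u" by auto
    then have "s \<le> u" using assms(2) by simp
    then show ?case using a by (intro determined_byI) (auto simp: coord_def)
  next
    case Empty then show ?case by (auto intro: determined_byI)
  next
    case (Compl a) then show ?case
      by (intro determined_byI) (auto dest: determined_byD)
  next
    case (Union a)
    show ?case
    proof (rule determined_byI)
      fix w w' assume w: "w \<in> cont_paths" "w' \<in> cont_paths" "\<And>t. 0 \<le> t \<Longrightarrow> t \<le> u \<Longrightarrow> w t = w' t"
      have "(w \<in> a i) = (w' \<in> a i)" for i
        using w by (intro determined_byD[OF Union.IH]) auto
      then show "(w \<in> (\<Union>i. a i)) = (w' \<in> (\<Union>i. a i))" by simp
    qed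
  qed
qed

section \<open>Dyadic approximation of times and evaluation at random times\<close>

definition dyadic_floor :: "nat \<Rightarrow> real \<Rightarrow> real" where
  "dyadic_floor k s = real_of_int \<lfloor>2 ^ k * s\<rfloor> / 2 ^ k"

lemma dyadic_floor_bounds:
  "dyadic_floor k s \<le> s" "s - 1 / 2 ^ k < dyadic_floor k s"
proof -
  have "real_of_int \<lfloor>2 ^ k * s\<rfloor> \<le> 2 ^ k * s" by linarith
  then show "dyadic_floor k s \<le> s"
    unfolding dyadic_floor_def by (simp add: divide_le_eq mult.commute)
  have "2 ^ k * s - 1 < real_of_int \<lfloor>2 ^ k * s\<rfloor>" by linarith
  then have "(2 ^ k * s - 1) / 2 ^ k < dyadic_floor k s"
    unfolding dyadic_floor_def by (rule divide_strict_right_mono) simp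
  then show "s - 1 / 2 ^ k < dyadic_floor k s"
    by (simp add: diff_divide_distrib)
qed

lemma dyadic_floor_nonneg: "0 \<le> s \<Longrightarrow> 0 \<le> dyadic_floor k s"
  unfolding dyadic_floor_def by simp

lemma inverse_power2_tendsto: "(\<lambda>k. 1 / 2 ^ k :: real) \<longlonglongrightarrow> 0"
  using LIMSEQ_realpow_zero[of "1/2::real"] by (simp add: power_one_over)

lemma dyadic_floor_tendsto: "(\<lambda>k. dyadic_floor k s) \<longlonglongrightarrow> s"
proof (rule tendsto_sandwich[of "\<lambda>k. s - 1 / 2 ^ k" _ _ "\<lambda>_. s"])
  show "(\<lambda>k. s - 1 / 2 ^ k) \<longlonglongrightarrow> s"
    using tendsto_diff[OF tendsto_const[of s] inverse_power2_tendsto] by simp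
qed (use dyadic_floor_bounds in \<open>auto intro!: always_eventually less_imp_le\<close>)

lemma path_tendsto_within:
  assumes "w \<in> cont_paths" "\<And>k. 0 \<le> q k" "q \<longlonglongrightarrow> s" "0 \<le> s"
  shows "(\<lambda>k. w (q k)) \<longlonglongrightarrow> w s"
  using continuous_on_tendsto_compose[OF cont_pathsD[OF assms(1)] assms(3)] assms by auto

text \<open>The dyadic approximations of \<open>S\<close> from below take countably many values, and
  continuity of the path carries measurability to the limit.\<close>

lemma measurable_eval_random_time:
  assumes f: "f \<in> measurable M path_space" and S: "S \<in> borel_measurable M"
    and nn: "\<And>x. x \<in> space M \<Longrightarrow> 0 \<le> S x"
  shows "(\<lambda>x. f x (S x)) \<in> borel_measurable M"
proof -
  define g where "g k x = f x (real (nat \<lfloor>2 ^ k * S x\<rfloor>) / 2 ^ k)" for k x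
  have "g k \<in> borel_measurable M" for k
    unfolding g_def
  proof (rule measurable_compose_countable[where f="\<lambda>i x. f x (real i / 2 ^ k)"])
    show "(\<lambda>x. f x (real i / 2 ^ k)) \<in> borel_measurable M" for i
      by (rule measurable_compose[OF f measurable_coord_path_space]) auto
    show "(\<lambda>x. nat \<lfloor>2 ^ k * S x\<rfloor>) \<in> measurable M (count_space UNIV)"
      using S by measurable
  qed
  then show ?thesis
  proof (rule borel_measurable_LIMSEQ_real[rotated])
    fix x assume x: "x \<in> space M"
    have "g k x = f x (dyadic_floor k (S x))" for k
      unfolding g_def dyadic_floor_def using nn[OF x] by simp
    then show "(\<lambda>k. g k x) \<longlonglongrightarrow> f x (S x)"
      using path_tendsto_within[of "f x" "\<lambda>k. dyadic_floor k (S x)"] measurable_space[OF f x]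
        dyadic_floor_tendsto dyadic_floor_nonneg nn[OF x] by simp
  qed
qed

lemma path_stoppingD:
  assumes "path_stopping S"
  shows "S \<in> borel_measurable path_space" "\<And>w. w \<in> cont_paths \<Longrightarrow> 0 \<le> S w" "determined_by S S"
  using assms by (auto simp: path_stopping_def)

lemma measurable_path_at_stopping:
  assumes "path_stopping S" shows "(\<lambda>w. w (S w)) \<in> borel_measurable path_space"
  using path_stoppingD[OF assms] by (intro measurable_eval_random_time[where f="\<lambda>w. w"]) auto

lemma measurable_stop_path_stopping:
  assumes "path_stopping S" shows "(\<lambda>w. stop_path (S w) w) \<in> measurable path_space path_space"
proof (rule measurable_into_path_space)
  fix s :: real assume "0 \<le> s"
  then show "(\<lambda>x. stop_path (S x) x s) \<in> borel_measurable path_space"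
    using path_stoppingD[OF assms]
    by (simp add: stop_path_apply, intro measurable_eval_random_time[where f="\<lambda>w. w"]) auto
qed (use path_stoppingD[OF assms] stop_path_in in auto)

lemma path_stopping_const: "0 \<le> u \<Longrightarrow> path_stopping (\<lambda>_. u)"
  by (auto simp: path_stopping_def determined_by_def)

lemma determined_by_mono:
  assumes "determined_by S f" "\<And>w. w \<in> cont_paths \<Longrightarrow> S w \<le> T w"
  shows "determined_by T f"
proof (rule determined_byI)
  fix w w' assume w: "w \<in> cont_paths" "w' \<in> cont_paths" and a: "\<And>t. 0 \<le> t \<Longrightarrow> t \<le> T w \<Longrightarrow> w t = w' t"
  then show "f w = f w'"
    using assms(2)[OF w(1)] by (intro determined_byD[OF assms(1) w]) auto
qed

lemma path_stopping_min:
  assumes "path_stopping S" "path_stopping T"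
  shows "path_stopping (\<lambda>w. min (S w) (T w))"
  unfolding path_stopping_def
proof (intro conjI ballI)
  show "(\<lambda>w. min (S w) (T w)) \<in> borel_measurable path_space"
    using path_stoppingD(1)[OF assms(1)] path_stoppingD(1)[OF assms(2)] by measurable
  show "0 \<le> min (S w) (T w)" if "w \<in> cont_paths" for w
    using that path_stoppingD(2)[OF assms(1)] path_stoppingD(2)[OF assms(2)] by simp
  show "determined_by (\<lambda>w. min (S w) (T w)) (\<lambda>w. min (S w) (T w))"
  proof (rule determined_byI)
    fix w w' assume w: "w \<in> cont_paths" "w' \<in> cont_paths"
      and a: "\<And>t. 0 \<le> t \<Longrightarrow> t \<le> min (S w) (T w) \<Longrightarrow> w t = w' t"
    \<comment> \<open>The second alternative covers a time of \<open>w'\<close> that falls below the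
      minimum taken at \<open>w\<close>: the paths agree up to it, so the roles of \<open>w\<close>
      and \<open>w'\<close> can be exchanged.\<close>
    have S: "S w = S w'" if "S w \<le> T w \<or> S w' \<le> min (S w) (T w)"
      using that
    proof
      assume "S w \<le> T w" then show ?thesis
        using a by (intro determined_byD[OF path_stoppingD(3)[OF assms(1)] w]) auto
    next
      assume "S w' \<le> min (S w) (T w)" then show ?thesis
        using a w by (intro determined_byD[OF path_stoppingD(3)[OF assms(1)] w(2,1), symmetric]) auto
    qed
    have T: "T w = T w'" if "T w \<le> S w \<or> T w' \<le> min (S w) (T w)"
      using that
    proof
      assume "T w \<le> S w" then show ?thesis
        using a by (intro determined_byD[OF path_stoppingD(3)[OF assms(2)] w]) auto
    next
      assume "T w' \<le> min (S w) (T w)" then show ?thesis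
        using a w by (intro determined_byD[OF path_stoppingD(3)[OF assms(2)] w(2,1), symmetric]) auto
    qed
    show "min (S w) (T w) = min (S w') (T w')"
      using S T by (auto simp: min_def split: if_splits)
  qed
qed

section \<open>Optional stopping\<close>

locale positive_path_martingale =
  fixes R :: "(real \<Rightarrow> real) measure"
  assumes path_prob_R: "path_prob R"
    and pos: "AE w in R. \<forall>t\<ge>0. 0 < w t"
    and start: "AE w in R. w 0 = 1"
    and local_mart: "local_martingale R path_filtration coord"
begin

sublocale prob_space R
  using path_prob_R by (simp add: path_prob_def)

lemma sets_R [measurable_cong, simp]: "sets R = sets path_space"
  using path_prob_R by (simp add: path_prob_def)

lemma space_R [simp]: "space R = cont_paths"
  using sets_eq_imp_space_eq[OF sets_R] by simp

lemma measurable_R_eq: "measurable R N = measurable path_space N"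
  by (rule measurable_cong_sets) auto

lemma subalgebra_R: "subalgebra R (path_filtration t)"
  by (simp add: subalgebra_def sets_path_filtration_subset)

lemma sigma_finite_subalgebra_R: "sigma_finite_subalgebra R (path_filtration t)"
  by (rule finite_measure_subalgebra_is_sigma_finite)
     (simp add: finite_measure_subalgebra_def finite_measure_subalgebra_axioms_def subalgebra_R finite_measure_axioms)

text \<open>Boundedness of \<open>f\<close> makes the products integrable, so \<open>f\<close> can
  be moved into the conditional expectation at time \<open>s\<close>.\<close>

lemma martingale_weighted_expectation:
  assumes M: "martingale R path_filtration M" and st: "0 \<le> s" "s \<le> t"
    and f: "f \<in> borel_measurable (path_filtration (ennreal s))"
    and bd: "\<And>w. w \<in> cont_paths \<Longrightarrow> \<bar>f w\<bar> \<le> K"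
  shows "integrable R (\<lambda>w. f w * M s w)" "integrable R (\<lambda>w. f w * M t w)"
    "(\<integral>w. f w * M s w \<partial>R) = (\<integral>w. f w * M t w \<partial>R)"
proof -
  interpret F: sigma_finite_subalgebra R "path_filtration (ennreal s)"
    by (rule sigma_finite_subalgebra_R)
  have f': "f \<in> borel_measurable R"
    by (rule measurable_from_subalg[OF subalgebra_R f])
  have int: "integrable R (M s)" "integrable R (M t)"
    using M st by (auto simp: martingale_def)
  have ce: "AE w in R. real_cond_exp R (path_filtration (ennreal s)) (M t) w = M s w"
    using M st by (auto simp: martingale_def)
  have *: "integrable R (\<lambda>w. f w * g w)" if g: "integrable R g" for g
  proof (rule Bochner_Integration.integrable_bound)
    show "integrable R (\<lambda>w. K * g w)" using g by simp
    show "AE w in R. norm (f w * g w) \<le> norm (K * g w)"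
    proof (rule AE_I2)
      fix w assume "w \<in> space R"
      then have "\<bar>f w\<bar> \<le> \<bar>K\<bar>" using bd[of w] by auto
      then show "norm (f w * g w) \<le> norm (K * g w)"
        by (simp add: abs_mult mult_right_mono)
    qed
  qed (use f' g in measurable)
  show "integrable R (\<lambda>w. f w * M s w)" "integrable R (\<lambda>w. f w * M t w)"
    using * int by auto
  have "(\<integral>w. f w * M t w \<partial>R) = (\<integral>w. f w * real_cond_exp R (path_filtration (ennreal s)) (M t) w \<partial>R)"
    using F.real_cond_exp_intg(2)[OF *[OF int(2)] f] int by auto
  also have "\<dots> = (\<integral>w. f w * M s w \<partial>R)"
  proof (rule integral_cong_AE)
    show "AE w in R. f w * real_cond_exp R (path_filtration (ennreal s)) (M t) w = f w * M s w"
      using ce by eventually_elim simp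
  qed (use f' int in measurable)
  finally show "(\<integral>w. f w * M s w \<partial>R) = (\<integral>w. f w * M t w \<partial>R)" by simp
qed

text \<open>Sampling on the dyadic grid from above. The indicator truncates the sampled value, which
  makes the passage to the limit possible without uniform integrability.\<close>

lemma martingale_dyadic_sampling:
  fixes S :: "(real \<Rightarrow> real) \<Rightarrow> real" and k :: nat
  defines "D \<equiv> \<lambda>w. dyadic_floor k (S w) + 1 / 2 ^ k"
  assumes M: "martingale R path_filtration M" and S: "path_stopping S"
    and SN: "\<And>w. w \<in> cont_paths \<Longrightarrow> S w \<le> real N"
    and f: "f \<in> borel_measurable path_space" "determined_by S f"
    and bd: "\<And>w. w \<in> cont_paths \<Longrightarrow> \<bar>f w\<bar> \<le> K"
  shows "(\<lambda>w. M (D w) w) \<in> borel_measurable R"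
    "(\<integral>w. f w * indicator {..c} (M (D w) w) * M (D w) w \<partial>R) =
     (\<integral>w. f w * indicator {..c} (M (D w) w) * M (real N + 1) w \<partial>R)"
proof -
  define q where "q j = real j / 2 ^ k" for j :: nat
  \<comment> \<open>The grid point is taken strictly above \<open>S\<close>, so
    \<open>S w = N\<close> is moved to \<open>N + 1 / 2 ^ k\<close>. Hence the extra index, and
    hence the terminal time \<open>N + 1\<close>.\<close>
  define J where "J = {1..N * 2 ^ k + 1}"
  define B where "B j = {w \<in> cont_paths. Suc (nat \<lfloor>2 ^ k * S w\<rfloor>) = j}" for j
  note Sm = path_stoppingD[OF S]
  have B_sets: "B j \<in> sets path_space" for j
  proof -
    have "B j = {w \<in> space path_space. Suc (nat \<lfloor>2 ^ k * S w\<rfloor>) = j}" by (simp add: B_def)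
    also have "\<dots> \<in> sets path_space" using Sm(1) by measurable
    finally show ?thesis .
  qed
  have D_q: "D w = q j" and S_less: "S w < q j" if "w \<in> B j" for w j
  proof -
    have w: "w \<in> cont_paths" "0 \<le> S w" using that Sm(2) by (auto simp: B_def)
    have j: "real j = real_of_int \<lfloor>2 ^ k * S w\<rfloor> + 1" using that w by (auto simp: B_def)
    show "D w = q j" unfolding D_def q_def dyadic_floor_def j by (simp add: add_divide_distrib)
    then show "S w < q j" using dyadic_floor_bounds(2)[of "S w" k] by (simp add: D_def)
  qed
  have B_ex: "\<exists>j\<in>J. w \<in> B j" if w: "w \<in> cont_paths" for w
  proof -
    have "2 ^ k * S w \<le> 2 ^ k * real N" using SN[OF w] by simp
    then have "\<lfloor>2 ^ k * S w\<rfloor> \<le> \<lfloor>2 ^ k * real N\<rfloor>" by (rule floor_mono)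
    also have "\<lfloor>2 ^ k * real N\<rfloor> = int (N * 2 ^ k)"
    proof -
      have "2 ^ k * real N = real (N * 2 ^ k)" by simp
      then show ?thesis by (simp only: floor_of_nat)
    qed
    finally have "nat \<lfloor>2 ^ k * S w\<rfloor> \<le> N * 2 ^ k" by linarith
    then show ?thesis unfolding J_def B_def using w by simp
  qed
  have q_bounds: "0 \<le> q j" "j \<in> J \<Longrightarrow> q j \<le> real N + 1" for j
  proof -
    assume "j \<in> J"
    then have "real j \<le> real (N * 2 ^ k + 1)" unfolding J_def by (simp only: of_nat_le_iff) simp
    moreover have "1 \<le> (2::real) ^ k" by simp
    ultimately have "real j \<le> real N * 2 ^ k + 1 * 2 ^ k"
      by (simp only: of_nat_add of_nat_mult of_nat_power of_nat_numeral of_nat_1)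
    then show "q j \<le> real N + 1" unfolding q_def by (simp add: divide_le_eq distrib_right)
  qed (simp add: q_def)
  have M_F: "M (q j) \<in> borel_measurable (path_filtration (ennreal (q j)))" for j
    using M q_bounds by (auto simp: martingale_def)
  have M_R: "M (q j) \<in> borel_measurable R" for j
    using M_F subalgebra_R by (rule measurable_from_subalg[rotated])
  \<comment> \<open>On \<open>B j\<close> the time lies strictly before \<open>q j\<close>, so the
    path up to \<open>q j\<close> determines both membership in \<open>B j\<close> and the value of
    \<open>f\<close> there.\<close>
  have fB_F: "(\<lambda>w. f w * indicator (B j) w) \<in> borel_measurable (path_filtration (ennreal (q j)))" for j
  proof (rule measurable_path_filtration_if_determined)
    show "(\<lambda>w. f w * indicator (B j) w) \<in> borel_measurable path_space"
      using f(1) B_sets by measurable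
    have one: "f w' = f w \<and> w' \<in> B j" if "w \<in> cont_paths" "w' \<in> cont_paths"
        "\<And>t. 0 \<le> t \<Longrightarrow> t \<le> q j \<Longrightarrow> w t = w' t" "w \<in> B j" for w w'
    proof -
      have "S w < q j" using S_less that(4) by simp
      then have a: "w t = w' t" if "0 \<le> t" "t \<le> S w" for t
        using that \<open>0 \<le> t \<Longrightarrow> t \<le> q j \<Longrightarrow> w t = w' t\<close> by simp
      have "S w = S w'" by (rule determined_byD[OF Sm(3) that(1,2) a])
      moreover have "f w = f w'" by (rule determined_byD[OF f(2) that(1,2) a])
      ultimately show ?thesis using that(2,4) by (simp add: B_def)
    qed
    show "determined_by (\<lambda>_. q j) (\<lambda>w. f w * indicator (B j) w)"
    proof (rule determined_byI)
      fix w w' assume w: "w \<in> cont_paths" "w' \<in> cont_paths" "\<And>t. 0 \<le> t \<Longrightarrow> t \<le> q j \<Longrightarrow> w t = w' t"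
      show "f w * indicator (B j) w = f w' * indicator (B j) w'"
      proof (cases "w \<in> B j")
        case True
        then show ?thesis using one[OF w True] by simp
      next
        case False
        then have "w' \<notin> B j" using one[OF w(2,1) w(3)[symmetric]] by blast
        then show ?thesis using False by simp
      qed
    qed
  qed (simp add: q_bounds)
  \<comment> \<open>The truncation of the sampled value is known at time \<open>q j\<close>, so it
    can be made part of the weight in the martingale identity between \<open>q j\<close> and
    \<open>N + 1\<close>.\<close>
  define \<phi> where "\<phi> j w = f w * indicator (B j) w * indicator {..c} (M (q j) w)" for j w
  have \<phi>_F: "\<phi> j \<in> borel_measurable (path_filtration (ennreal (q j)))" for j
    unfolding \<phi>_def using fB_F M_F by measurable
  have \<phi>_bd: "\<bar>\<phi> j w\<bar> \<le> K" if "w \<in> cont_paths" for j w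
    using bd[OF that] by (auto simp: \<phi>_def indicator_def)
  have \<phi>_eq: "integrable R (\<lambda>w. \<phi> j w * M (q j) w)" "integrable R (\<lambda>w. \<phi> j w * M (real N + 1) w)"
    "(\<integral>w. \<phi> j w * M (q j) w \<partial>R) = (\<integral>w. \<phi> j w * M (real N + 1) w \<partial>R)" if "j \<in> J" for j
    using martingale_weighted_expectation[OF M _ _ \<phi>_F \<phi>_bd] q_bounds that by auto
  have sum_B: "(\<Sum>j\<in>J. indicator (B j) w * g j) = g i" if "w \<in> B i" "i \<in> J" for w i and g :: "nat \<Rightarrow> real"
  proof -
    have "(\<Sum>j\<in>J. indicator (B j) w * g j) = (\<Sum>j\<in>J. if j = i then g i else 0)"
      using that(1) by (intro sum.cong) (auto simp: B_def)
    then show ?thesis using that(2) by (simp add: J_def)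
  qed
  have DM: "M (D w) w = (\<Sum>j\<in>J. indicator (B j) w * M (q j) w)" if "w \<in> cont_paths" for w
  proof -
    obtain i where i: "i \<in> J" "w \<in> B i" using B_ex[OF \<open>w \<in> cont_paths\<close>] by blast
    show ?thesis using sum_B[OF i(2,1), of "\<lambda>j. M (q j) w"] D_q[OF i(2)] by simp
  qed
  show "(\<lambda>w. M (D w) w) \<in> borel_measurable R"
  proof -
    have "(\<lambda>w. \<Sum>j\<in>J. indicator (B j) w * M (q j) w) \<in> borel_measurable R"
      using M_R B_sets by measurable
    moreover have "(\<lambda>w. M (D w) w) \<in> borel_measurable R \<longleftrightarrow>
        (\<lambda>w. \<Sum>j\<in>J. indicator (B j) w * M (q j) w) \<in> borel_measurable R"
      by (rule measurable_cong) (use DM in auto)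
    ultimately show ?thesis by blast
  qed
  have eq: "f w * indicator {..c} (M (D w) w) * y (D w) = (\<Sum>j\<in>J. \<phi> j w * y (q j))"
    if "w \<in> cont_paths" for w y
  proof -
    obtain i where i: "i \<in> J" "w \<in> B i" using B_ex[OF \<open>w \<in> cont_paths\<close>] by auto
    have "(\<Sum>j\<in>J. \<phi> j w * y (q j)) = (\<Sum>j\<in>J. indicator (B j) w * (f w * indicator {..c} (M (q j) w) * y (q j)))"
      by (intro sum.cong) (auto simp: \<phi>_def)
    also have "\<dots> = f w * indicator {..c} (M (q i) w) * y (q i)"
      by (rule sum_B) (use i in auto)
    finally show ?thesis using D_q[OF i(2)] by simp
  qed
  have "(\<integral>w. f w * indicator {..c} (M (D w) w) * M (D w) w \<partial>R) = (\<integral>w. (\<Sum>j\<in>J. \<phi> j w * M (q j) w) \<partial>R)"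
  proof (intro Bochner_Integration.integral_cong refl)
    fix w assume "w \<in> space R"
    then show "f w * indicator {..c} (M (D w) w) * M (D w) w = (\<Sum>j\<in>J. \<phi> j w * M (q j) w)"
      using eq[of w "\<lambda>t. M t w"] by simp
  qed
  also have "\<dots> = (\<Sum>j\<in>J. \<integral>w. \<phi> j w * M (q j) w \<partial>R)"
    by (rule Bochner_Integration.integral_sum) (use \<phi>_eq in auto)
  also have "\<dots> = (\<Sum>j\<in>J. \<integral>w. \<phi> j w * M (real N + 1) w \<partial>R)"
    by (intro sum.cong \<phi>_eq) auto
  also have "\<dots> = (\<integral>w. (\<Sum>j\<in>J. \<phi> j w * M (real N + 1) w) \<partial>R)"
    by (rule Bochner_Integration.integral_sum[symmetric]) (use \<phi>_eq in auto)
  also have "\<dots> = (\<integral>w. f w * indicator {..c} (M (D w) w) * M (real N + 1) w \<partial>R)"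
  proof (intro Bochner_Integration.integral_cong refl)
    fix w assume "w \<in> space R"
    then show "(\<Sum>j\<in>J. \<phi> j w * M (real N + 1) w) = f w * indicator {..c} (M (D w) w) * M (real N + 1) w"
      using eq[of w "\<lambda>_. M (real N + 1) w"] by simp
  qed
  finally show "(\<integral>w. f w * indicator {..c} (M (D w) w) * M (D w) w \<partial>R) =
     (\<integral>w. f w * indicator {..c} (M (D w) w) * M (real N + 1) w \<partial>R)" .
qed

text \<open>The values sampled at dyadic times above \<open>S\<close> need not be bounded.
  Truncation at \<open>2 * C\<close> bounds them and is eventually inactive, since they tend to
  \<open>M (S w) w \<le> C\<close> and \<open>0 < C\<close> leaves a strict margin. On the other
  side the fixed variable \<open>M (N + 1)\<close> dominates, so both integrals converge.\<close>

lemma martingale_optional_sampling: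
  assumes M: "martingale R path_filtration M" and S: "path_stopping S"
    and SN: "\<And>w. w \<in> cont_paths \<Longrightarrow> S w \<le> real N"
    and f: "f \<in> borel_measurable path_space" "determined_by S f"
    and bd: "\<And>w. w \<in> cont_paths \<Longrightarrow> \<bar>f w\<bar> \<le> K"
    and cont: "\<And>w. w \<in> cont_paths \<Longrightarrow> continuous_on {0..} (\<lambda>t. M t w)"
    and Mpos: "AE w in R. \<forall>t\<ge>0. 0 \<le> M t w"
    and bound: "AE w in R. M (S w) w \<le> C" "0 < C"
  shows "(\<integral>w. f w * M (S w) w \<partial>R) = (\<integral>w. f w * M (real N + 1) w \<partial>R)"
    "(\<lambda>w. M (S w) w) \<in> borel_measurable R"
proof -
  define D where "D k w = dyadic_floor k (S w) + 1 / 2 ^ k" for k w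
  note Sm = path_stoppingD[OF S]
  note grid = martingale_dyadic_sampling[OF M S SN f bd, folded D_def]
  have K: "0 \<le> K" using bd not_empty by force
  have D0: "0 \<le> D k w" if "w \<in> cont_paths" for k w
    unfolding D_def using dyadic_floor_nonneg[OF Sm(2)[OF that]] by simp
  have D_lim: "(\<lambda>k. M (D k w) w) \<longlonglongrightarrow> M (S w) w" if w: "w \<in> cont_paths" for w
  proof (rule continuous_on_tendsto_compose[OF cont[OF w]])
    show "(\<lambda>k. D k w) \<longlonglongrightarrow> S w"
      unfolding D_def using tendsto_add[OF dyadic_floor_tendsto inverse_power2_tendsto] by simp
  qed (use D0 w Sm(2) in auto)
  show MS: "(\<lambda>w. M (S w) w) \<in> borel_measurable R"
    by (rule borel_measurable_LIMSEQ_real[OF _ grid(1)]) (use D_lim in auto)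
  have intN: "integrable R (M (real N + 1))" using M by (auto simp: martingale_def)
  have fR: "f \<in> borel_measurable R" using f by (simp add: measurable_R_eq)
  have ind: "(\<lambda>k. indicator {..2 * C} (M (D k w) w)) \<longlonglongrightarrow> (1::real)"
    if w: "w \<in> cont_paths" "M (S w) w \<le> C" for w
  proof (rule tendsto_eventually)
    have "\<forall>\<^sub>F k in sequentially. M (D k w) w < 2 * C"
      using D_lim[OF w(1)] by (rule order_tendstoD) (use w bound in auto)
    then show "\<forall>\<^sub>F k in sequentially. indicator {..2 * C} (M (D k w) w) = (1::real)"
      by eventually_elim simp
  qed
  have L1: "(\<lambda>k. \<integral>w. f w * indicator {..2 * C} (M (D k w) w) * M (D k w) w \<partial>R)
      \<longlonglongrightarrow> (\<integral>w. f w * M (S w) w \<partial>R)"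
  proof (rule integral_dominated_convergence[where w="\<lambda>_. K * (2 * C)"])
    show "AE w in R. (\<lambda>k. f w * indicator {..2 * C} (M (D k w) w) * M (D k w) w) \<longlonglongrightarrow> f w * M (S w) w"
      using bound(1)
    proof (rule AE_mp, intro AE_I2 impI)
      fix w assume "w \<in> space R" "M (S w) w \<le> C"
      then show "(\<lambda>k. f w * indicator {..2 * C} (M (D k w) w) * M (D k w) w) \<longlonglongrightarrow> f w * M (S w) w"
        using tendsto_mult[OF tendsto_mult[OF tendsto_const[of "f w"] ind[of w]] D_lim[of w]] by simp
    qed
    show "AE w in R. norm (f w * indicator {..2 * C} (M (D k w) w) * M (D k w) w) \<le> K * (2 * C)" for k
      using Mpos
    proof (rule AE_mp, intro AE_I2 impI)
      fix w assume w: "w \<in> space R" "\<forall>t\<ge>0. 0 \<le> M t w"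
      have "\<bar>indicator {..2 * C} (M (D k w) w) * M (D k w) w\<bar> \<le> 2 * C"
        using w D0[of w k] bound(2) by (auto simp: indicator_def)
      then have "\<bar>f w\<bar> * \<bar>indicator {..2 * C} (M (D k w) w) * M (D k w) w\<bar> \<le> K * (2 * C)"
        using bd[of w] w K by (intro mult_mono) auto
      then show "norm (f w * indicator {..2 * C} (M (D k w) w) * M (D k w) w) \<le> K * (2 * C)"
        by (simp add: abs_mult mult.assoc)
    qed
  qed (use fR grid(1) MS in measurable)
  have L2: "(\<lambda>k. \<integral>w. f w * indicator {..2 * C} (M (D k w) w) * M (real N + 1) w \<partial>R)
      \<longlonglongrightarrow> (\<integral>w. f w * M (real N + 1) w \<partial>R)"
  proof (rule integral_dominated_convergence[where w="\<lambda>w. K * \<bar>M (real N + 1) w\<bar>"])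
    show "AE w in R. (\<lambda>k. f w * indicator {..2 * C} (M (D k w) w) * M (real N + 1) w)
        \<longlonglongrightarrow> f w * M (real N + 1) w"
      using bound(1)
    proof (rule AE_mp, intro AE_I2 impI)
      fix w assume "w \<in> space R" "M (S w) w \<le> C"
      then show "(\<lambda>k. f w * indicator {..2 * C} (M (D k w) w) * M (real N + 1) w)
          \<longlonglongrightarrow> f w * M (real N + 1) w"
        using tendsto_mult[OF tendsto_mult[OF tendsto_const[of "f w"] ind[of w]] tendsto_const] by simp
    qed
    show "AE w in R. norm (f w * indicator {..2 * C} (M (D k w) w) * M (real N + 1) w)
        \<le> K * \<bar>M (real N + 1) w\<bar>" for k
    proof (intro AE_I2)
      fix w assume w: "w \<in> space R"
      have "\<bar>f w * indicator {..2 * C} (M (D k w) w)\<bar> \<le> K"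
        using bd[of w] w K by (auto simp: indicator_def)
      then show "norm (f w * indicator {..2 * C} (M (D k w) w) * M (real N + 1) w)
        \<le> K * \<bar>M (real N + 1) w\<bar>"
        by (simp add: abs_mult mult_right_mono)
    qed
    show "integrable R (\<lambda>w. K * \<bar>M (real N + 1) w\<bar>)" using intN by auto
  qed (use fR grid(1) intN in measurable)
  show "(\<integral>w. f w * M (S w) w \<partial>R) = (\<integral>w. f w * M (real N + 1) w \<partial>R)"
  proof (rule LIMSEQ_unique[OF L1])
    have "(\<lambda>k. \<integral>w. f w * indicator {..2 * C} (M (D k w) w) * M (D k w) w \<partial>R) =
        (\<lambda>k. \<integral>w. f w * indicator {..2 * C} (M (D k w) w) * M (real N + 1) w \<partial>R)"
      by (intro ext grid(2))
    with L2 show "(\<lambda>k. \<integral>w. f w * indicator {..2 * C} (M (D k w) w) * M (D k w) w \<partial>R)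
      \<longlonglongrightarrow> (\<integral>w. f w * M (real N + 1) w \<partial>R)" by (simp only:)
  qed
qed

text \<open>The localized processes satisfy optional sampling at \<open>S\<close> and at
  \<open>T\<close> with the same terminal value, so the two expectations agree for each
  \<open>n\<close>. Up to \<open>T\<close> the path is bounded by \<open>C\<close>, and dominated
  convergence removes the localization.\<close>

lemma optional_stopping_bounded:
  assumes S: "path_stopping S" and T: "path_stopping T"
    and ST: "\<And>w. w \<in> cont_paths \<Longrightarrow> S w \<le> T w"
    and TN: "\<And>w. w \<in> cont_paths \<Longrightarrow> T w \<le> real N"
    and f: "f \<in> borel_measurable path_space" "determined_by S f"
    and bd: "\<And>w. w \<in> cont_paths \<Longrightarrow> \<bar>f w\<bar> \<le> K"
    and bound: "AE w in R. \<forall>t\<in>{0..T w}. w t \<le> C" "0 < C"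
  shows "(\<integral>w. f w * w (S w) \<partial>R) = (\<integral>w. f w * w (T w) \<partial>R)"
proof -
  obtain \<tau> :: "nat \<Rightarrow> (real \<Rightarrow> real) \<Rightarrow> ennreal" where
    \<tau>: "AE w in R. (\<lambda>n. \<tau> n w) \<longlonglongrightarrow> \<infinity>" "\<And>n. martingale R path_filtration (stopped coord (\<tau> n))"
    using local_mart unfolding local_martingale_def by (auto simp: AE_conj_iff)
  have K: "0 \<le> K" using bd not_empty by force
  have fR: "f \<in> borel_measurable R" using f by (simp add: measurable_R_eq)
  have cont: "continuous_on {0..} (\<lambda>t. stopped coord (\<tau> n) t w)" if w: "w \<in> cont_paths" for n w
  proof -
    \<comment> \<open>At an infinite localizing time \<open>enn2real\<close> returns zero, so this
      case has to be separated.\<close>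
    have eq: "enn2real (min (ennreal t) (\<tau> n w)) = (if \<tau> n w = \<infinity> then t else min t (enn2real (\<tau> n w)))"
      if "0 \<le> t" for t
      using that by (cases "\<tau> n w") (auto simp: min_def ennreal_leI ennreal_le_iff)
    have c: "continuous_on {0..} (\<lambda>t. if \<tau> n w = \<infinity> then t else min t (enn2real (\<tau> n w)))"
      by (cases "\<tau> n w = \<infinity>") (auto intro!: continuous_intros)
    have "continuous_on {0..} (\<lambda>t. w (if \<tau> n w = \<infinity> then t else min t (enn2real (\<tau> n w))))"
      by (rule continuous_on_compose2[OF cont_pathsD[OF w] c]) auto
    then show ?thesis
      by (rule continuous_on_eq) (simp add: stopped_def coord_def eq)
  qed
  have Mpos: "AE w in R. \<forall>t\<ge>0. 0 \<le> stopped coord (\<tau> n) t w" for n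
    using pos by eventually_elim (simp add: stopped_def coord_def less_imp_le)
  have le: "stopped coord (\<tau> n) (U w) w \<le> C" "0 \<le> stopped coord (\<tau> n) (U w) w"
    if w: "w \<in> cont_paths" "\<forall>t\<in>{0..T w}. w t \<le> C" "\<forall>t\<ge>0. 0 < w t"
      and U: "path_stopping U" "U w \<le> T w" for n w U
  proof -
    have "enn2real (min (ennreal (U w)) (\<tau> n w)) \<le> U w"
      using path_stoppingD(2)[OF U(1) w(1)] by (intro enn2real_leI) auto
    then show "stopped coord (\<tau> n) (U w) w \<le> C"  "0 \<le> stopped coord (\<tau> n) (U w) w"
      using w U by (auto simp: stopped_def coord_def less_imp_le)
  qed
  have B: "AE w in R. w \<in> cont_paths \<and> (\<forall>t\<in>{0..T w}. w t \<le> C) \<and> (\<forall>t\<ge>0. 0 < w t) \<and> (\<lambda>n. \<tau> n w) \<longlonglongrightarrow> \<infinity>"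
    using bound(1) pos \<tau>(1) AE_space[of R] by eventually_elim auto
  have lim: "(\<lambda>n. \<integral>w. f w * stopped coord (\<tau> n) (U w) w \<partial>R) \<longlonglongrightarrow> (\<integral>w. f w * w (U w) \<partial>R)"
    and eq: "(\<integral>w. f w * stopped coord (\<tau> n) (U w) w \<partial>R)
      = (\<integral>w. f w * stopped coord (\<tau> n) (real N + 1) w \<partial>R)"
    if U: "path_stopping U" "\<And>w. w \<in> cont_paths \<Longrightarrow> U w \<le> T w" "determined_by U f" for U n
  proof -
    have bU: "AE w in R. stopped coord (\<tau> n) (U w) w \<le> C" for n
      using B by eventually_elim (use le U in auto)
    have UN: "U w \<le> real N" if "w \<in> cont_paths" for w
      using U(2)[OF that] TN[OF that] by simp
    note os = martingale_optional_sampling[OF \<tau>(2) U(1) UN f(1) U(3) bd cont Mpos bU bound(2)]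
    show "(\<integral>w. f w * stopped coord (\<tau> n) (U w) w \<partial>R)
      = (\<integral>w. f w * stopped coord (\<tau> n) (real N + 1) w \<partial>R)" by (rule os(1))
    show "(\<lambda>n. \<integral>w. f w * stopped coord (\<tau> n) (U w) w \<partial>R) \<longlonglongrightarrow> (\<integral>w. f w * w (U w) \<partial>R)"
    proof (rule integral_dominated_convergence[where w="\<lambda>_. K * C"])
      show "(\<lambda>w. f w * w (U w)) \<in> borel_measurable R"
        using fR measurable_path_at_stopping[OF U(1)] by (simp add: measurable_R_eq) 
      show "(\<lambda>w. f w * stopped coord (\<tau> n) (U w) w) \<in> borel_measurable R" for n
        using fR os(2) by (rule borel_measurable_times)
      show "AE w in R. (\<lambda>n. f w * stopped coord (\<tau> n) (U w) w) \<longlonglongrightarrow> f w * w (U w)"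
        using B
      proof eventually_elim
        case (elim w)
        \<comment> \<open>For a fixed path the localizing times eventually exceed
          \<open>U w\<close>, and from then on the stopped value is the value itself.\<close>
        have "\<forall>\<^sub>F n in sequentially. ennreal (U w) < \<tau> n w"
          by (rule order_tendstoD(1)[of _ "\<infinity>"]) (use elim in auto)
        then have "\<forall>\<^sub>F n in sequentially. f w * stopped coord (\<tau> n) (U w) w = f w * w (U w)"
          by eventually_elim
             (use path_stoppingD(2)[OF U(1)] elim in \<open>simp add: stopped_def coord_def min_absorb1 less_imp_le\<close>)
        then show ?case by (rule tendsto_eventually)
      qed
      show "AE w in R. norm (f w * stopped coord (\<tau> n) (U w) w) \<le> K * C" for n
        using B
      proof eventually_elim
        case (elim w)
        then have "\<bar>f w\<bar> * \<bar>stopped coord (\<tau> n) (U w) w\<bar> \<le> K * C"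
          using bd[of w] le[of w U n] U K by (intro mult_mono) auto
        then show ?case by (simp add: abs_mult)
      qed
    qed auto
  qed
  have "(\<lambda>n. \<integral>w. f w * stopped coord (\<tau> n) (real N + 1) w \<partial>R) \<longlonglongrightarrow> (\<integral>w. f w * w (S w) \<partial>R)"
    using lim[OF S ST f(2)] eq[OF S ST f(2)] by simp
  moreover have "(\<lambda>n. \<integral>w. f w * stopped coord (\<tau> n) (real N + 1) w \<partial>R) \<longlonglongrightarrow> (\<integral>w. f w * w (T w) \<partial>R)"
    using lim[OF T _ determined_by_mono[OF f(2) ST]] eq[OF T _ determined_by_mono[OF f(2) ST]] by simp
  ultimately show ?thesis by (rule LIMSEQ_unique)
qed

end

section \<open>Hitting times\<close>

text \<open>The cap makes the infimum range over a nonempty set and keeps the time bounded, as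
  optional stopping requires. The observed process \<open>g\<close> is a parameter because two are
  used: the path itself, and the amount by which it has fallen since a level time.\<close>

definition capped_hit :: "((real \<Rightarrow> real) \<Rightarrow> real \<Rightarrow> real) \<Rightarrow> real \<Rightarrow> real \<Rightarrow> (real \<Rightarrow> real) \<Rightarrow> real" where
  "capped_hit g c N w = Inf (insert N {t. 0 \<le> t \<and> c \<le> g w t})"

lemma capped_hit_bounds:
  assumes "0 \<le> N" shows "0 \<le> capped_hit g c N w" "capped_hit g c N w \<le> N"
proof -
  have "bdd_below (insert N {t. 0 \<le> t \<and> c \<le> g w t})" using assms by (intro bdd_belowI[of _ 0]) auto
  then show "capped_hit g c N w \<le> N" unfolding capped_hit_def by (intro cInf_lower) auto
  show "0 \<le> capped_hit g c N w" unfolding capped_hit_def using assms by (intro cInf_greatest) auto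
qed

lemma capped_hit_le:
  assumes "0 \<le> N" "0 \<le> t" "c \<le> g w t" shows "capped_hit g c N w \<le> t"
proof -
  have "bdd_below (insert N {t. 0 \<le> t \<and> c \<le> g w t})" using assms by (intro bdd_belowI[of _ 0]) auto
  then show ?thesis unfolding capped_hit_def using assms by (intro cInf_lower) auto
qed

lemma capped_hit_before:
  assumes "0 \<le> N" "0 \<le> t" "t < capped_hit g c N w" shows "g w t < c"
  using capped_hit_le[of N t c g w] assms by force

lemma capped_hit_attained:
  assumes c: "continuous_on {0..} (g w)" and N: "0 \<le> N" and less: "capped_hit g c N w < N"
  shows "c \<le> g w (capped_hit g c N w)"
proof -
  let ?A = "{t. 0 \<le> t \<and> c \<le> g w t}"
  have "closed ({0..} \<inter> g w -` {c..})"
    using continuous_on_closed_vimage[of "{0..}" "g w"] c by (simp add: Int_commute)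
  moreover have "{0..} \<inter> g w -` {c..} = ?A" by auto
  ultimately have "closed (insert N ?A)" by simp
  then have "Inf (insert N ?A) \<in> insert N ?A"
    using N by (intro closed_contains_Inf) (auto intro!: bdd_belowI[of _ 0])
  then show ?thesis using less unfolding capped_hit_def by auto
qed

text \<open>By the intermediate value theorem a value above \<open>c\<close> would be preceded by
  the value \<open>c\<close> at a strictly earlier time.\<close>

lemma capped_hit_upto:
  assumes c: "continuous_on {0..} (g w)" and N: "0 \<le> N" and g0: "g w 0 \<le> c"
    and t: "0 \<le> t" "t \<le> capped_hit g c N w"
  shows "g w t \<le> c"
proof (rule ccontr)
  assume "\<not> g w t \<le> c"
  then obtain x where x: "0 \<le> x" "x \<le> t" "g w x = c"
    using IVT'[of "g w" 0 c t] g0 t continuous_on_subset[OF c, of "{0..t}"] by auto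
  then have "x \<noteq> t" using \<open>\<not> g w t \<le> c\<close> by auto
  then show False using capped_hit_before[OF N x(1), of g c w] x t by auto
qed

lemma dyadic_floor_rat: "dyadic_floor k s = real_of_rat (of_int \<lfloor>2 ^ k * s\<rfloor> / 2 ^ k)"
  by (simp add: dyadic_floor_def of_rat_divide of_rat_power)

lemma dyadic_floor_le1: "s \<le> 1 \<Longrightarrow> dyadic_floor k s \<le> 1"
  using dyadic_floor_bounds(1)[of k s] by simp

text \<open>The points \<open>u * real_of_rat r\<close> are dense in the interval from 0 to
  \<open>u\<close>, with a countable index set that does not depend on \<open>u\<close>; this lets
  hitting before \<open>u\<close> be tested by countably many coordinates.\<close>

lemma exists_rational_near:
  fixes h :: "real \<Rightarrow> real"
  assumes c: "continuous_on {0..} h" and u: "0 \<le> u" and t: "0 \<le> t" "t \<le> u" and less: "a < h t"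
  shows "\<exists>r::rat. 0 \<le> r \<and> r \<le> 1 \<and> a < h (u * real_of_rat r)"
proof (cases "u = 0")
  case True then show ?thesis using t less by (intro exI[of _ 0]) auto
next
  case False
  then have s: "0 \<le> t / u" "t / u \<le> 1" "u * (t / u) = t" using u t by auto
  have lim: "(\<lambda>k. h (u * dyadic_floor k (t / u))) \<longlonglongrightarrow> h (u * (t / u))"
  proof (rule continuous_on_tendsto_compose[OF c])
    show "(\<lambda>k. u * dyadic_floor k (t / u)) \<longlonglongrightarrow> u * (t / u)"
      by (intro tendsto_mult tendsto_const dyadic_floor_tendsto)
  qed (use s t u dyadic_floor_nonneg in auto)
  have "\<forall>\<^sub>F k in sequentially. a < h (u * dyadic_floor k (t / u))"
    using order_tendstoD(1)[OF lim, of a] less s(3) by simp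
  then obtain k where k: "a < h (u * dyadic_floor k (t / u))"
    by (auto dest: eventually_happens)
  define r :: rat where "r = of_int \<lfloor>2 ^ k * (t / u)\<rfloor> / 2 ^ k"
  have r: "real_of_rat r = dyadic_floor k (t / u)" by (simp only: dyadic_floor_rat r_def)
  have "0 \<le> r"
    using zero_le_of_rat_iff[where 'a=real, of r] dyadic_floor_nonneg[OF s(1)] by (simp only: r)
  moreover have "r \<le> 1"
    using of_rat_le_1_iff[where 'a=real, of r] dyadic_floor_le1[OF s(2)] by (simp only: r)
  ultimately show ?thesis using k r by (intro exI[of _ r]) auto
qed

text \<open>Since \<open>u < N\<close>, the cap plays no part before \<open>u\<close>, and by
  compactness the level is hit iff the supremum up to \<open>u\<close> is at least \<open>c\<close>.
  The slack \<open>1 / (k + 1)\<close> is there because the value \<open>c\<close> may be attained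
  only off the countable set of test times.\<close>

lemma capped_hit_le_iff:
  assumes c: "continuous_on {0..} (g w)" and u: "0 \<le> u" "u < N"
  shows "capped_hit g c N w \<le> u \<longleftrightarrow>
    (\<forall>k::nat. \<exists>r::rat. 0 \<le> r \<and> r \<le> 1 \<and> c - 1 / real (Suc k) < g w (u * real_of_rat r))"
proof
  let ?h = "capped_hit g c N w"
  assume le: "?h \<le> u"
  then have "c \<le> g w ?h" using u by (intro capped_hit_attained[where g=g, OF c]) auto
  moreover have "0 \<le> ?h" using u by (intro capped_hit_bounds) auto
  ultimately show "\<forall>k::nat. \<exists>r::rat. 0 \<le> r \<and> r \<le> 1 \<and> c - 1 / real (Suc k) < g w (u * real_of_rat r)"
    using le u by (intro allI exists_rational_near[OF c, of u ?h]) (auto intro: less_le_trans[of _ c])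
next
  assume *: "\<forall>k::nat. \<exists>r::rat. 0 \<le> r \<and> r \<le> 1 \<and> c - 1 / real (Suc k) < g w (u * real_of_rat r)"
  have "compact {0..u}" "{0..u} \<noteq> {}" "continuous_on {0..u} (g w)"
    using u continuous_on_subset[OF c, of "{0..u}"] by auto
  then obtain x where x: "x \<in> {0..u}" "\<And>t. t \<in> {0..u} \<Longrightarrow> g w t \<le> g w x"
    using continuous_attains_sup by metis
  have "c - 1 / real (Suc k) < g w x" for k :: nat
  proof -
    obtain r :: rat where r: "0 \<le> r" "r \<le> 1" "c - 1 / real (Suc k) < g w (u * real_of_rat r)"
      using * by blast
    moreover have "u * real_of_rat r \<in> {0..u}" using r u by (auto intro: mult_left_le)
    ultimately show ?thesis using x(2) by force
  qed
  then have le: "c - 1 / real (Suc k) \<le> g w x" for k :: nat by (rule less_imp_le)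
  have "(\<lambda>k. c - 1 / real (Suc k)) \<longlonglongrightarrow> c - 0"
    by (intro tendsto_diff tendsto_const LIMSEQ_inverse_real_of_nat[unfolded inverse_eq_divide])
  then have "c - 0 \<le> g w x"
    by (rule LIMSEQ_le_const2) (use le in blast)
  then show "capped_hit g c N w \<le> u"
    using capped_hit_le[of N x c g w] x(1) u by auto
qed

lemma path_stopping_capped_hit:
  assumes c: "\<And>w. w \<in> cont_paths \<Longrightarrow> continuous_on {0..} (g w)"
    and m: "\<And>t. 0 \<le> t \<Longrightarrow> (\<lambda>w. g w t) \<in> borel_measurable path_space"
    and d: "\<And>t. 0 \<le> t \<Longrightarrow> determined_by (\<lambda>_. t) (\<lambda>w. g w t)" and N: "0 \<le> N"
  shows "path_stopping (capped_hit g c N)"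
  unfolding path_stopping_def
proof (intro conjI ballI)
  show "0 \<le> capped_hit g c N w" for w by (rule capped_hit_bounds[OF N])
  show "capped_hit g c N \<in> borel_measurable path_space"
    unfolding borel_measurable_iff_le
  proof
    fix u :: real
    consider "N \<le> u" | "u < 0" | "0 \<le> u" "u < N" by linarith
    then show "{w \<in> space path_space. capped_hit g c N w \<le> u} \<in> sets path_space"
    proof cases
      case 1
      then have "{w \<in> space path_space. capped_hit g c N w \<le> u} = space path_space"
        using capped_hit_bounds(2)[OF N] order_trans by blast
      then show ?thesis by (simp only: sets.top)
    next
      case 2
      then have "{w \<in> space path_space. capped_hit g c N w \<le> u} = {}"
        using capped_hit_bounds(1)[OF N] by (auto simp: not_le intro: less_le_trans)
      then show ?thesis by (simp only: sets.empty_sets)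
    next
      case 3
      have eq: "{w \<in> space path_space. capped_hit g c N w \<le> u} = {w \<in> space path_space.
          \<forall>k::nat. \<exists>r::rat. 0 \<le> r \<and> r \<le> 1 \<and> c - 1 / real (Suc k) < g w (u * real_of_rat r)}"
        using capped_hit_le_iff[where g=g, OF c 3] by auto
      have [measurable]: "Measurable.pred path_space (\<lambda>w. 0 \<le> r \<and> r \<le> 1 \<and> a < g w (u * real_of_rat r))"
        for r a
        using m[of "u * real_of_rat r"] 3 by (cases "0 \<le> r") auto
      show ?thesis unfolding eq by measurable
    qed
  qed
  show "determined_by (capped_hit g c N) (capped_hit g c N)"
  proof (rule determined_byI)
    fix w w' assume w: "w \<in> cont_paths" "w' \<in> cont_paths"
      and a: "\<And>t. 0 \<le> t \<Longrightarrow> t \<le> capped_hit g c N w \<Longrightarrow> w t = w' t"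
    have eq: "g w t = g w' t" if "0 \<le> t" "t \<le> capped_hit g c N w" for t
      using a that by (intro determined_byD[OF d[OF that(1)] w]) auto
    \<comment> \<open>The earlier of two different hitting times is attained, while the other path
      is still below \<open>c\<close> at that moment; so the two observed values cannot agree
      there.\<close>
    have no: False if less: "capped_hit g c N u < capped_hit g c N v"
      and uv: "u \<in> cont_paths" "g u (capped_hit g c N u) = g v (capped_hit g c N u)" for u v
    proof -
      have "capped_hit g c N u < N"
        using less capped_hit_bounds(2)[OF N, of g c v] by linarith
      then have "c \<le> g u (capped_hit g c N u)"
        by (rule capped_hit_attained[where g=g, OF c[OF uv(1)] N])
      moreover have "g v (capped_hit g c N u) < c"
        by (rule capped_hit_before[OF N capped_hit_bounds(1)[OF N] less])
      ultimately show False using uv(2) by simp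
    qed
    have "\<not> capped_hit g c N w < capped_hit g c N w'"
      using no[of w w'] w(1) eq[of "capped_hit g c N w"] capped_hit_bounds(1)[OF N] by blast
    moreover have "\<not> capped_hit g c N w' < capped_hit g c N w"
      using no[of w' w] w(2) eq[of "capped_hit g c N w'"] capped_hit_bounds(1)[OF N] by force
    ultimately show "capped_hit g c N w = capped_hit g c N w'" by simp
  qed
qed

section \<open>Hitting times of the geometric levels\<close>

definition level_time :: "nat \<Rightarrow> (real \<Rightarrow> real) \<Rightarrow> real" where
  "level_time n = capped_hit (\<lambda>w. w) (4 ^ n) (real n)"

lemma level_time_bounds: "0 \<le> level_time n w" "level_time n w \<le> real n"
  by (simp_all add: level_time_def capped_hit_bounds)

lemma path_stopping_level_time: "path_stopping (level_time n)"
  unfolding level_time_def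
  by (rule path_stopping_capped_hit)
     (auto intro: cont_pathsD measurable_coord_path_space simp: determined_by_def)

lemma level_time_attained:
  "w \<in> cont_paths \<Longrightarrow> level_time n w < real n \<Longrightarrow> 4 ^ n \<le> w (level_time n w)"
  unfolding level_time_def
  by (rule capped_hit_attained[where g="\<lambda>w. w"]) (auto intro: cont_pathsD)

lemma level_time_before: "0 \<le> t \<Longrightarrow> t < level_time n w \<Longrightarrow> w t < 4 ^ n"
  unfolding level_time_def using capped_hit_before[of "real n" t "\<lambda>w. w" "4 ^ n" w] by simp

lemma level_time_upto:
  "w \<in> cont_paths \<Longrightarrow> w 0 = 1 \<Longrightarrow> 0 \<le> t \<Longrightarrow> t \<le> level_time n w \<Longrightarrow> w t \<le> 4 ^ n"
  unfolding level_time_def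
  using capped_hit_upto[of "\<lambda>w. w" w "real n" "4 ^ n" t] by (simp add: cont_pathsD)

lemma level_time_mono:
  assumes "w \<in> cont_paths" "m \<le> n" shows "level_time m w \<le> level_time n w"
proof (rule ccontr)
  assume "\<not> ?thesis"
  then have less: "level_time n w < level_time m w" by simp
  then have "level_time n w < real n" using level_time_bounds(2)[of m w] assms(2) by linarith
  then have "4 ^ n \<le> w (level_time n w)" by (rule level_time_attained[OF assms(1)])
  moreover have "w (level_time n w) < 4 ^ m" using less by (intro level_time_before level_time_bounds)
  moreover have "(4::real) ^ m \<le> 4 ^ n" using assms(2) by (intro power_increasing) auto
  ultimately show False by simp
qed

text \<open>A level above the bound \<open>B\<close> of the path on the interval up to
  \<open>t\<close> is not reached by time \<open>t\<close>, and \<open>t < n\<close> puts the cap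
  beyond \<open>t\<close>. Continuity on the closed interval is what excludes explosion.\<close>

lemma level_time_eventually:
  assumes w: "w \<in> cont_paths" and t: "0 \<le> t"
  shows "\<forall>\<^sub>F n in sequentially. t < level_time n w"
proof -
  have "compact (w ` {0..t})"
    using continuous_on_subset[OF cont_pathsD[OF w], of "{0..t}"] by (intro compact_continuous_image) auto
  then obtain B where B: "\<And>s. s \<in> {0..t} \<Longrightarrow> w s \<le> B"
    by (meson bdd_above_def bounded_imp_bdd_above compact_imp_bounded imageI)
  have "\<forall>\<^sub>F n in sequentially. t < real n"
    using filterlim_real_sequentially by (auto simp: filterlim_at_top_dense)
  moreover have "\<forall>\<^sub>F n in sequentially. B < real n"
    using filterlim_real_sequentially by (auto simp: filterlim_at_top_dense)
  ultimately show ?thesis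
  proof eventually_elim
    case (elim n)
    show ?case
    proof (rule ccontr)
      assume "\<not> ?case"
      then have le: "level_time n w \<le> t" by simp
      then have "4 ^ n \<le> w (level_time n w)" using elim by (intro level_time_attained[OF w]) auto
      also have "\<dots> \<le> B" using le level_time_bounds(1) by (intro B) auto
      also have "\<dots> < real n" by (rule elim)
      also have "real n \<le> 2 ^ n" by (rule of_nat_less_two_power[THEN less_imp_le])
      also have "(2::real) ^ n \<le> 4 ^ n" by (rule power_mono) auto
      finally show False by simp
    qed
  qed
qed

context positive_path_martingale
begin

lemma level_time_bound: "AE w in R. \<forall>t\<in>{0..level_time n w}. w t \<le> 4 ^ n"
  using start AE_space[of R] by eventually_elim (auto intro: level_time_upto)

text \<open>Cutting \<open>f\<close> at \<open>k\<close> reduces to bounded weights, for which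
  optional stopping holds because \<open>X\<close> is bounded by \<open>4 ^ n\<close> up to the
  level time; monotone convergence removes the cut and admits every nonnegative measurable weight
  determined at \<open>S\<close>.\<close>

lemma optional_stopping_level:
  assumes S: "path_stopping S" and le: "\<And>w. w \<in> cont_paths \<Longrightarrow> S w \<le> level_time n w"
    and f: "f \<in> borel_measurable path_space" "determined_by S f"
  shows "(\<integral>\<^sup>+w. ennreal (w (level_time n w)) * f w \<partial>R) = (\<integral>\<^sup>+w. ennreal (w (S w)) * f w \<partial>R)"
proof -
  let ?T = "level_time n"
  have m: "(\<lambda>w. w (U w)) \<in> borel_measurable R" if "path_stopping U" for U
    using measurable_path_at_stopping[OF that] by (simp add: measurable_R_eq)
  have b: "AE w in R. 0 \<le> w (U w) \<and> w (U w) \<le> 4 ^ n"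
    if "path_stopping U" "\<forall>w\<in>cont_paths. U w \<le> ?T w" for U
    using level_time_bound[of n] pos AE_space[of R]
  proof eventually_elim
    case (elim w)
    then have "U w \<in> {0..?T w}" using path_stoppingD(2)[OF that(1)] that(2) by simp
    then show ?case using elim by (auto simp: less_imp_le)
  qed
  define F where "F k w = min (f w) (of_nat k)" for k :: nat and w
  have Fr: "F k w = ennreal (enn2real (F k w))" "enn2real (F k w) \<le> real k" for k w
  proof -
    have "F k w \<le> of_nat k" by (simp add: F_def)
    also have k: "(of_nat k :: ennreal) = ennreal (real k)" by (simp add: ennreal_of_nat_eq_real_of_nat)
    finally have le: "F k w \<le> ennreal (real k)" .
    then show "F k w = ennreal (enn2real (F k w))"
      using le_less_trans[OF le ennreal_less_top] by (simp add: less_top)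
    show "enn2real (F k w) \<le> real k" by (rule enn2real_leI[OF _ le]) simp
  qed
  have Fm: "F k \<in> borel_measurable R" for k
    using f(1) unfolding F_def measurable_R_eq by measurable
  have Fd: "determined_by S (\<lambda>w. enn2real (F k w))" for k
    unfolding F_def by (rule determined_byI) (auto dest: determined_byD[OF f(2)])
  have one: "(\<integral>\<^sup>+w. ennreal (w (U w)) * F k w \<partial>R) = ennreal (\<integral>w. enn2real (F k w) * w (U w) \<partial>R)"
    if U: "path_stopping U" "\<forall>w\<in>cont_paths. U w \<le> ?T w" for U k
  proof -
    have "(\<integral>\<^sup>+w. ennreal (w (U w)) * F k w \<partial>R) = (\<integral>\<^sup>+w. ennreal (enn2real (F k w) * w (U w)) \<partial>R)"
    proof (rule nn_integral_cong_AE)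
      show "AE w in R. ennreal (w (U w)) * F k w = ennreal (enn2real (F k w) * w (U w))"
        using b[OF U] by eventually_elim (subst Fr(1), simp add: ennreal_mult' mult.commute)
    qed
    also have "\<dots> = ennreal (\<integral>w. enn2real (F k w) * w (U w) \<partial>R)"
    proof (rule nn_integral_eq_integral)
      have "AE w in R. norm (enn2real (F k w) * w (U w)) \<le> real k * 4 ^ n"
        using b[OF U]
      proof eventually_elim
        case (elim w)
        then show ?case using Fr(2)[of k w] by (simp add: abs_mult mult_mono)
      qed
      then show "integrable R (\<lambda>w. enn2real (F k w) * w (U w))"
        by (intro integrable_const_bound) (use m[OF U(1)] Fm in measurable)
      show "AE w in R. 0 \<le> enn2real (F k w) * w (U w)"
        using b[OF U] by eventually_elim simp
    qed
    finally show ?thesis .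
  qed
  have step: "(\<integral>\<^sup>+w. ennreal (w (?T w)) * F k w \<partial>R) = (\<integral>\<^sup>+w. ennreal (w (S w)) * F k w \<partial>R)" for k
  proof -
    have "(\<integral>w. enn2real (F k w) * w (S w) \<partial>R) = (\<integral>w. enn2real (F k w) * w (?T w) \<partial>R)"
      by (rule optional_stopping_bounded[OF S path_stopping_level_time le level_time_bounds(2) _ Fd _ level_time_bound])
         (use Fm Fr(2) in \<open>auto simp: measurable_R_eq\<close>)
    then show ?thesis
      using one[OF S] le one[OF path_stopping_level_time] by simp
  qed
  have sup: "(\<integral>\<^sup>+w. ennreal (w (U w)) * f w \<partial>R) = (SUP k. \<integral>\<^sup>+w. ennreal (w (U w)) * F k w \<partial>R)"
    if U: "path_stopping U" for U
  proof -
    have "f w = (SUP k. F k w)" for w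
    proof -
      have "(SUP k. F k w) = min (f w) (SUP k. of_nat k)"
        unfolding F_def inf_min[symmetric] by (rule inf_SUP[symmetric])
      then show ?thesis by (simp add: ennreal_SUP_of_nat_eq_top)
    qed
    then have "(\<integral>\<^sup>+w. ennreal (w (U w)) * f w \<partial>R) = (\<integral>\<^sup>+w. (SUP k. ennreal (w (U w)) * F k w) \<partial>R)"
      by (simp add: SUP_mult_left_ennreal)
    also have "\<dots> = (SUP k. \<integral>\<^sup>+w. ennreal (w (U w)) * F k w \<partial>R)"
    proof (rule nn_integral_monotone_convergence_SUP)
      show "incseq (\<lambda>k w. ennreal (w (U w)) * F k w)"
        unfolding F_def by (intro incseq_SucI le_funI mult_left_mono min.mono of_nat_mono) auto
      show "(\<lambda>w. ennreal (w (U w)) * F k w) \<in> borel_measurable R" for k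
        using m[OF U] Fm by measurable
    qed
    finally show ?thesis .
  qed
  show ?thesis
    unfolding sup[OF S] sup[OF path_stopping_level_time] by (simp add: step)
qed

end

section \<open>The changed measures up to the level times and their projective limit\<close>

text \<open>Negative rationals are sent to time 0, so that the values live in the full function type
  \<open>rat => real\<close>, which carries a Polish topology.\<close>

definition stopped_recip :: "nat \<Rightarrow> (real \<Rightarrow> real) \<Rightarrow> rat \<Rightarrow> real" where
  "stopped_recip n w q = 1 / w (min (max 0 (real_of_rat q)) (level_time n w))"

lemma determined_by_comp:
  assumes "determined_by S f" shows "determined_by S (\<lambda>w. g (f w))"
proof (rule determined_byI)
  fix w w' assume "w \<in> cont_paths" "w' \<in> cont_paths" "\<And>t. 0 \<le> t \<Longrightarrow> t \<le> S w \<Longrightarrow> w t = w' t"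
  then have "f w = f w'" by (rule determined_byD[OF assms])
  then show "g (f w) = g (f w')" by simp
qed

lemma determined_by_path_at:
  assumes "path_stopping U" shows "determined_by U (\<lambda>w. w (U w))"
proof (rule determined_byI)
  fix w w' assume w: "w \<in> cont_paths" "w' \<in> cont_paths" and a: "\<And>t. 0 \<le> t \<Longrightarrow> t \<le> U w \<Longrightarrow> w t = w' t"
  have "U w = U w'" by (rule determined_byD[OF path_stoppingD(3)[OF assms] w a])
  then show "w (U w) = w' (U w')" using a[OF path_stoppingD(2)[OF assms w(1)]] by simp
qed

lemma path_stopping_min_level: "0 \<le> t \<Longrightarrow> path_stopping (\<lambda>w. min t (level_time n w))"
  by (intro path_stopping_min[where S="\<lambda>_. t"] path_stopping_const path_stopping_level_time)

lemma measurable_stopped_recip: "stopped_recip n \<in> borel_measurable path_space"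
  unfolding stopped_recip_def
  by (intro measurable_coordinatewise_then_product borel_measurable_divide borel_measurable_const
      measurable_path_at_stopping path_stopping_min_level) simp

lemma determined_by_stopped_recip: "determined_by (level_time n) (stopped_recip n)"
proof (rule determined_byI, rule ext)
  fix w w' q assume w: "w \<in> cont_paths" "w' \<in> cont_paths" and a: "\<And>t. 0 \<le> t \<Longrightarrow> t \<le> level_time n w \<Longrightarrow> w t = w' t"
  have "w (min (max 0 (real_of_rat q)) (level_time n w)) = w' (min (max 0 (real_of_rat q)) (level_time n w'))"
    by (rule determined_byD[OF determined_by_path_at[OF path_stopping_min_level] w]) (use a in auto)
  then show "stopped_recip n w q = stopped_recip n w' q" by (simp add: stopped_recip_def)
qed

context positive_path_martingale
begin

definition level_law :: "nat \<Rightarrow> (real \<Rightarrow> real) measure" where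
  "level_law n = density R (\<lambda>w. ennreal (w (level_time n w)))"

lemma sets_level_law [measurable_cong, simp]: "sets (level_law n) = sets path_space"
  by (simp add: level_law_def)

lemma space_level_law [simp]: "space (level_law n) = cont_paths"
  by (simp add: level_law_def)

lemma measurable_level_law_eq: "measurable (level_law n) N = measurable path_space N"
  by (rule measurable_cong_sets) auto

lemma measurable_level_density: "(\<lambda>w. ennreal (w (level_time n w))) \<in> borel_measurable R"
  using measurable_path_at_stopping[OF path_stopping_level_time, of n] by (simp add: measurable_R_eq)

lemma nn_integral_level_law:
  "f \<in> borel_measurable path_space \<Longrightarrow>
    (\<integral>\<^sup>+w. f w \<partial>level_law n) = (\<integral>\<^sup>+w. ennreal (w (level_time n w)) * f w \<partial>R)"
  unfolding level_law_def
  by (rule nn_integral_density) (use measurable_level_density in \<open>auto simp: measurable_R_eq\<close>)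

text \<open>The times \<open>S\<close> and 0 are both compared with the level time, and the path
  starts at one.\<close>

lemma expectation_at_level: 
  assumes S: "path_stopping S" and le: "\<And>w. w \<in> cont_paths \<Longrightarrow> S w \<le> level_time n w"
  shows "(\<integral>\<^sup>+w. ennreal (w (S w)) \<partial>R) = 1"
proof -
  have one: "determined_by U (\<lambda>_. 1::ennreal)" for U by (rule determined_byI) simp
  have "(\<integral>\<^sup>+w. ennreal (w (S w)) \<partial>R) = (\<integral>\<^sup>+w. ennreal (w (level_time n w)) \<partial>R)"
    using optional_stopping_level[OF S le _ one] by simp
  also have "\<dots> = (\<integral>\<^sup>+w. ennreal (w 0) \<partial>R)"
    using optional_stopping_level[OF path_stopping_const level_time_bounds(1) _ one, of n] by simp
  also have "\<dots> = (\<integral>\<^sup>+w. 1 \<partial>R)"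
    by (rule nn_integral_cong_AE) (use start in eventually_elim, simp)
  finally show ?thesis using emeasure_space_1 by simp
qed

lemma prob_space_level_law: "prob_space (level_law n)"
proof (rule prob_spaceI)
  have "emeasure (level_law n) (space (level_law n)) = (\<integral>\<^sup>+w. 1 \<partial>level_law n)" by simp
  also have "\<dots> = (\<integral>\<^sup>+w. ennreal (w (level_time n w)) \<partial>R)"
    using nn_integral_level_law[of "\<lambda>_. 1" n] by simp
  also have "\<dots> = 1" by (rule expectation_at_level[OF path_stopping_level_time, of n n]) simp
  finally show "emeasure (level_law n) (space (level_law n)) = 1" .
qed

text \<open>Functionals of the path up to \<open>level_time m\<close> do not distinguish the density
  at level \<open>n\<close> from the one at level \<open>m\<close>; this is optional stopping
  between the two level times.\<close>

lemma level_law_consistent: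
  assumes F: "F \<in> measurable path_space N" "determined_by (level_time m) F" and mn: "m \<le> n"
  shows "distr (level_law n) N F = distr (level_law m) N F"
proof (rule measure_eqI)
  fix A assume "A \<in> sets (distr (level_law n) N F)"
  then have A: "A \<in> sets N" by simp
  define f :: "(real \<Rightarrow> real) \<Rightarrow> ennreal" where "f w = indicator A (F w)" for w
  have f: "f \<in> borel_measurable path_space" unfolding f_def
    by (rule measurable_compose[OF F(1) borel_measurable_indicator[OF A]])
  have fd: "determined_by (level_time m) f"
    unfolding f_def by (rule determined_by_comp[OF F(2)])
  have e: "emeasure (distr (level_law k) N F) A = (\<integral>\<^sup>+w. f w \<partial>level_law k)" for k
  proof -
    have F': "F \<in> measurable (level_law k) N"
      using F(1) by (simp only: measurable_level_law_eq)
    have "emeasure (distr (level_law k) N F) A = (\<integral>\<^sup>+y. indicator A y \<partial>distr (level_law k) N F)"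
      using A by simp
    also have "\<dots> = (\<integral>\<^sup>+w. f w \<partial>level_law k)"
      unfolding f_def by (rule nn_integral_distr[OF F']) (use A in simp)
    finally show ?thesis .
  qed
  show "emeasure (distr (level_law n) N F) A = emeasure (distr (level_law m) N F) A"
    unfolding e nn_integral_level_law[OF f]
    by (rule optional_stopping_level[OF path_stopping_level_time level_time_mono[OF _ mn] f fd])
qed simp

text \<open>By consistency every level that bounds the indices in \<open>J\<close> gives the same
  law. The inserted 0 makes the maximum meaningful when \<open>J\<close> is empty.\<close>

definition finite_dim_law :: "nat set \<Rightarrow> (nat \<Rightarrow> rat \<Rightarrow> real) measure" where
  "finite_dim_law J = distr (level_law (Max (insert 0 J))) (PiM J (\<lambda>_. borel)) (\<lambda>w. \<lambda>i\<in>J. stopped_recip i w)"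

lemma measurable_stopped_recip_family:
  "(\<lambda>w. \<lambda>i\<in>J. stopped_recip i w) \<in> measurable path_space (PiM J (\<lambda>_. borel))"
  by (rule measurable_restrict) (rule measurable_stopped_recip)

lemma finite_dim_law_eq:
  assumes J: "finite J" "\<And>i. i \<in> J \<Longrightarrow> i \<le> n"
  shows "finite_dim_law J = distr (level_law n) (PiM J (\<lambda>_. borel)) (\<lambda>w. \<lambda>i\<in>J. stopped_recip i w)"
proof -
  let ?m = "Max (insert 0 J)"
  have "determined_by (level_time ?m) (\<lambda>w. \<lambda>i\<in>J. stopped_recip i w)"
  proof (rule determined_byI, rule restrict_ext)
    fix w w' i assume w: "w \<in> cont_paths" "w' \<in> cont_paths"
      and a: "\<And>t. 0 \<le> t \<Longrightarrow> t \<le> level_time ?m w \<Longrightarrow> w t = w' t" and i: "i \<in> J"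
    have "level_time i w \<le> level_time ?m w"
      using J(1) i by (intro level_time_mono[OF w(1)] Max_ge) auto
    then show "stopped_recip i w = stopped_recip i w'"
      by (intro determined_byD[OF determined_by_stopped_recip w] a) auto
  qed
  moreover have "?m \<le> n" using J by auto
  ultimately show ?thesis
    unfolding finite_dim_law_def
    by (intro level_law_consistent[symmetric] measurable_stopped_recip_family)
qed

text \<open>Dropping indices changes only the level at which the law is taken, and
  \<open>finite_dim_law_eq\<close> allows any sufficiently high level.\<close>

lemma polish_projective_finite_dim_law: "polish_projective UNIV finite_dim_law"
proof (unfold polish_projective_def, rule projective_family.intro)
  have m: "(\<lambda>w. \<lambda>i\<in>J. stopped_recip i w) \<in> measurable (level_law n) (PiM J (\<lambda>_. borel))" for J n
    using measurable_stopped_recip_family by (simp only: measurable_level_law_eq)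
  show "finite_dim_law J = distr (finite_dim_law H) (PiM J (\<lambda>_. borel)) (\<lambda>f. restrict f J)"
    if JH: "J \<subseteq> H" "finite H" for J H
  proof -
    let ?n = "Max (insert 0 H)"
    have "distr (finite_dim_law H) (PiM J (\<lambda>_. borel)) (\<lambda>f. restrict f J) =
        distr (level_law ?n) (PiM J (\<lambda>_. borel)) ((\<lambda>f. restrict f J) \<circ> (\<lambda>w. \<lambda>i\<in>H. stopped_recip i w))"
      unfolding finite_dim_law_def by (rule distr_distr[OF measurable_restrict_subset[OF JH(1)] m])
    also have "(\<lambda>f. restrict f J) \<circ> (\<lambda>w. \<lambda>i\<in>H. stopped_recip i w) = (\<lambda>w. \<lambda>i\<in>J. stopped_recip i w)"
      using JH(1) by (auto simp: fun_eq_iff)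
    also have "distr (level_law ?n) (PiM J (\<lambda>_. borel)) (\<lambda>w. \<lambda>i\<in>J. stopped_recip i w) = finite_dim_law J"
      using JH finite_subset by (intro finite_dim_law_eq[symmetric]) auto
    finally show ?thesis by (rule sym)
  qed
  show "prob_space (finite_dim_law J)" for J
    unfolding finite_dim_law_def by (rule prob_space.prob_space_distr[OF prob_space_level_law m])
qed

definition limit_law :: "(nat \<Rightarrow> rat \<Rightarrow> real) measure" where
  "limit_law = projective_family.lim UNIV finite_dim_law (\<lambda>_. borel)"

lemma prob_space_limit_law: "prob_space limit_law"
proof -
  interpret polish_projective UNIV finite_dim_law by (rule polish_projective_finite_dim_law)
  show ?thesis unfolding limit_law_def by (rule P.prob_space_axioms)
qed

lemma sets_limit_law [measurable_cong, simp]: "sets limit_law = sets (PiM UNIV (\<lambda>_. borel))"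
proof -
  interpret polish_projective UNIV finite_dim_law by (rule polish_projective_finite_dim_law)
  show ?thesis unfolding limit_law_def by simp
qed

lemma space_limit_law [simp]: "space limit_law = UNIV"
  using sets_eq_imp_space_eq[OF sets_limit_law] by (simp add: space_PiM)

text \<open>Later arguments compare only two stopped reciprocals at a time, so the projective limit
  is accessed through its marginals on \<open>{m, n}\<close>.\<close>

lemma limit_law_pair:
  assumes mn: "m \<le> n"
  shows "distr limit_law (borel \<Otimes>\<^sub>M borel) (\<lambda>x. (x m, x n)) =
    distr (level_law n) (borel \<Otimes>\<^sub>M borel) (\<lambda>w. (stopped_recip m w, stopped_recip n w))"
proof -
  interpret polish_projective UNIV finite_dim_law by (rule polish_projective_finite_dim_law)
  let ?J = "{m, n}" and ?B = "borel \<Otimes>\<^sub>M borel :: ((rat \<Rightarrow> real) \<times> (rat \<Rightarrow> real)) measure"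
  have r: "(\<lambda>x. restrict x ?J) \<in> measurable lim (PiM ?J (\<lambda>_. borel))"
    using measurable_restrict_subset[of ?J UNIV "\<lambda>_. borel"]
    by (simp add: measurable_cong_sets[OF sets_lim])
  have J: "distr lim (PiM ?J (\<lambda>_. borel)) (\<lambda>x. restrict x ?J) = finite_dim_law ?J"
  proof (rule measure_eqI)
    fix A assume "A \<in> sets (distr lim (PiM ?J (\<lambda>_. borel)) (\<lambda>x. restrict x ?J))"
    then have A: "A \<in> sets (PiM ?J (\<lambda>_. borel))" by simp
    have "emeasure (distr lim (PiM ?J (\<lambda>_. borel)) (\<lambda>x. restrict x ?J)) A =
        emeasure lim ((\<lambda>x. restrict x ?J) -` A \<inter> space lim)"
      by (rule emeasure_distr[OF r A])
    also have "(\<lambda>x. restrict x ?J) -` A \<inter> space lim = emb UNIV ?J A"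
      by (simp add: prod_emb_def space_PiM)
    also have "emeasure lim (emb UNIV ?J A) = emeasure (finite_dim_law ?J) A"
      by (rule emeasure_lim_emb) (use A in auto)
    finally show "emeasure (distr lim (PiM ?J (\<lambda>_. borel)) (\<lambda>x. restrict x ?J)) A = emeasure (finite_dim_law ?J) A" .
  qed (simp add: finite_dim_law_def)
  have p: "(\<lambda>x. (x m, x n)) \<in> measurable (PiM ?J (\<lambda>_. borel)) ?B" by measurable
  have "distr limit_law ?B (\<lambda>x. (x m, x n)) = distr lim ?B ((\<lambda>x. (x m, x n)) \<circ> (\<lambda>x. restrict x ?J))"
    unfolding limit_law_def by (simp add: comp_def)
  also have "\<dots> = distr (distr lim (PiM ?J (\<lambda>_. borel)) (\<lambda>x. restrict x ?J)) ?B (\<lambda>x. (x m, x n))"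
    by (rule distr_distr[OF p r, symmetric])
  also have "\<dots> = distr (distr (level_law n) (PiM ?J (\<lambda>_. borel)) (\<lambda>w. \<lambda>i\<in>?J. stopped_recip i w)) ?B (\<lambda>x. (x m, x n))"
    unfolding J using mn by (subst finite_dim_law_eq[of ?J n]) auto
  also have "\<dots> = distr (level_law n) ?B ((\<lambda>x. (x m, x n)) \<circ> (\<lambda>w. \<lambda>i\<in>?J. stopped_recip i w))"
    by (rule distr_distr[OF p]) (use measurable_stopped_recip_family in \<open>simp only: measurable_level_law_eq\<close>)
  finally show ?thesis by (simp add: comp_def)
qed

lemma measurable_stopped_recip_pair:
  "(\<lambda>w. (stopped_recip m w, stopped_recip n w)) \<in> measurable path_space (borel \<Otimes>\<^sub>M borel)"
  using measurable_stopped_recip by measurable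

lemma nn_integral_limit_pair:
  assumes mn: "m \<le> n" and g: "g \<in> borel_measurable (borel \<Otimes>\<^sub>M borel)"
  shows "(\<integral>\<^sup>+x. g (x m, x n) \<partial>limit_law) =
    (\<integral>\<^sup>+w. ennreal (w (level_time n w)) * g (stopped_recip m w, stopped_recip n w) \<partial>R)"
proof -
  have "(\<integral>\<^sup>+x. g (x m, x n) \<partial>limit_law) = (\<integral>\<^sup>+p. g p \<partial>distr limit_law (borel \<Otimes>\<^sub>M borel) (\<lambda>x. (x m, x n)))"
    by (rule nn_integral_distr[symmetric]) (use g in measurable)
  also have "\<dots> = (\<integral>\<^sup>+w. g (stopped_recip m w, stopped_recip n w) \<partial>level_law n)"
    unfolding limit_law_pair[OF mn]
    by (rule nn_integral_distr)
       (use g measurable_stopped_recip_pair in \<open>simp_all only: measurable_level_law_eq measurable_distr_eq1\<close>)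
  also have "\<dots> = (\<integral>\<^sup>+w. ennreal (w (level_time n w)) * g (stopped_recip m w, stopped_recip n w) \<partial>R)"
    by (rule nn_integral_level_law) (rule measurable_compose[OF measurable_stopped_recip_pair g])
  finally show ?thesis .
qed

text \<open>The level law has a density with respect to \<open>R\<close>, so relations between two
  stopped reciprocals that hold \<open>R\<close>-almost surely pass to the limit space.\<close>

lemma AE_limit_pair:
  assumes mn: "m \<le> n" and P: "Measurable.pred (borel \<Otimes>\<^sub>M borel) P"
    and ae: "AE w in R. P (stopped_recip m w, stopped_recip n w)"
  shows "AE x in limit_law. P (x m, x n)"
proof -
  define g :: "_ \<Rightarrow> ennreal" where "g p = (if P p then 0 else 1)" for p
  have g: "g \<in> borel_measurable (borel \<Otimes>\<^sub>M borel)" unfolding g_def using P by measurable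
  have "(\<integral>\<^sup>+x. g (x m, x n) \<partial>limit_law) = (\<integral>\<^sup>+w. 0 \<partial>R)"
    unfolding nn_integral_limit_pair[OF mn g]
    by (rule nn_integral_cong_AE) (use ae in eventually_elim, simp add: g_def)
  moreover have "(\<lambda>x. g (x m, x n)) \<in> borel_measurable limit_law"
    using g by measurable
  ultimately have "AE x in limit_law. g (x m, x n) = 0"
    by (simp add: nn_integral_0_iff_AE)
  then show ?thesis by eventually_elim (simp add: g_def split: if_splits)
qed

end

section \<open>Extending paths from the rationals\<close>

text \<open>Uniform continuity on bounded sets of nonnegative rationals, written with countable
  quantifiers so that it is a Borel condition.\<close>

definition rat_uc :: "(rat \<Rightarrow> real) \<Rightarrow> bool" where
  "rat_uc x \<longleftrightarrow> (\<forall>N k::nat. \<exists>m::nat. \<forall>q r. 0 \<le> q \<longrightarrow> 0 \<le> r \<longrightarrow> q \<le> of_nat N \<longrightarrow> r \<le> of_nat N \<longrightarrow>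
     \<bar>real_of_rat q - real_of_rat r\<bar> < 1 / real (Suc m) \<longrightarrow> \<bar>x q - x r\<bar> < 1 / real (Suc k))"

definition dyadic_rat :: "nat \<Rightarrow> real \<Rightarrow> rat" where
  "dyadic_rat k s = of_int \<lfloor>2 ^ k * s\<rfloor> / 2 ^ k"

text \<open>The constant default path keeps every value in \<open>cont_paths\<close>, so the map is
  measurable into \<open>path_space\<close> on the whole space and not only off a null set.\<close>

definition rat_ext :: "(rat \<Rightarrow> real) \<Rightarrow> real \<Rightarrow> real" where
  "rat_ext x = (if rat_uc x then (\<lambda>t\<in>{0..}. lim (\<lambda>k. x (dyadic_rat k t))) else (\<lambda>t\<in>{0..}. 1))"

lemma of_rat_dyadic_rat: "real_of_rat (dyadic_rat k s) = dyadic_floor k s"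
  by (simp add: dyadic_rat_def dyadic_floor_rat)

lemma dyadic_rat_nonneg: "0 \<le> s \<Longrightarrow> 0 \<le> dyadic_rat k s"
  by (simp add: dyadic_rat_def)

lemma dyadic_rat_le: "s \<le> real N \<Longrightarrow> dyadic_rat k s \<le> of_nat N"
  using dyadic_floor_bounds(1)[of k s]
  by (metis (no_types, opaque_lifting) of_rat_dyadic_rat of_rat_less_eq of_rat_of_nat_eq order_trans)

lemma dyadic_rat_close:
  assumes "\<bar>s - t\<bar> < d"
  shows "\<forall>\<^sub>F k in sequentially. \<bar>real_of_rat (dyadic_rat k s) - real_of_rat (dyadic_rat k t)\<bar> < d"
proof -
  have "(\<lambda>k. \<bar>real_of_rat (dyadic_rat k s) - real_of_rat (dyadic_rat k t)\<bar>) \<longlonglongrightarrow> \<bar>s - t\<bar>"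
    unfolding of_rat_dyadic_rat by (intro tendsto_rabs tendsto_diff dyadic_floor_tendsto)
  then show ?thesis using assms by (rule order_tendstoD(2))
qed

lemma rat_uc_convergent:
  assumes uc: "rat_uc x" and t: "0 \<le> t" shows "(\<lambda>k. x (dyadic_rat k t)) \<longlonglongrightarrow> lim (\<lambda>k. x (dyadic_rat k t))"
proof -
  obtain N :: nat where N: "t \<le> real N" using real_arch_simple by blast
  have "Cauchy (\<lambda>k. x (dyadic_rat k t))"
  proof (rule metric_CauchyI)
    fix e :: real assume "0 < e"
    then obtain k where k: "1 / real (Suc k) < e" using nat_approx_posE by blast
    obtain m where m: "\<And>q r. \<lbrakk>0 \<le> q; 0 \<le> r; q \<le> of_nat N; r \<le> of_nat N;
        \<bar>real_of_rat q - real_of_rat r\<bar> < 1 / real (Suc m)\<rbrakk> \<Longrightarrow> \<bar>x q - x r\<bar> < 1 / real (Suc k)"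
      using uc unfolding rat_uc_def by meson
    have "Cauchy (\<lambda>k. dyadic_floor k t)"
      by (rule LIMSEQ_imp_Cauchy[OF dyadic_floor_tendsto])
    then obtain M where M: "\<And>i j. i \<ge> M \<Longrightarrow> j \<ge> M \<Longrightarrow> dist (dyadic_floor i t) (dyadic_floor j t) < 1 / real (Suc m)"
      using metric_CauchyD[of "\<lambda>k. dyadic_floor k t" "1 / real (Suc m)"] by auto
    show "\<exists>M. \<forall>i\<ge>M. \<forall>j\<ge>M. dist (x (dyadic_rat i t)) (x (dyadic_rat j t)) < e"
    proof (intro exI allI impI)
      fix i j assume "i \<ge> M" "j \<ge> M"
      then have "\<bar>x (dyadic_rat i t) - x (dyadic_rat j t)\<bar> < 1 / real (Suc k)"
        using M by (intro m dyadic_rat_nonneg dyadic_rat_le t N)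
          (simp add: of_rat_dyadic_rat dist_real_def)
      then show "dist (x (dyadic_rat i t)) (x (dyadic_rat j t)) < e" using k by (simp add: dist_real_def)
    qed
  qed
  then show ?thesis using convergent_LIMSEQ_iff real_Cauchy_convergent by blast
qed

lemma rat_ext_in_cont_paths: "rat_ext x \<in> cont_paths"
proof (cases "rat_uc x")
  case uc: True
  let ?y = "\<lambda>t. lim (\<lambda>k. x (dyadic_rat k t))"
  have "continuous_on {0..} ?y"
    unfolding continuous_on_iff
  proof (intro ballI allI impI)
    fix t e :: real assume t: "t \<in> {0..}" and "0 < e"
    then obtain k where k: "1 / real (Suc k) < e" using nat_approx_posE by blast
    \<comment> \<open>Every modulus \<open>1 / (m + 1)\<close> is at most 1, so \<open>N\<close>
      also bounds all times that are compared with \<open>t\<close>.\<close>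
    obtain N :: nat where N: "t + 1 \<le> real N" using real_arch_simple by blast
    obtain m where m: "\<And>q r. \<lbrakk>0 \<le> q; 0 \<le> r; q \<le> of_nat N; r \<le> of_nat N;
        \<bar>real_of_rat q - real_of_rat r\<bar> < 1 / real (Suc m)\<rbrakk> \<Longrightarrow> \<bar>x q - x r\<bar> < 1 / real (Suc k)"
      using uc unfolding rat_uc_def by meson
    show "\<exists>d>0. \<forall>s\<in>{0..}. dist s t < d \<longrightarrow> dist (?y s) (?y t) < e"
    proof (intro exI[of _ "1 / real (Suc m)"] conjI ballI impI)
      fix s :: real assume s: "s \<in> {0..}" "dist s t < 1 / real (Suc m)"
      then have st: "\<bar>s - t\<bar> < 1 / real (Suc m)" by (simp add: dist_real_def)
      have "1 / real (Suc m) \<le> 1" by simp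
      then have sN: "s \<le> real N" "t \<le> real N" using st N by linarith+
      have "(\<lambda>k. \<bar>x (dyadic_rat k s) - x (dyadic_rat k t)\<bar>) \<longlonglongrightarrow> \<bar>?y s - ?y t\<bar>"
        using s t by (intro tendsto_rabs tendsto_diff rat_uc_convergent[OF uc]) auto
      moreover have "\<forall>\<^sub>F i in sequentially. \<bar>x (dyadic_rat i s) - x (dyadic_rat i t)\<bar> \<le> 1 / real (Suc k)"
        using dyadic_rat_close[OF st]
      proof eventually_elim
        case (elim i)
        show ?case
          by (rule less_imp_le, rule m) (use s t sN elim in \<open>auto intro: dyadic_rat_nonneg dyadic_rat_le\<close>)
      qed
      ultimately have "\<bar>?y s - ?y t\<bar> \<le> 1 / real (Suc k)"
        by (rule tendsto_upperbound) simp
      then show "dist (?y s) (?y t) < e" using k by (simp add: dist_real_def)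
    qed simp
  qed
  then have "continuous_on {0..} (rat_ext x)"
    by (rule continuous_on_eq) (simp add: rat_ext_def uc)
  then show ?thesis by (simp add: cont_paths_def rat_ext_def uc)
next
  case False
  have "continuous_on {0..} (rat_ext x)"
    by (rule continuous_on_eq[OF continuous_on_const[of _ 1]]) (simp add: rat_ext_def False)
  then show ?thesis by (simp add: cont_paths_def rat_ext_def False)
qed

lemma measurable_rat_uc: "Measurable.pred borel rat_uc"
proof -
  have "Measurable.pred borel (\<lambda>x :: rat \<Rightarrow> real. \<bar>x q - x r\<bar> < c)" for q r c
    by measurable
  then show ?thesis unfolding rat_uc_def by measurable
qed

lemma measurable_rat_ext: "rat_ext \<in> measurable borel path_space"
proof (rule measurable_into_path_space)
  show "rat_ext x \<in> cont_paths" for x by (rule rat_ext_in_cont_paths)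
  fix s :: real assume s: "0 \<le> s"
  have "(\<lambda>x :: rat \<Rightarrow> real. lim (\<lambda>k. x (dyadic_rat k s))) \<in> borel_measurable borel"
    by (rule borel_measurable_lim_metric) measurable
  then have "(\<lambda>x. if rat_uc x then lim (\<lambda>k. x (dyadic_rat k s)) else 1) \<in> borel_measurable borel"
    using measurable_rat_uc by measurable
  also have "(\<lambda>x. if rat_uc x then lim (\<lambda>k. x (dyadic_rat k s)) else 1) = (\<lambda>x. rat_ext x s)"
    using s by (auto simp: rat_ext_def)
  finally show "(\<lambda>x. rat_ext x s) \<in> borel_measurable borel" .
qed

lemma rat_ext_tendsto:
  assumes "rat_uc x" "0 \<le> s" shows "(\<lambda>k. x (dyadic_rat k s)) \<longlonglongrightarrow> rat_ext x s"
  using rat_uc_convergent[OF assms] assms by (simp add: rat_ext_def)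

text \<open>Dyadic floors approximate from the left, so the extension up to \<open>t\<close> reads
  only rationals not beyond \<open>t\<close>. This keeps the extension adapted.\<close>

lemma rat_ext_eq_path:
  assumes uc: "rat_uc x" and y: "y \<in> cont_paths" and s: "0 \<le> s" "s \<le> t"
    and eq: "\<And>q. 0 \<le> q \<Longrightarrow> real_of_rat q \<le> t \<Longrightarrow> x q = y (real_of_rat q)"
  shows "rat_ext x s = y s"
proof (rule LIMSEQ_unique[OF rat_ext_tendsto[OF uc s(1)]])
  have "x (dyadic_rat k s) = y (dyadic_floor k s)" for k
    using eq[of "dyadic_rat k s"] dyadic_rat_nonneg[OF s(1)] dyadic_floor_bounds(1)[of k s] s(2)
    by (simp add: of_rat_dyadic_rat)
  then show "(\<lambda>k. x (dyadic_rat k s)) \<longlonglongrightarrow> y s"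
    using path_tendsto_within[OF y dyadic_floor_nonneg[OF s(1)] dyadic_floor_tendsto s(1)] by simp
qed

lemma rat_ext_agree:
  assumes "rat_uc x" "rat_uc x'" and s: "0 \<le> s" "s \<le> t"
    and eq: "\<And>q. 0 \<le> q \<Longrightarrow> real_of_rat q \<le> t \<Longrightarrow> x q = x' q"
  shows "rat_ext x s = rat_ext x' s"
proof -
  have "x (dyadic_rat k s) = x' (dyadic_rat k s)" for k
    using eq[of "dyadic_rat k s"] dyadic_rat_nonneg[OF s(1)] dyadic_floor_bounds(1)[of k s] s(2)
    by (simp add: of_rat_dyadic_rat)
  then show ?thesis
    using LIMSEQ_unique[OF rat_ext_tendsto[OF assms(1) s(1)]] rat_ext_tendsto[OF assms(2) s(1)] by simp
qed

lemma rat_uc_of_continuous: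
  assumes c: "continuous_on {0..} h" and x: "\<And>q. 0 \<le> q \<Longrightarrow> x q = h (real_of_rat q)"
  shows "rat_uc x"
  unfolding rat_uc_def
proof (intro allI)
  fix N k :: nat
  have "uniformly_continuous_on {0..real N} h"
    by (rule compact_uniformly_continuous[OF continuous_on_subset[OF c]]) auto
  then obtain d where d: "0 < d" "\<And>s t. s \<in> {0..real N} \<Longrightarrow> t \<in> {0..real N} \<Longrightarrow> dist s t < d \<Longrightarrow>
      dist (h s) (h t) < 1 / real (Suc k)"
    using uniformly_continuous_onE[of "{0..real N}" h "1 / real (Suc k)"] by (auto simp: dist_commute)
  obtain m where m: "1 / real (Suc m) < d" using nat_approx_posE[OF d(1)] by blast
  show "\<exists>m::nat. \<forall>q r. 0 \<le> q \<longrightarrow> 0 \<le> r \<longrightarrow> q \<le> of_nat N \<longrightarrow> r \<le> of_nat N \<longrightarrow>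
     \<bar>real_of_rat q - real_of_rat r\<bar> < 1 / real (Suc m) \<longrightarrow> \<bar>x q - x r\<bar> < 1 / real (Suc k)"
  proof (intro exI allI impI)
    fix q r :: rat
    assume qr: "0 \<le> q" "0 \<le> r" "q \<le> of_nat N" "r \<le> of_nat N"
      "\<bar>real_of_rat q - real_of_rat r\<bar> < 1 / real (Suc m)"
    have le: "real_of_rat p \<le> real N" if "p \<le> of_nat N" for p
      using that by (metis of_rat_less_eq of_rat_of_nat_eq)
    have "dist (h (real_of_rat q)) (h (real_of_rat r)) < 1 / real (Suc k)"
      by (rule d(2)) (use qr m le in \<open>auto simp: dist_real_def\<close>)
    then show "\<bar>x q - x r\<bar> < 1 / real (Suc k)" using qr x by (simp add: dist_real_def)
  qed
qed

lemma geometric_increments_converge: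
  fixes a :: "nat \<Rightarrow> real"
  assumes inc: "\<And>n. n0 \<le> n \<Longrightarrow> \<bar>a (Suc n) - a n\<bar> \<le> 1 / 2 ^ n"
  shows "a \<longlonglongrightarrow> lim a" "\<And>n. n0 \<le> n \<Longrightarrow> \<bar>a n - lim a\<bar> \<le> 2 / 2 ^ n"
proof -
  have "summable (\<lambda>n. (1 / 2 :: real) ^ n)" by (rule summable_geometric) simp
  then have "summable (\<lambda>n. a (Suc n) - a n)"
    by (rule summable_comparison_test_ev[rotated])
       (use inc in \<open>auto simp: eventually_sequentially power_one_over\<close>)
  then have "(\<lambda>n. \<Sum>k<n. a (Suc k) - a k) \<longlonglongrightarrow> (\<Sum>k. a (Suc k) - a k)" by (rule summable_LIMSEQ)
  then have "(\<lambda>n. (a n - a 0) + a 0) \<longlonglongrightarrow> (\<Sum>k. a (Suc k) - a k) + a 0"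
    by (intro tendsto_add tendsto_const) (simp add: sum_lessThan_telescope)
  then have "convergent a" unfolding convergent_def by auto
  then show lim: "a \<longlonglongrightarrow> lim a" by (simp add: convergent_LIMSEQ_iff)
  fix n assume n: "n0 \<le> n"
  \<comment> \<open>The subtracted term makes the bound telescope, which lets the induction go
    through.\<close>
  have step: "\<bar>a n - a (n + j)\<bar> \<le> 2 / 2 ^ n - 2 / 2 ^ (n + j)" for j
  proof (induction j)
    case (Suc j)
    have "\<bar>a n - a (n + Suc j)\<bar> \<le> \<bar>a n - a (n + j)\<bar> + \<bar>a (Suc (n + j)) - a (n + j)\<bar>" by simp
    also have "\<dots> \<le> (2 / 2 ^ n - 2 / 2 ^ (n + j)) + 1 / 2 ^ (n + j)"
      using Suc inc[of "n + j"] n by (intro add_mono) auto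
    also have "\<dots> = 2 / 2 ^ n - 2 / 2 ^ (n + Suc j)" by (simp add: field_simps)
    finally show ?case .
  qed simp
  have "(\<lambda>j. \<bar>a n - a (j + n)\<bar>) \<longlonglongrightarrow> \<bar>a n - lim a\<bar>"
    by (intro tendsto_rabs tendsto_diff tendsto_const LIMSEQ_ignore_initial_segment[OF lim])
  then show "\<bar>a n - lim a\<bar> \<le> 2 / 2 ^ n"
  proof (rule LIMSEQ_le_const2)
    show "\<exists>N. \<forall>j\<ge>N. \<bar>a n - a (j + n)\<bar> \<le> 2 / 2 ^ n"
    proof (intro exI allI impI)
      fix j :: nat
      have "0 \<le> 2 / (2::real) ^ (n + j)" by simp
      moreover have "\<bar>a n - a (j + n)\<bar> \<le> 2 / 2 ^ n - 2 / 2 ^ (n + j)"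
        using step[of j] by (simp only: add.commute)
      ultimately show "\<bar>a n - a (j + n)\<bar> \<le> 2 / 2 ^ n" by linarith
    qed
  qed
qed

definition limit_path :: "(nat \<Rightarrow> rat \<Rightarrow> real) \<Rightarrow> rat \<Rightarrow> real" where
  "limit_path x q = lim (\<lambda>n. x n q)"

lemma measurable_limit_path: "limit_path \<in> borel_measurable (PiM UNIV (\<lambda>_. borel))"
proof (rule measurable_coordinatewise_then_product)
  fix q
  have "(\<lambda>x. x n q) \<in> borel_measurable (PiM UNIV (\<lambda>_. borel :: (rat \<Rightarrow> real) measure))" for n :: nat
  proof -
    have 1: "(\<lambda>x. x n) \<in> measurable (PiM UNIV (\<lambda>_. borel :: (rat \<Rightarrow> real) measure)) borel"
      by (rule measurable_component_singleton) simp
    have 2: "(\<lambda>z :: rat \<Rightarrow> real. z q) \<in> borel_measurable borel"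
      by (rule measurable_product_coordinates)
    show ?thesis by (rule measurable_compose[OF 1 2])
  qed
  then show "(\<lambda>x. limit_path x q) \<in> borel_measurable (PiM UNIV (\<lambda>_. borel))"
    unfolding limit_path_def by (rule borel_measurable_lim_metric)
qed

text \<open>On each bounded range the increments are eventually at most \<open>1 / 2 ^ n\<close>, so
  convergence is uniform there and uniform continuity passes to the limit.\<close>

lemma limit_path_regular:
  assumes uc: "\<And>n. rat_uc (x n)"
    and close: "\<forall>\<^sub>F n in sequentially. \<forall>q. 0 \<le> q \<longrightarrow> q \<le> of_nat n \<longrightarrow> \<bar>x (Suc n) q - x n q\<bar> \<le> 1 / 2 ^ n"
  shows "rat_uc (limit_path x)" "\<And>q. 0 \<le> q \<Longrightarrow> (\<lambda>n. x n q) \<longlonglongrightarrow> limit_path x q"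
proof -
  obtain n0 where n0: "\<And>n q. n0 \<le> n \<Longrightarrow> 0 \<le> q \<Longrightarrow> q \<le> of_nat n \<Longrightarrow> \<bar>x (Suc n) q - x n q\<bar> \<le> 1 / 2 ^ n"
    using close unfolding eventually_sequentially by blast
  have inc: "\<bar>x (Suc n) q - x n q\<bar> \<le> 1 / 2 ^ n" if "max n0 N \<le> n" "0 \<le> q" "q \<le> of_nat N" for n N q
  proof (rule n0)
    show "q \<le> of_nat n" using that by (meson max.bounded_iff of_nat_mono order_trans)
  qed (use that in auto)
  show "(\<lambda>n. x n q) \<longlonglongrightarrow> limit_path x q" if q: "0 \<le> q" for q
  proof -
    obtain N :: nat where N: "q \<le> of_nat N" using real_arch_simple by blast
    show ?thesis unfolding limit_path_def
      by (rule geometric_increments_converge(1)[of "max n0 N" "\<lambda>n. x n q"]) (use inc q N in blast)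
  qed
  have tail: "\<bar>x n q - limit_path x q\<bar> \<le> 2 / 2 ^ n" if "max n0 N \<le> n" "0 \<le> q" "q \<le> of_nat N" for n N q
    unfolding limit_path_def
    by (rule geometric_increments_converge(2)[of "max n0 N" "\<lambda>n. x n q"]) (use inc that in blast)+
  show "rat_uc (limit_path x)"
    unfolding rat_uc_def
  proof (intro allI)
    fix N k :: nat
    \<comment> \<open>For \<open>\<epsilon> = 1 / (k + 1)\<close> the error is split as
      \<open>\<epsilon> / 6 + \<epsilon> / 2 + \<epsilon> / 6\<close>; the middle part is
      \<open>1 / Suc (2 * k + 1)\<close>.\<close>
    have e: "0 < 1 / (6 * real (Suc k))" by simp
    have "(\<lambda>n. 2 * (1 / 2 ^ n :: real)) \<longlonglongrightarrow> 2 * 0"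
      by (intro tendsto_mult tendsto_const inverse_power2_tendsto)
    then have "\<forall>\<^sub>F n in sequentially. 2 * (1 / 2 ^ n :: real) < 1 / (6 * real (Suc k))"
      by (rule order_tendstoD(2)) (use e in simp)
    then have "\<forall>\<^sub>F n in sequentially. max n0 N \<le> n \<and> 2 * (1 / 2 ^ n :: real) < 1 / (6 * real (Suc k))"
      using eventually_ge_at_top[of "max n0 N"] by eventually_elim auto
    then obtain n where n: "max n0 N \<le> n" "2 / 2 ^ n < 1 / (6 * real (Suc k))"
      by (auto dest: eventually_happens)
    obtain m where m: "\<And>q r. \<lbrakk>0 \<le> q; 0 \<le> r; q \<le> of_nat N; r \<le> of_nat N;
        \<bar>real_of_rat q - real_of_rat r\<bar> < 1 / real (Suc m)\<rbrakk> \<Longrightarrow> \<bar>x n q - x n r\<bar> < 1 / real (Suc (2 * k + 1))"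
      using uc[of n] unfolding rat_uc_def by meson
    show "\<exists>m::nat. \<forall>q r. 0 \<le> q \<longrightarrow> 0 \<le> r \<longrightarrow> q \<le> of_nat N \<longrightarrow> r \<le> of_nat N \<longrightarrow>
     \<bar>real_of_rat q - real_of_rat r\<bar> < 1 / real (Suc m) \<longrightarrow> \<bar>limit_path x q - limit_path x r\<bar> < 1 / real (Suc k)"
    proof (intro exI allI impI)
      fix q r :: rat
      assume qr: "0 \<le> q" "0 \<le> r" "q \<le> of_nat N" "r \<le> of_nat N"
        "\<bar>real_of_rat q - real_of_rat r\<bar> < 1 / real (Suc m)"
      have "\<bar>limit_path x q - limit_path x r\<bar> \<le>
          \<bar>x n q - limit_path x q\<bar> + \<bar>x n q - x n r\<bar> + \<bar>x n r - limit_path x r\<bar>" by linarith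
      also have "\<dots> < 1 / (6 * real (Suc k)) + 1 / real (Suc (2 * k + 1)) + 1 / (6 * real (Suc k))"
        using m[OF qr] tail[OF n(1) qr(1,3)] tail[OF n(1) qr(2,4)] n(2) by linarith
      also have "\<dots> \<le> 1 / real (Suc k)"
      proof -
        define y where "y = 1 / real (Suc k)"
        have "1 / real (Suc (2 * k + 1)) = 1 / (2 * real (Suc k))" by simp
        also have "\<dots> = y / 2" unfolding y_def by simp
        finally have "1 / real (Suc (2 * k + 1)) = y / 2" .
        moreover have "1 / (6 * real (Suc k)) = y / 6" "0 \<le> y" unfolding y_def by simp_all
        ultimately show ?thesis unfolding y_def[symmetric] by simp
      qed
      finally show "\<bar>limit_path x q - limit_path x r\<bar> < 1 / real (Suc k)" .
    qed
  qed
qed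

section \<open>Convergence of the stopped reciprocals\<close>

text \<open>Both reciprocals are positive and \<open>1 / b \<le> 1 / 2 ^ n\<close>, so a difference
  above \<open>1 / 2 ^ n\<close> can come only from \<open>1 / a > 1 / 2 ^ n\<close>, that is
  \<open>a < 2 ^ n\<close>.\<close>

lemma inverse_level_gap:
  fixes a b :: real
  assumes "1 \<le> n" "0 < a" "b = 4 ^ n" "1 / 2 ^ n < \<bar>1 / a - 1 / b\<bar>"
  shows "4 ^ n - 2 ^ n \<le> b - a"
proof -
  have p: "(4::real) ^ n = 2 ^ n * 2 ^ n" by (simp add: power_mult_distrib[symmetric])
  have "1 / b \<le> 1 / 2 ^ n" unfolding assms(3) by (rule divide_left_mono) (auto intro: power_mono)
  moreover have "0 < 1 / a" "0 < 1 / b" using assms by auto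
  ultimately have "1 / 2 ^ n < 1 / a" using assms(4) by linarith
  then have "a < 2 ^ n" using assms(2) by (simp add: divide_simps split: if_splits)
  then show ?thesis using assms(3) by simp
qed

lemma measurable_pair_coordinates:
  "(\<lambda>p :: (rat \<Rightarrow> real) \<times> (rat \<Rightarrow> real). fst p q) \<in> borel_measurable (borel \<Otimes>\<^sub>M borel)"
  "(\<lambda>p :: (rat \<Rightarrow> real) \<times> (rat \<Rightarrow> real). snd p q) \<in> borel_measurable (borel \<Otimes>\<^sub>M borel)"
  by (rule measurable_compose[OF measurable_fst measurable_product_coordinates],
      rule measurable_compose[OF measurable_snd measurable_product_coordinates])

text \<open>From the level time on, the stopped reciprocal stays at or below
  \<open>1 / 4 ^ n\<close>, and some rational lies between the level time and \<open>t\<close>. Thus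
  the rational values, all that is available on the limit space, reveal whether the level was
  reached. The bound \<open>t \<le> n\<close> rules out the cap.\<close>

lemma level_time_ge_if_recip_large:
  assumes w: "w \<in> cont_paths" and t: "t \<le> real n"
    and big: "\<And>q. 0 \<le> q \<Longrightarrow> real_of_rat q \<le> t \<Longrightarrow> 1 / 4 ^ n < stopped_recip n w q"
  shows "t \<le> level_time n w"
proof (rule ccontr)
  assume "\<not> t \<le> level_time n w"
  then have less: "level_time n w < t" by simp
  then obtain r where r: "level_time n w < real_of_rat r" "real_of_rat r < t"
    using of_rat_dense by blast
  have r0: "0 \<le> r" using r(1) level_time_bounds(1)[of n w]
    by (metis less_le_trans not_le of_rat_0 of_rat_less order_less_imp_le)
  have a: "4 ^ n \<le> w (level_time n w)" using less t by (intro level_time_attained[OF w]) simp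
  then have p: "0 < w (level_time n w)" by (rule less_le_trans[rotated]) simp
  have "1 / w (level_time n w) \<le> 1 / 4 ^ n"
    by (intro divide_left_mono mult_pos_pos a p) auto
  moreover have "1 / 4 ^ n < stopped_recip n w r" using big r r0 by simp
  ultimately show False using r r0 by (simp add: stopped_recip_def min_def split: if_splits)
qed

context positive_path_martingale
begin

text \<open>Under the changed measure, the probability that the reciprocal climbs to \<open>2\<^sup>-\<^sup>n\<close> after it was
  stopped at \<open>4\<^sup>-\<^sup>n\<close> is the \<open>R\<close>-expectation of the path value at the climbing time \<open>S\<close> on this event; there it is
  at most \<open>2\<^sup>n / c\<close> times the value at the earlier time \<open>U\<close>, whose expectation is one.\<close>

lemma crossing_bound:
  assumes n: "1 \<le> n"
  shows "(\<integral>\<^sup>+w. ennreal (w (level_time (Suc n) w)) * indicator {w. \<exists>q. 0 \<le> q \<and> q \<le> of_nat n \<and>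
      1 / 2 ^ n < \<bar>stopped_recip (Suc n) w q - stopped_recip n w q\<bar>} w \<partial>R) \<le> ennreal (2 / 2 ^ n)"
    (is "(\<integral>\<^sup>+w. _ * indicator ?Bad w \<partial>R) \<le> _")
proof -
  \<comment> \<open>The size of a fall from level \<open>4 ^ n\<close> to level
    \<open>2 ^ n\<close>, which is how the path sees its reciprocal climb to
    \<open>1 / 2 ^ n\<close>.\<close>
  define c where "c = (4::real) ^ n - 2 ^ n"
  define g where "g w t = w (min t (level_time n w)) - w t" for w :: "real \<Rightarrow> real" and t
  \<comment> \<open>The cap exceeds \<open>n\<close> by one, so a hit at a time up to
    \<open>n\<close> is never confused with the cap.\<close>
  define \<kappa> where "\<kappa> = capped_hit g c (real (Suc n))"
  define S where "S w = min (\<kappa> w) (level_time (Suc n) w)" for w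
  define U where "U w = min (S w) (level_time n w)" for w
  define A where "A = {w \<in> cont_paths. c \<le> w (U w) - w (S w)}"
  have p4: "(4::real) ^ n = 2 ^ n * 2 ^ n" by (simp add: power_mult_distrib[symmetric])
  \<comment> \<open>For \<open>n \<ge> 1\<close> the number \<open>2 ^ n\<close> is at most half of
    \<open>4 ^ n\<close>, hence so is \<open>c\<close> at least that half, and
    \<open>2 ^ n / c\<close> has the claimed size.\<close>
  have "(2::real) ^ 1 \<le> 2 ^ n" using n by (intro power_increasing) auto
  then have two: "(2::real) \<le> 2 ^ n" by simp
  have c: "0 < c" "2 ^ n / c \<le> 2 / 2 ^ n"
  proof -
    have "2 * 2 ^ n \<le> (2::real) ^ n * 2 ^ n" using two by (intro mult_right_mono) auto
    then have "4 ^ n \<le> 2 * c" unfolding c_def p4 by simp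
    then show "0 < c" by (smt (verit) zero_less_power)
    then show "2 ^ n / c \<le> 2 / 2 ^ n"
      using \<open>4 ^ n \<le> 2 * c\<close> by (simp add: divide_simps p4)
  qed
  have gc: "continuous_on {0..} (g w)" if w: "w \<in> cont_paths" for w
    unfolding g_def
    by (intro continuous_on_diff cont_pathsD[OF w] continuous_on_compose2[OF cont_pathsD[OF w]]
        continuous_on_min continuous_on_id continuous_on_const) (auto simp: level_time_bounds)
  have g\<kappa>: "path_stopping \<kappa>"
    unfolding \<kappa>_def
  proof (rule path_stopping_capped_hit[OF gc])
    fix t :: real assume t: "0 \<le> t"
    show "(\<lambda>w. g w t) \<in> borel_measurable path_space"
      unfolding g_def using measurable_path_at_stopping[OF path_stopping_min_level[OF t]] t by measurable
    show "determined_by (\<lambda>_. t) (\<lambda>w. g w t)"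
    proof (rule determined_byI)
      fix w w' assume w: "w \<in> cont_paths" "w' \<in> cont_paths" and a: "\<And>s. 0 \<le> s \<Longrightarrow> s \<le> t \<Longrightarrow> w s = w' s"
      have "w (min t (level_time n w)) = w' (min t (level_time n w'))"
        by (rule determined_byD[OF determined_by_path_at[OF path_stopping_min_level[OF t]] w]) (use a in simp)
      then show "g w t = g w' t" unfolding g_def using a[OF t order_refl] by simp
    qed
  qed auto
  have S: "path_stopping S" unfolding S_def by (rule path_stopping_min[OF g\<kappa> path_stopping_level_time])
  have U: "path_stopping U" unfolding U_def by (rule path_stopping_min[OF S path_stopping_level_time])
  have SU: "U w \<le> S w" "S w \<le> level_time (Suc n) w" "U w \<le> level_time n w" for w by (auto simp: S_def U_def)
  have A_sets: "A \<in> sets path_space"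
  proof -
    have "A = {w \<in> space path_space. c \<le> w (U w) - w (S w)}" by (simp add: A_def)
    also have "\<dots> \<in> sets path_space"
      using measurable_path_at_stopping[OF S] measurable_path_at_stopping[OF U] by measurable
    finally show ?thesis .
  qed
  have A_det: "determined_by S (indicator A :: _ \<Rightarrow> ennreal)"
  proof (rule determined_byI)
    fix w w' assume w: "w \<in> cont_paths" "w' \<in> cont_paths" and a: "\<And>t. 0 \<le> t \<Longrightarrow> t \<le> S w \<Longrightarrow> w t = w' t"
    have 1: "w (S w) = w' (S w')" by (rule determined_byD[OF determined_by_path_at[OF S] w a])
    have 2: "w (U w) = w' (U w')"
      by (rule determined_byD[OF determined_by_path_at[OF U] w]) (use a SU(1)[of w] in simp)
    show "(indicator A w :: ennreal) = indicator A w'" using 1 2 w by (simp add: A_def indicator_def)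
  qed
  \<comment> \<open>A discrepancy can occur only after \<open>level_time n\<close>, where the path
    was exactly at \<open>4 ^ n\<close>. By the time of the discrepancy it has fallen by
    \<open>c\<close>, so \<open>\<kappa>\<close> comes no later, and no later than
    \<open>level_time (Suc n)\<close>.\<close>
  have bad: "AE w in R. indicator ?Bad w \<le> (indicator A w :: ennreal)"
    using pos start AE_space[of R]
  proof eventually_elim
    case (elim w)
    then have w: "w \<in> cont_paths" by simp
    show ?case
    proof (cases "w \<in> ?Bad")
      case True
      then obtain q where q: "0 \<le> q" "q \<le> of_nat n"
        "1 / 2 ^ n < \<bar>stopped_recip (Suc n) w q - stopped_recip n w q\<bar>" by blast
      define r where "r = real_of_rat q"
      have r: "0 \<le> r" "r \<le> real n" unfolding r_def using q(1,2)
        by (simp, metis of_rat_less_eq of_rat_of_nat_eq)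
      let ?T = "level_time n w" and ?T' = "level_time (Suc n) w"
      have TT: "?T \<le> ?T'" by (rule level_time_mono[OF w]) simp
      define t where "t = min r ?T'"
      have t0: "0 \<le> t" using r level_time_bounds(1)[of "Suc n" w] by (simp add: t_def)
      have gap: "1 / 2 ^ n < \<bar>1 / w t - 1 / w (min r ?T)\<bar>"
        using q(3) r by (simp add: stopped_recip_def r_def[symmetric] t_def)
      have "?T < r"
      proof (rule ccontr)
        assume "\<not> ?T < r"
        then have "min r ?T = t" using TT by (simp add: t_def)
        then show False using gap by simp
      qed
      then have "4 ^ n \<le> w ?T" using r by (intro level_time_attained[OF w]) simp
      moreover have "w ?T \<le> 4 ^ n" using elim by (intro level_time_upto[OF w] level_time_bounds) auto
      ultimately have wT: "w ?T = 4 ^ n" by simp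
      have "c \<le> w ?T - w t"
        unfolding c_def
        by (rule inverse_level_gap[OF n _ wT]) (use elim t0 gap \<open>?T < r\<close> in \<open>auto simp: min_def\<close>)
      moreover have "min t ?T = ?T" using \<open>?T < r\<close> TT by (simp add: t_def)
      ultimately have gt: "c \<le> g w t" by (simp add: g_def)
      have \<kappa>t: "\<kappa> w \<le> t" unfolding \<kappa>_def by (rule capped_hit_le[where g=g, OF _ t0 gt]) simp
      have "\<kappa> w < real (Suc n)" using \<kappa>t r by (simp add: t_def)
      then have "c \<le> g w (\<kappa> w)" unfolding \<kappa>_def by (intro capped_hit_attained[where g=g, OF gc[OF w]]) auto
      moreover have "S w = \<kappa> w" using \<kappa>t by (simp add: S_def t_def)
      ultimately have "w \<in> A" using w by (simp add: A_def g_def U_def)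
      then show ?thesis by (simp add: indicator_def)
    qed simp
  qed
  \<comment> \<open>The value at \<open>U\<close> is at most \<open>4 ^ n\<close>, so a fall by
    \<open>c\<close> leaves at most \<open>2 ^ n\<close> at \<open>S\<close>. Since the value at
    \<open>S\<close> is positive, the value at \<open>U\<close> is at least
    \<open>c\<close>.\<close>
  have onA: "AE w in R. ennreal (w (S w)) * indicator A w \<le> ennreal (2 ^ n / c) * ennreal (w (U w))"
    using pos start AE_space[of R]
  proof eventually_elim
    case (elim w)
    then have w: "w \<in> cont_paths" by simp
    show ?case
    proof (cases "w \<in> A")
      case True
      have "w (U w) \<le> 4 ^ n"
        using elim SU(3) by (intro level_time_upto[OF w] path_stoppingD(2)[OF U w]) auto
      then have 1: "w (S w) \<le> 2 ^ n" using True by (simp add: A_def c_def)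
      have "0 < w (S w)" using elim path_stoppingD(2)[OF S w] by auto
      then have 2: "c \<le> w (U w)" using True by (simp add: A_def)
      have "w (S w) \<le> 2 ^ n * 1" using 1 by simp
      also have "\<dots> \<le> 2 ^ n * (w (U w) / c)" using 2 c by (intro mult_left_mono) auto
      finally have "ennreal (w (S w)) \<le> ennreal (2 ^ n / c * w (U w))" by (intro ennreal_leI) simp
      also have "\<dots> = ennreal (2 ^ n / c) * ennreal (w (U w))"
        by (rule ennreal_mult') (use c in simp)
      finally show ?thesis using True by simp
    qed simp
  qed
  have "(\<integral>\<^sup>+w. ennreal (w (level_time (Suc n) w)) * indicator ?Bad w \<partial>R) \<le>
      (\<integral>\<^sup>+w. ennreal (w (level_time (Suc n) w)) * indicator A w \<partial>R)"
    by (rule nn_integral_mono_AE) (use bad in eventually_elim, rule mult_left_mono, auto)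
  also have "\<dots> = (\<integral>\<^sup>+w. ennreal (w (S w)) * indicator A w \<partial>R)"
    by (rule optional_stopping_level[OF S SU(2) _ A_det]) (use A_sets in simp)
  also have "\<dots> \<le> (\<integral>\<^sup>+w. ennreal (2 ^ n / c) * ennreal (w (U w)) \<partial>R)"
    by (rule nn_integral_mono_AE[OF onA])
  also have "\<dots> = ennreal (2 ^ n / c) * (\<integral>\<^sup>+w. ennreal (w (U w)) \<partial>R)"
    by (rule nn_integral_cmult) (use measurable_path_at_stopping[OF U] in \<open>simp add: measurable_R_eq\<close>)
  also have "(\<integral>\<^sup>+w. ennreal (w (U w)) \<partial>R) = 1"
    by (rule expectation_at_level[OF U SU(3)])
  also have "ennreal (2 ^ n / c) * 1 \<le> ennreal (2 / 2 ^ n)" using c(2) by (simp add: ennreal_leI)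
  finally show ?thesis .
qed

lemma AE_limit_close:
  "AE x in limit_law. \<forall>\<^sub>F n in sequentially. \<forall>q. 0 \<le> q \<longrightarrow> q \<le> of_nat n \<longrightarrow> \<bar>x (Suc n) q - x n q\<bar> \<le> 1 / 2 ^ n"
proof -
  interpret L: prob_space limit_law by (rule prob_space_limit_law)
  define B :: "nat \<Rightarrow> ((rat \<Rightarrow> real) \<times> (rat \<Rightarrow> real)) set" where
    "B n = {p. \<exists>q. 0 \<le> q \<and> q \<le> of_nat n \<and> 1 / 2 ^ n < \<bar>snd p q - fst p q\<bar>}" for n
  have B: "B n \<in> sets (borel \<Otimes>\<^sub>M borel)" for n
  proof -
    note measurable_pair_coordinates [measurable]
    have "{p \<in> space (borel \<Otimes>\<^sub>M borel). \<exists>q::rat. 0 \<le> q \<and> q \<le> of_nat n \<and>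
        1 / 2 ^ n < \<bar>snd p q - fst p q :: real\<bar>} \<in> sets (borel \<Otimes>\<^sub>M borel)" by measurable
    then show ?thesis by (simp add: B_def space_pair_measure)
  qed
  \<comment> \<open>The index is shifted by one because \<open>crossing_bound\<close> asks for
    \<open>1 \<le> n\<close>; the resulting bound on the probabilities is
    \<open>(1 / 2) ^ n\<close>.\<close>
  define A where "A n = {x. (x (Suc n), x (Suc (Suc n))) \<in> B (Suc n)}" for n
  have A: "A n \<in> sets limit_law" for n
  proof -
    have "(\<lambda>x. (x (Suc n), x (Suc (Suc n)))) \<in> measurable limit_law (borel \<Otimes>\<^sub>M borel)" by measurable
    from measurable_sets[OF this B[of "Suc n"]] show ?thesis by (simp add: A_def vimage_def)
  qed
  have bound: "emeasure limit_law (A n) \<le> ennreal (2 / 2 ^ Suc n)" for n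
  proof -
    have "emeasure limit_law (A n) = (\<integral>\<^sup>+x. indicator (B (Suc n)) (x (Suc n), x (Suc (Suc n))) \<partial>limit_law)"
      unfolding nn_integral_indicator[OF A, symmetric]
      by (intro nn_integral_cong) (simp add: A_def indicator_def)
    also have "\<dots> = (\<integral>\<^sup>+w. ennreal (w (level_time (Suc (Suc n)) w)) *
        indicator (B (Suc n)) (stopped_recip (Suc n) w, stopped_recip (Suc (Suc n)) w) \<partial>R)"
      by (rule nn_integral_limit_pair) (use B in auto)
    also have "\<dots> \<le> ennreal (2 / 2 ^ Suc n)"
      using crossing_bound[of "Suc n"] by (simp add: B_def indicator_def)
    finally show ?thesis .
  qed
  have m: "measure limit_law (A n) \<le> (1 / 2) ^ n" for n
  proof -
    have "ennreal (measure limit_law (A n)) \<le> ennreal (2 / 2 ^ Suc n)"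
      using bound[of n] by (simp add: L.emeasure_eq_measure)
    then have "measure limit_law (A n) \<le> 2 / 2 ^ Suc n" by (subst (asm) ennreal_le_iff) auto
    then show ?thesis by (simp add: power_one_over)
  qed
  have "summable (\<lambda>n. measure limit_law (A n))"
    by (rule summable_comparison_test'[OF summable_geometric[of "1/2 :: real"], of 0]) (use m in auto)
  then have "AE x in limit_law. \<forall>\<^sub>F n in sequentially. x \<in> space limit_law - A n"
    using A by (intro borel_cantelli_AE1) (auto simp: L.emeasure_eq_measure)
  then show ?thesis
  proof eventually_elim
    case (elim x)
    then have "\<forall>\<^sub>F n in sequentially. \<forall>q. 0 \<le> q \<longrightarrow> q \<le> of_nat (Suc n) \<longrightarrow>
        \<bar>x (Suc (Suc n)) q - x (Suc n) q\<bar> \<le> 1 / 2 ^ Suc n"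
      by eventually_elim (auto simp: A_def B_def not_less)
    then show ?case by (rule eventually_sequentially_Suc[THEN iffD1])
  qed
qed

lemma AE_stopped_recip_uc: "AE w in R. rat_uc (stopped_recip n w)"
  using pos AE_space[of R]
proof eventually_elim
  case (elim w)
  then have w: "w \<in> cont_paths" by simp
  show ?case
  proof (rule rat_uc_of_continuous)
    show "continuous_on {0..} (\<lambda>t. 1 / w (min t (level_time n w)))"
    proof (intro continuous_on_divide continuous_on_const ballI)
      show "continuous_on {0..} (\<lambda>t. w (min t (level_time n w)))"
        by (intro continuous_on_compose2[OF cont_pathsD[OF w]] continuous_on_min continuous_on_id continuous_on_const)
           (auto simp: level_time_bounds)
      fix t :: real assume "t \<in> {0..}"
      then have "0 < w (min t (level_time n w))" using elim level_time_bounds(1)[of n w] by simp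
      then show "w (min t (level_time n w)) \<noteq> 0" by simp
    qed
  qed (simp add: stopped_recip_def)
qed

lemma AE_limit_uc: "AE x in limit_law. \<forall>n. rat_uc (x n)"
proof -
  have "Measurable.pred (borel \<Otimes>\<^sub>M borel) (\<lambda>p :: (rat \<Rightarrow> real) \<times> (rat \<Rightarrow> real). rat_uc (fst p))"
    by (rule measurable_compose[OF measurable_fst measurable_rat_uc])
  then have "AE x in limit_law. rat_uc (x n)" for n
    using AE_limit_pair[of n n "\<lambda>p. rat_uc (fst p)"] AE_stopped_recip_uc[of n] by simp
  then show ?thesis by (simp add: AE_all_countable)
qed

lemma AE_limit_regular:
  "AE x in limit_law. (\<forall>n. rat_uc (x n)) \<and> rat_uc (limit_path x) \<and>
     (\<forall>q\<ge>0. (\<lambda>n. x n q) \<longlonglongrightarrow> limit_path x q)"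
  using AE_limit_uc AE_limit_close by eventually_elim (use limit_path_regular in blast)

text \<open>If the reciprocal stopped at level \<open>m\<close> stays above \<open>1 / 4 ^ m\<close>
  up to \<open>t\<close>, then \<open>level_time m\<close> is at least \<open>t\<close>, and higher
  levels make no difference before \<open>t\<close>. The condition speaks of \<open>x m\<close>
  alone, since the limit space carries no underlying path.\<close>

lemma AE_limit_agree:
  assumes t: "0 \<le> t" "t \<le> real m" and mn: "m \<le> n"
  shows "AE x in limit_law. (\<forall>q. 0 \<le> q \<longrightarrow> real_of_rat q \<le> t \<longrightarrow> 1 / 4 ^ m < x m q) \<longrightarrow>
    (\<forall>q. 0 \<le> q \<longrightarrow> real_of_rat q \<le> t \<longrightarrow> x n q = x m q)"
proof -
  let ?P = "\<lambda>p :: (rat \<Rightarrow> real) \<times> (rat \<Rightarrow> real).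
    (\<forall>q. 0 \<le> q \<longrightarrow> real_of_rat q \<le> t \<longrightarrow> 1 / 4 ^ m < fst p q) \<longrightarrow>
    (\<forall>q. 0 \<le> q \<longrightarrow> real_of_rat q \<le> t \<longrightarrow> snd p q = fst p q)"
  note measurable_pair_coordinates [measurable]
  have P: "Measurable.pred (borel \<Otimes>\<^sub>M borel) ?P" by measurable
  have "AE w in R. ?P (stopped_recip m w, stopped_recip n w)"
    using AE_space[of R]
  proof eventually_elim
    case (elim w)
    then have w: "w \<in> cont_paths" by simp
    show ?case
    proof (intro impI allI, unfold fst_conv snd_conv)
      assume big: "\<forall>q. 0 \<le> q \<longrightarrow> real_of_rat q \<le> t \<longrightarrow> 1 / 4 ^ m < stopped_recip m w q"
      have "t \<le> level_time m w"
        by (rule level_time_ge_if_recip_large[OF w t(2)]) (use big in blast)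
      moreover have "level_time m w \<le> level_time n w" by (rule level_time_mono[OF w mn])
      moreover fix q assume "0 \<le> q" "real_of_rat q \<le> t"
      ultimately show "stopped_recip n w q = stopped_recip m w q"
        by (simp add: stopped_recip_def)
    qed
  qed
  from AE_limit_pair[OF mn P this] show ?thesis by simp
qed

end

section \<open>The law of the limit path\<close>

text \<open>A continuous function attains its minimum on a compact interval, so positivity there is
  a uniform lower bound, which rational times detect.\<close>

lemma everywhere_positive_iff:
  assumes c: "continuous_on {0..} h"
  shows "(\<forall>t\<ge>0. 0 < h t) \<longleftrightarrow>
    (\<forall>N::nat. \<exists>k::nat. \<forall>q::rat. 0 \<le> q \<longrightarrow> q \<le> of_nat N \<longrightarrow> 1 / real (Suc k) \<le> h (real_of_rat q))"
proof (intro iffI allI impI)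
  fix N :: nat assume pos: "\<forall>t\<ge>0. 0 < h t"
  have "compact {0..real N}" "{0..real N} \<noteq> {}" "continuous_on {0..real N} h"
    using continuous_on_subset[OF c, of "{0..real N}"] by auto
  then obtain s where s: "s \<in> {0..real N}" "\<And>t. t \<in> {0..real N} \<Longrightarrow> h s \<le> h t"
    using continuous_attains_inf by metis
  then have "0 < h s" using pos by auto
  then obtain k where k: "1 / real (Suc k) < h s" using nat_approx_posE by blast
  show "\<exists>k::nat. \<forall>q::rat. 0 \<le> q \<longrightarrow> q \<le> of_nat N \<longrightarrow> 1 / real (Suc k) \<le> h (real_of_rat q)"
  proof (intro exI allI impI)
    fix q :: rat assume q: "0 \<le> q" "q \<le> of_nat N"
    have "real_of_rat q \<le> real N" using q(2) by (metis of_rat_less_eq of_rat_of_nat_eq)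
    then have "h s \<le> h (real_of_rat q)" using q(1) by (intro s(2)) simp
    then show "1 / real (Suc k) \<le> h (real_of_rat q)" using k by simp
  qed
next
  fix t :: real
  assume *: "\<forall>N::nat. \<exists>k::nat. \<forall>q::rat. 0 \<le> q \<longrightarrow> q \<le> of_nat N \<longrightarrow> 1 / real (Suc k) \<le> h (real_of_rat q)"
    and t: "0 \<le> t"
  obtain N :: nat where N: "t \<le> real N" using real_arch_simple by blast
  obtain k :: nat where k: "\<And>q. 0 \<le> q \<Longrightarrow> q \<le> of_nat N \<Longrightarrow> 1 / real (Suc k) \<le> h (real_of_rat q)"
    using * by blast
  have le: "1 / real (Suc k) \<le> h (dyadic_floor i t)" for i
    using k[OF dyadic_rat_nonneg[OF t] dyadic_rat_le[OF N]] by (simp only: of_rat_dyadic_rat)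
  have "(\<lambda>i. h (dyadic_floor i t)) \<longlonglongrightarrow> h t"
    by (rule continuous_on_tendsto_compose[OF c dyadic_floor_tendsto]) (use t dyadic_floor_nonneg in auto)
  then have "1 / real (Suc k) \<le> h t" by (rule LIMSEQ_le_const) (use le in blast)
  moreover have "0 < 1 / real (Suc k)" by simp
  ultimately show "0 < h t" by linarith
qed

text \<open>Used with the identity, for positivity of the path, and with the absolute value, for
  paths that avoid zero.\<close>

lemma measurable_everywhere_positive:
  fixes \<phi> :: "real \<Rightarrow> real"
  assumes c: "continuous_on UNIV \<phi>"
  shows "Measurable.pred path_space (\<lambda>w. \<forall>t\<ge>0. 0 < \<phi> (w t))"
proof -
  have "(\<lambda>w. \<phi> (w (real_of_rat q))) \<in> borel_measurable path_space" if "0 \<le> q" for q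
    by (rule measurable_compose[OF measurable_coord_path_space borel_measurable_continuous_onI[OF c]]) (use that in simp)
  then have [measurable]: "Measurable.pred path_space (\<lambda>w. 0 \<le> q \<longrightarrow> q \<le> of_nat N \<longrightarrow> 1 / real (Suc k) \<le> \<phi> (w (real_of_rat q)))"
    for q and N k :: nat
    by (cases "0 \<le> q") simp_all
  have "Measurable.pred path_space (\<lambda>w. \<forall>N::nat. \<exists>k::nat. \<forall>q::rat. 0 \<le> q \<longrightarrow> q \<le> of_nat N \<longrightarrow>
      1 / real (Suc k) \<le> \<phi> (w (real_of_rat q)))" by measurable
  also have "?this \<longleftrightarrow> ?thesis"
  proof (rule measurable_cong)
    fix w assume "w \<in> space path_space"
    then have "continuous_on {0..} (\<lambda>t. \<phi> (w t))"
      by (intro continuous_on_compose2[OF c] cont_pathsD) auto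
    then show "(\<forall>N::nat. \<exists>k::nat. \<forall>q::rat. 0 \<le> q \<longrightarrow> q \<le> of_nat N \<longrightarrow> 1 / real (Suc k) \<le> \<phi> (w (real_of_rat q)))
        = (\<forall>t\<ge>0. 0 < \<phi> (w t))"
      by (rule everywhere_positive_iff[symmetric])
  qed
  finally show ?thesis .
qed

text \<open>A total version of \<open>reciprocal_path\<close>: the default path makes it a map of
  \<open>cont_paths\<close> into itself, so measurability and image measures need no
  restriction.\<close>

definition recip_path :: "(real \<Rightarrow> real) \<Rightarrow> real \<Rightarrow> real" where
  "recip_path w = (if \<forall>t\<ge>0. 0 < w t then (\<lambda>t\<in>{0..}. 1 / w t) else (\<lambda>t\<in>{0..}. 1))"

lemma recip_path_in_cont_paths:
  assumes w: "w \<in> cont_paths" shows "recip_path w \<in> cont_paths"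
proof (cases "\<forall>t\<ge>0. 0 < w t")
  case pos: True
  have "continuous_on {0..} (\<lambda>t. 1 / w t)"
    by (intro continuous_on_divide continuous_on_const cont_pathsD[OF w]) (use pos in fastforce)
  then have "continuous_on {0..} (recip_path w)"
    by (rule continuous_on_eq) (simp add: recip_path_def pos)
  then show ?thesis using pos by (simp add: cont_paths_def recip_path_def)
next
  case False
  have "continuous_on {0..} (\<lambda>t\<in>{0..}. 1 :: real)"
    by (rule continuous_on_eq[OF continuous_on_const[of _ 1]]) simp
  then show ?thesis unfolding recip_path_def if_not_P[OF False] by (simp add: cont_paths_def)
qed

lemma recip_path_apply: "\<forall>t\<ge>0. 0 < w t \<Longrightarrow> 0 \<le> s \<Longrightarrow> recip_path w s = 1 / w s"
  by (simp add: recip_path_def)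

lemma measurable_recip_path: "recip_path \<in> measurable path_space path_space"
proof (rule measurable_into_path_space)
  fix s :: real assume s: "0 \<le> s"
  have "Measurable.pred path_space (\<lambda>w. \<forall>t\<ge>0. 0 < w t)"
    using measurable_everywhere_positive[of "\<lambda>x. x"] by simp
  then have "(\<lambda>w. if \<forall>t\<ge>0. 0 < w t then 1 / w s else 1) \<in> borel_measurable path_space"
    using s by measurable
  also have "(\<lambda>w. if \<forall>t\<ge>0. 0 < w t then 1 / w s else 1) = (\<lambda>w. recip_path w s)"
    using s by (auto simp: recip_path_def fun_eq_iff)
  finally show "(\<lambda>w. recip_path w s) \<in> borel_measurable path_space" .
qed (simp add: recip_path_in_cont_paths)

text \<open>Fatou's lemma; \<open>ennreal\<close> cuts negative values to zero, so no sign condition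
  on the functions arises.\<close>

lemma nn_integral_limit_le:
  fixes u :: "nat \<Rightarrow> 'a \<Rightarrow> real"
  assumes "\<And>n. u n \<in> borel_measurable M" "AE x in M. (\<lambda>n. u n x) \<longlonglongrightarrow> v x"
    and "\<And>n. (\<integral>\<^sup>+x. ennreal (u n x) \<partial>M) \<le> c"
  shows "(\<integral>\<^sup>+x. ennreal (v x) \<partial>M) \<le> c"
proof -
  have "(\<integral>\<^sup>+x. ennreal (v x) \<partial>M) = (\<integral>\<^sup>+x. liminf (\<lambda>n. ennreal (u n x)) \<partial>M)"
  proof (rule nn_integral_cong_AE)
    show "AE x in M. ennreal (v x) = liminf (\<lambda>n. ennreal (u n x))"
      using assms(2)
    proof eventually_elim
      case (elim x)
      show ?case by (rule lim_imp_Liminf[symmetric]) (use elim in \<open>auto intro: tendsto_ennrealI\<close>)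
    qed
  qed
  also have "\<dots> \<le> liminf (\<lambda>n. \<integral>\<^sup>+x. ennreal (u n x) \<partial>M)"
    by (rule nn_integral_liminf) (use assms(1) in measurable)
  also have "\<dots> \<le> c" by (rule Liminf_le) (use assms(3) in auto)
  finally show ?thesis .
qed

lemma determined_by_stop_path:
  assumes S: "path_stopping S" shows "determined_by S (\<lambda>w. stop_path (S w) w)"
proof (rule determined_byI)
  fix w w' assume w: "w \<in> cont_paths" "w' \<in> cont_paths" and a: "\<And>t. 0 \<le> t \<Longrightarrow> t \<le> S w \<Longrightarrow> w t = w' t"
  have eq: "S w = S w'" by (rule determined_byD[OF path_stoppingD(3)[OF S] w a])
  show "stop_path (S w) w = stop_path (S w') w'"
    unfolding stop_path_def eq[symmetric]
    by (rule restrict_ext) (use a path_stoppingD(2)[OF S w(1)] in simp)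
qed

context positive_path_martingale
begin

text \<open>Stands in for the event that level \<open>4 ^ n\<close> is not reached before
  \<open>t\<close>, expressed through rational values so that it makes sense on the limit
  space.\<close>

definition recip_large :: "real \<Rightarrow> nat \<Rightarrow> (rat \<Rightarrow> real) \<Rightarrow> bool" where
  "recip_large t n z \<longleftrightarrow> (\<forall>q. 0 \<le> q \<longrightarrow> real_of_rat q \<le> t \<longrightarrow> 1 / 4 ^ n < z q)"

lemma measurable_recip_large [measurable]: "Measurable.pred borel (recip_large t n)"
  unfolding recip_large_def by measurable

lemma measurable_limit_coord [measurable]: "(\<lambda>x. x n) \<in> borel_measurable limit_law"
  by measurable

definition limit_ext :: "(nat \<Rightarrow> rat \<Rightarrow> real) \<Rightarrow> real \<Rightarrow> real" where
  "limit_ext x = rat_ext (limit_path x)"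

lemma measurable_limit_ext [measurable]: "limit_ext \<in> measurable limit_law path_space"
proof -
  have "limit_path \<in> borel_measurable limit_law"
    using measurable_limit_path by (subst measurable_cong_sets[OF sets_limit_law refl])
  then show ?thesis unfolding limit_ext_def by (rule measurable_compose[OF _ measurable_rat_ext])
qed

lemma AE_limit_ext_agree:
  assumes t: "0 \<le> t" "t \<le> real n"
  shows "AE x in limit_law. recip_large t n (x n) \<longrightarrow> (\<forall>s. 0 \<le> s \<longrightarrow> s \<le> t \<longrightarrow> limit_ext x s = rat_ext (x n) s)"
proof -
  have "AE x in limit_law. \<forall>j. recip_large t n (x n) \<longrightarrow>
      (\<forall>q. 0 \<le> q \<longrightarrow> real_of_rat q \<le> t \<longrightarrow> x (n + j) q = x n q)"
    unfolding AE_all_countable recip_large_def by (intro allI AE_limit_agree t) simp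
  then show ?thesis using AE_limit_regular
  proof eventually_elim
    case (elim x)
    show ?case
    proof (intro impI allI)
      fix s assume big: "recip_large t n (x n)" and s: "0 \<le> s" "s \<le> t"
      show "limit_ext x s = rat_ext (x n) s"
        unfolding limit_ext_def
      proof (rule rat_ext_agree[OF _ _ s])
        fix q :: rat assume q: "0 \<le> q" "real_of_rat q \<le> t"
        have "(\<lambda>j. x (j + n) q) \<longlonglongrightarrow> limit_path x q"
          using elim q(1) by (intro LIMSEQ_ignore_initial_segment) blast
        moreover have "(\<lambda>j. x (j + n) q) = (\<lambda>j. x n q)"
          using elim(1) big q by (auto simp: add.commute)
        ultimately show "limit_path x q = x n q" by (simp add: LIMSEQ_const_iff)
      qed (use elim in auto)
    qed
  qed
qed

text \<open>On the localizing event the limit path agrees up to \<open>t\<close> with the extension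
  of \<open>x n\<close>, whose law is known from \<open>R\<close>. The integrand depends on the path
  up to \<open>S\<close>, the minimum of \<open>t\<close> and the level time, so optional stopping
  turns the density into the value at \<open>S\<close>. On the event \<open>S\<close> equals
  \<open>t\<close>, and the density \<open>w t\<close> cancels the factor
  \<open>1 / w t\<close>.\<close>

lemma nn_integral_limit_ext_local:
  assumes t: "0 \<le> t" "t \<le> real n"
    and g: "g \<in> borel_measurable path_space" "determined_by (\<lambda>_. t) g"
  shows "(\<integral>\<^sup>+x. ennreal (limit_ext x t) * g (limit_ext x) * indicator {x. recip_large t n (x n)} x \<partial>limit_law) =
    (\<integral>\<^sup>+w. g (recip_path w) * indicator {w. recip_large t n (stopped_recip n w)} w \<partial>R)"
proof -
  define h where "h z = ennreal (rat_ext z t) * g (rat_ext z) * indicator {z. recip_large t n z} z" for z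
  define S where "S w = min t (level_time n w)" for w
  \<comment> \<open>The integrand \<open>h\<close> rewritten as a function of the path stopped at
    \<open>S\<close>, which exhibits it as determined at \<open>S\<close>.\<close>
  define F where "F y = ennreal (1 / y t) * g (recip_path y) *
    indicator {y. \<forall>q. 0 \<le> q \<longrightarrow> real_of_rat q \<le> t \<longrightarrow> 1 / 4 ^ n < 1 / y (real_of_rat q)} y" for y :: "real \<Rightarrow> real"
  have S: "path_stopping S" unfolding S_def by (rule path_stopping_min_level[OF t(1)])
  have h: "h \<in> borel_measurable borel"
  proof -
    have 1: "(\<lambda>z. rat_ext z t) \<in> borel_measurable borel"
      by (rule measurable_compose[OF measurable_rat_ext measurable_coord_path_space[OF t(1)]])
    have 2: "(\<lambda>z. g (rat_ext z)) \<in> borel_measurable borel"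
      by (rule measurable_compose[OF measurable_rat_ext g(1)])
    show ?thesis unfolding h_def using 1 2 by measurable
  qed
  have F: "F \<in> borel_measurable path_space"
  proof -
    have "(\<lambda>y. y (real_of_rat q)) \<in> borel_measurable path_space" if "0 \<le> q" for q
      using that by (intro measurable_coord_path_space) simp
    then have [measurable]: "Measurable.pred path_space (\<lambda>y. 0 \<le> q \<longrightarrow> real_of_rat q \<le> t \<longrightarrow> 1 / 4 ^ n < 1 / y (real_of_rat q))" for q
      by (cases "0 \<le> q") simp_all
    have 1: "(\<lambda>y. g (recip_path y)) \<in> borel_measurable path_space"
      by (rule measurable_compose[OF measurable_recip_path g(1)])
    show ?thesis unfolding F_def using 1 t(1) by measurable
  qed
  have large_eq: "(\<forall>q. 0 \<le> q \<longrightarrow> real_of_rat q \<le> t \<longrightarrow> 1 / 4 ^ n < 1 / stop_path (S w) w (real_of_rat q)) \<longleftrightarrow>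
      recip_large t n (stopped_recip n w)" for w
    unfolding recip_large_def
  proof (intro all_cong1 imp_cong refl)
    fix q :: rat assume q: "0 \<le> q" "real_of_rat q \<le> t"
    have "min (real_of_rat q) (S w) = min (real_of_rat q) (level_time n w)"
      using q by (auto simp: S_def)
    then show "(1 / 4 ^ n < 1 / stop_path (S w) w (real_of_rat q)) = (1 / 4 ^ n < stopped_recip n w q)"
      using q by (simp add: stop_path_apply stopped_recip_def)
  qed
  have "(\<integral>\<^sup>+x. ennreal (limit_ext x t) * g (limit_ext x) * indicator {x. recip_large t n (x n)} x \<partial>limit_law)
      = (\<integral>\<^sup>+x. h (x n) \<partial>limit_law)"
  proof (rule nn_integral_cong_AE)
    show "AE x in limit_law. ennreal (limit_ext x t) * g (limit_ext x) * indicator {x. recip_large t n (x n)} x = h (x n)"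
      using AE_limit_ext_agree[OF t]
    proof eventually_elim
      case (elim x)
      show ?case
      proof (cases "recip_large t n (x n)")
        case True
        then have eq: "limit_ext x s = rat_ext (x n) s" if "0 \<le> s" "s \<le> t" for s
          using elim that by blast
        have "g (limit_ext x) = g (rat_ext (x n))"
          by (rule determined_byD[OF g(2)]) (use eq in \<open>auto simp: limit_ext_def rat_ext_in_cont_paths\<close>)
        then show ?thesis using True eq[OF t(1)] by (simp add: h_def)
      qed (simp add: h_def)
    qed
  qed
  also have "\<dots> = (\<integral>\<^sup>+w. ennreal (w (level_time n w)) * h (stopped_recip n w) \<partial>R)"
  proof -
    have "(\<lambda>p. h (fst p)) \<in> borel_measurable (borel \<Otimes>\<^sub>M borel :: ((rat \<Rightarrow> real) \<times> (rat \<Rightarrow> real)) measure)"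
      by (rule measurable_compose[OF measurable_fst h])
    then show ?thesis using nn_integral_limit_pair[of n n "\<lambda>p. h (fst p)"] by simp
  qed
  also have "\<dots> = (\<integral>\<^sup>+w. ennreal (w (level_time n w)) * F (stop_path (S w) w) \<partial>R)"
  proof (rule nn_integral_cong_AE)
    show "AE w in R. ennreal (w (level_time n w)) * h (stopped_recip n w) =
        ennreal (w (level_time n w)) * F (stop_path (S w) w)"
      using pos AE_space[of R] AE_stopped_recip_uc[of n]
    proof eventually_elim
      case (elim w)
      then have w: "w \<in> cont_paths" by simp
      let ?y = "recip_path (stop_path (S w) w)"
      have Sw: "0 \<le> S w" by (rule path_stoppingD(2)[OF S w])
      have sp: "\<forall>s\<ge>0. 0 < stop_path (S w) w s" using elim Sw by (simp add: stop_path_apply)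
      have y: "?y \<in> cont_paths" using stop_path_in[OF w Sw] by (rule recip_path_in_cont_paths)
      have eq: "rat_ext (stopped_recip n w) s = ?y s" if s: "0 \<le> s" "s \<le> t" for s
      proof (rule rat_ext_eq_path[OF elim(3) y s])
        fix q :: rat assume q: "0 \<le> q" "real_of_rat q \<le> t"
        have "min (real_of_rat q) (S w) = min (real_of_rat q) (level_time n w)"
          using q by (auto simp: S_def)
        then show "stopped_recip n w q = ?y (real_of_rat q)"
          using q recip_path_apply[OF sp, of "real_of_rat q"] by (simp add: stop_path_apply stopped_recip_def)
      qed
      have "g (rat_ext (stopped_recip n w)) = g ?y"
        by (rule determined_byD[OF g(2) rat_ext_in_cont_paths y]) (use eq in simp)
      moreover have "rat_ext (stopped_recip n w) t = 1 / stop_path (S w) w t"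
        using eq[OF t(1) order_refl] recip_path_apply[OF sp t(1)] by simp
      ultimately show ?case
        unfolding h_def F_def indicator_def mem_Collect_eq large_eq by simp
    qed
  qed
  also have "\<dots> = (\<integral>\<^sup>+w. ennreal (w (S w)) * F (stop_path (S w) w) \<partial>R)"
  proof (rule optional_stopping_level[OF S])
    show "(\<lambda>w. F (stop_path (S w) w)) \<in> borel_measurable path_space"
      by (rule measurable_compose[OF measurable_stop_path_stopping[OF S] F])
    show "determined_by S (\<lambda>w. F (stop_path (S w) w))"
      by (rule determined_by_comp[OF determined_by_stop_path[OF S]])
  qed (simp add: S_def)
  also have "\<dots> = (\<integral>\<^sup>+w. g (recip_path w) * indicator {w. recip_large t n (stopped_recip n w)} w \<partial>R)"
  proof (rule nn_integral_cong_AE)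
    show "AE w in R. ennreal (w (S w)) * F (stop_path (S w) w) =
        g (recip_path w) * indicator {w. recip_large t n (stopped_recip n w)} w"
      using pos AE_space[of R]
    proof eventually_elim
      case (elim w)
      then have w: "w \<in> cont_paths" by simp
      show ?case
      proof (cases "recip_large t n (stopped_recip n w)")
        case True
        have "t \<le> level_time n w"
          by (rule level_time_ge_if_recip_large[OF w t(2)]) (use True in \<open>auto simp: recip_large_def\<close>)
        then have St: "S w = t" by (simp add: S_def)
        have sp: "\<forall>s\<ge>0. 0 < stop_path t w s" using elim t(1) by (simp add: stop_path_apply)
        have "g (recip_path (stop_path t w)) = g (recip_path w)"
        proof (rule determined_byD[OF g(2)])
          fix s assume s: "0 \<le> s" "s \<le> t"
          then show "recip_path (stop_path t w) s = recip_path w s"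
            using recip_path_apply[OF sp s(1)] recip_path_apply[of w s] elim by (simp add: stop_path_apply)
        qed (use w t stop_path_in recip_path_in_cont_paths in auto)
        moreover have "ennreal (w t) * ennreal (1 / stop_path t w t) = 1"
        proof -
          have "0 < w t" using elim t(1) by simp
          then have "ennreal (w t) * ennreal (1 / w t) = ennreal (w t * (1 / w t))"
            by (intro ennreal_mult[symmetric]) auto
          then show ?thesis using \<open>0 < w t\<close> t(1) by (simp add: stop_path_apply)
        qed
        ultimately show ?thesis
          unfolding F_def indicator_def mem_Collect_eq large_eq using True St
          by (simp add: mult.assoc[symmetric])
      next
        case False
        then show ?thesis unfolding F_def indicator_def mem_Collect_eq large_eq by simp
      qed
    qed
  qed
  finally show ?thesis .
qed

text \<open>At a fixed rational time density and reciprocal cancel after optional stopping, so each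
  stopped reciprocal has expectation one. Fatou's lemma is applied twice: along the levels and along
  the dyadic times that tend to \<open>t\<close>.\<close>

lemma expectation_limit_ext_le:
  assumes t: "0 \<le> t" shows "(\<integral>\<^sup>+x. ennreal (limit_ext x t) \<partial>limit_law) \<le> 1"
proof -
  have coord: "(\<lambda>x. x n q) \<in> borel_measurable limit_law" for n q
    by (rule measurable_compose[OF measurable_limit_coord measurable_product_coordinates])
  have one: "(\<integral>\<^sup>+x. ennreal (x n q) \<partial>limit_law) = 1" if q: "0 \<le> q" for n q
  proof -
    define S where "S w = min (real_of_rat q) (level_time n w)" for w
    have S: "path_stopping S" unfolding S_def by (rule path_stopping_min_level) (use q in simp)
    have "(\<lambda>p. ennreal (fst p q)) \<in> borel_measurable (borel \<Otimes>\<^sub>M borel :: ((rat \<Rightarrow> real) \<times> (rat \<Rightarrow> real)) measure)"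
      using measurable_pair_coordinates(1) by measurable
    then have "(\<integral>\<^sup>+x. ennreal (x n q) \<partial>limit_law) = (\<integral>\<^sup>+w. ennreal (w (level_time n w)) * ennreal (stopped_recip n w q) \<partial>R)"
      using nn_integral_limit_pair[of n n "\<lambda>p. ennreal (fst p q)"] by simp
    also have "\<dots> = (\<integral>\<^sup>+w. ennreal (w (level_time n w)) * ennreal (1 / w (S w)) \<partial>R)"
      using q by (simp add: stopped_recip_def S_def)
    also have "\<dots> = (\<integral>\<^sup>+w. ennreal (w (S w)) * ennreal (1 / w (S w)) \<partial>R)"
      by (rule optional_stopping_level[OF S _ _ determined_by_comp[OF determined_by_path_at[OF S]]])
         (use measurable_path_at_stopping[OF S] in \<open>simp_all add: S_def\<close>)
    also have "\<dots> = (\<integral>\<^sup>+w. 1 \<partial>R)"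
    proof (rule nn_integral_cong_AE)
      show "AE w in R. ennreal (w (S w)) * ennreal (1 / w (S w)) = 1"
        using pos AE_space[of R]
      proof eventually_elim
        case (elim w)
        then have "0 < w (S w)" using path_stoppingD(2)[OF S] by simp
        then show ?case by (subst ennreal_mult[symmetric]) auto
      qed
    qed
    also have "\<dots> = 1" using emeasure_space_1 by simp
    finally show ?thesis .
  qed
  have le: "(\<integral>\<^sup>+x. ennreal (limit_path x q) \<partial>limit_law) \<le> 1" if q: "0 \<le> q" for q
  proof (rule nn_integral_limit_le[where u="\<lambda>n x. x n q"])
    show "AE x in limit_law. (\<lambda>n. x n q) \<longlonglongrightarrow> limit_path x q"
      using AE_limit_regular by eventually_elim (use q in blast)
  qed (use coord one q in auto)
  show ?thesis
  proof (rule nn_integral_limit_le[where u="\<lambda>k x. limit_path x (dyadic_rat k t)"])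
    show "AE x in limit_law. (\<lambda>k. limit_path x (dyadic_rat k t)) \<longlonglongrightarrow> limit_ext x t"
      unfolding limit_ext_def using AE_limit_regular by eventually_elim (use rat_ext_tendsto t in blast)
    show "(\<lambda>x. limit_path x (dyadic_rat k t)) \<in> borel_measurable limit_law" for k
      unfolding limit_path_def using coord by (rule borel_measurable_lim_metric)
    show "(\<integral>\<^sup>+x. ennreal (limit_path x (dyadic_rat k t)) \<partial>limit_law) \<le> 1" for k
      by (rule le[OF dyadic_rat_nonneg[OF t]])
  qed
qed

text \<open>The local identities exhaust the mass: their total weight is already one, and by Fatou's lemma
  the expectation of \<open>limit_ext x t\<close> is at most one, so it vanishes off the exhausting events.\<close>

theorem nn_integral_limit_ext:
  assumes t: "0 \<le> t" and g: "g \<in> borel_measurable path_space" "determined_by (\<lambda>_. t) g"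
  shows "(\<integral>\<^sup>+x. ennreal (limit_ext x t) * g (limit_ext x) \<partial>limit_law) = (\<integral>\<^sup>+w. g (recip_path w) \<partial>R)"
proof -
  obtain N :: nat where N: "t \<le> real N" using real_arch_simple by blast
  define D where "D k = {x. recip_large t (N + k) (x (N + k) :: rat \<Rightarrow> real)}" for k
  define E where "E k = {w. recip_large t (N + k) (stopped_recip (N + k) w)}" for k
  have tN: "t \<le> real (N + k)" for k using N by simp
  have coord: "(\<lambda>x. limit_ext x t) \<in> borel_measurable limit_law"
    by (rule measurable_compose[OF measurable_limit_ext measurable_coord_path_space[OF t]])
  have D_sets: "D k \<in> sets limit_law" for k
  proof -
    have "D k = {x \<in> space limit_law. recip_large t (N + k) (x (N + k))}" by (simp add: D_def)
    also have "\<dots> \<in> sets limit_law" by measurable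
    finally show ?thesis .
  qed
  have E_sets: "E k \<inter> cont_paths \<in> sets path_space" for k
  proof -
    have "E k \<inter> cont_paths = {w \<in> space path_space. recip_large t (N + k) (stopped_recip (N + k) w)}" by (auto simp: E_def)
    also have "\<dots> \<in> sets path_space" using measurable_stopped_recip by measurable
    finally show ?thesis .
  qed
  have four: "1 / (4::real) ^ Suc n \<le> 1 / 4 ^ n" for n by (simp add: divide_simps)
  \<comment> \<open>On \<open>D k\<close> the next stopped reciprocal agrees with the present one up
    to \<open>t\<close>, and its threshold is lower.\<close>
  have D_inc: "AE x in limit_law. \<forall>k. x \<in> D k \<longrightarrow> x \<in> D (Suc k)"
    unfolding AE_all_countable
  proof
    fix k
    show "AE x in limit_law. x \<in> D k \<longrightarrow> x \<in> D (Suc k)"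
      using AE_limit_agree[OF t tN[of k] le_SucI[OF order_refl]]
    proof eventually_elim
      case (elim x)
      then show ?case
        using four[of "N + k"] unfolding D_def recip_large_def by (auto intro: le_less_trans)
    qed
  qed
  have E_inc: "AE w in R. \<forall>k. w \<in> E k \<longrightarrow> w \<in> E (Suc k)"
    using AE_space[of R]
  proof eventually_elim
    case (elim w)
    then have w: "w \<in> cont_paths" by simp
    show ?case
    proof (intro allI impI)
      fix k assume k: "w \<in> E k"
      then have "t \<le> level_time (N + k) w"
        by (intro level_time_ge_if_recip_large[OF w tN]) (auto simp: E_def recip_large_def)
      moreover have "level_time (N + k) w \<le> level_time (Suc (N + k)) w"
        by (rule level_time_mono[OF w]) simp
      ultimately have "stopped_recip (Suc (N + k)) w q = stopped_recip (N + k) w q"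
        if "0 \<le> q" "real_of_rat q \<le> t" for q
        using that by (simp add: stopped_recip_def)
      then show "w \<in> E (Suc k)" using k four[of "N + k"]
        unfolding E_def recip_large_def by (auto intro: le_less_trans)
    qed
  qed
  \<comment> \<open>A positive continuous path stays below some level up to \<open>t\<close>, so
    under \<open>R\<close> the localizing events exhaust the space.\<close>
  have E_all: "AE w in R. \<exists>k. w \<in> E k"
    using pos AE_space[of R]
  proof eventually_elim
    case (elim w)
    then have w: "w \<in> cont_paths" by simp
    have "\<forall>\<^sub>F n in sequentially. t < level_time n w \<and> N \<le> n"
      using level_time_eventually[OF w t] eventually_ge_at_top[of N] by eventually_elim simp
    then obtain n where n: "t < level_time n w" "N \<le> n" by (auto dest: eventually_happens)
    have "1 / 4 ^ n < stopped_recip n w q" if q: "0 \<le> q" "real_of_rat q \<le> t" for q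
    proof -
      have "w (real_of_rat q) < 4 ^ n" using q n by (intro level_time_before) auto
      moreover have "0 < w (real_of_rat q)" using elim q by simp
      ultimately have "1 / 4 ^ n < 1 / w (real_of_rat q)" by (intro divide_strict_left_mono) auto
      then show ?thesis using q n by (simp add: stopped_recip_def)
    qed
    then have "w \<in> E (n - N)" using n by (simp add: E_def recip_large_def)
    then show ?case by blast
  qed
  \<comment> \<open>The events increase only almost surely, hence the almost-everywhere form of
    monotone convergence.\<close>
  have sup: "(\<integral>\<^sup>+x. f x * indicator (\<Union>k. A k) x \<partial>M) = (SUP k. \<integral>\<^sup>+x. f x * indicator (A k) x \<partial>M)"
    if inc: "AE x in M. \<forall>k. x \<in> A k \<longrightarrow> x \<in> A (Suc k)"
      and m: "\<And>k. (\<lambda>x. f x * indicator (A k) x) \<in> borel_measurable M"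
    for M :: "'z measure" and f :: "'z \<Rightarrow> ennreal" and A :: "nat \<Rightarrow> 'z set"
  proof -
    have "(\<integral>\<^sup>+x. f x * indicator (\<Union>k. A k) x \<partial>M) = (\<integral>\<^sup>+x. (SUP k. f x * indicator (A k) x) \<partial>M)"
    proof (rule nn_integral_cong)
      fix x
      show "f x * indicator (\<Union>k. A k) x = (SUP k. f x * indicator (A k) x)"
      proof (rule antisym)
        show "f x * indicator (\<Union>k. A k) x \<le> (SUP k. f x * indicator (A k) x)"
        proof (cases "\<exists>k. x \<in> A k")
          case True
          then obtain k where "x \<in> A k" by blast
          then show ?thesis by (intro SUP_upper2[of k]) (auto simp: indicator_def)
        qed (simp add: indicator_def)
        show "(SUP k. f x * indicator (A k) x) \<le> f x * indicator (\<Union>k. A k) x"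
          by (rule SUP_least) (auto simp: indicator_def)
      qed
    qed
    also have "\<dots> = (SUP k. \<integral>\<^sup>+x. f x * indicator (A k) x \<partial>M)"
    proof (rule nn_integral_monotone_convergence_SUP_AE[OF _ m])
      show "AE x in M. f x * indicator (A k) x \<le> f x * indicator (A (Suc k)) x" for k
        using inc
      proof eventually_elim
        case (elim x)
        then have "(indicator (A k) x :: ennreal) \<le> indicator (A (Suc k)) x" by (auto simp: indicator_def)
        then show ?case by (rule mult_left_mono) simp
      qed
    qed
    finally show ?thesis .
  qed
  have main: "(\<integral>\<^sup>+x. ennreal (limit_ext x t) * f (limit_ext x) * indicator (\<Union>k. D k) x \<partial>limit_law) =
      (\<integral>\<^sup>+w. f (recip_path w) \<partial>R)"
    if f: "f \<in> borel_measurable path_space" "determined_by (\<lambda>_. t) f" for f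
  proof -
    have fm: "(\<lambda>x. f (limit_ext x)) \<in> borel_measurable limit_law"
      by (rule measurable_compose[OF measurable_limit_ext f(1)])
    have fr: "(\<lambda>w. f (recip_path w)) \<in> borel_measurable path_space"
      by (rule measurable_compose[OF measurable_recip_path f(1)])
    have "(\<integral>\<^sup>+x. ennreal (limit_ext x t) * f (limit_ext x) * indicator (\<Union>k. D k) x \<partial>limit_law) =
        (SUP k. \<integral>\<^sup>+x. ennreal (limit_ext x t) * f (limit_ext x) * indicator (D k) x \<partial>limit_law)"
      by (rule sup[OF D_inc]) (use coord fm D_sets in measurable)
    also have "\<dots> = (SUP k. \<integral>\<^sup>+w. f (recip_path w) * indicator (E k) w \<partial>R)"
      unfolding D_def E_def by (intro SUP_cong refl nn_integral_limit_ext_local t tN f)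
    also have "\<dots> = (\<integral>\<^sup>+w. f (recip_path w) * indicator (\<Union>k. E k) w \<partial>R)"
    proof (rule sup[OF E_inc, symmetric])
      fix k
      have "(\<lambda>w. f (recip_path w) * indicator (E k \<inter> cont_paths) w) \<in> borel_measurable R"
        unfolding measurable_R_eq using fr E_sets by measurable
      also have "?this \<longleftrightarrow> (\<lambda>w. f (recip_path w) * indicator (E k) w) \<in> borel_measurable R"
        by (rule measurable_cong) (auto simp: indicator_def)
      finally show "(\<lambda>w. f (recip_path w) * indicator (E k) w) \<in> borel_measurable R" .
    qed
    also have "\<dots> = (\<integral>\<^sup>+w. f (recip_path w) \<partial>R)"
      by (rule nn_integral_cong_AE) (use E_all in eventually_elim, auto simp: indicator_def)
    finally show ?thesis .
  qed
  have "(\<integral>\<^sup>+x. ennreal (limit_ext x t) * indicator (\<Union>k. D k) x \<partial>limit_law) = 1"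
    using main[of "\<lambda>_. 1"] emeasure_space_1 by (simp add: determined_by_def)
  moreover have DU: "(\<Union>k. D k) \<in> sets limit_law" using D_sets by auto
  ultimately have zero: "(\<integral>\<^sup>+x. ennreal (limit_ext x t) * indicator (- (\<Union>k. D k)) x \<partial>limit_law) = 0"
  proof -
    let ?a = "\<integral>\<^sup>+x. ennreal (limit_ext x t) * indicator (\<Union>k. D k) x \<partial>limit_law"
    let ?b = "\<integral>\<^sup>+x. ennreal (limit_ext x t) * indicator (- (\<Union>k. D k)) x \<partial>limit_law"
    have C: "- (\<Union>k. D k) \<in> sets limit_law" using sets.compl_sets[OF DU] by (simp add: Compl_eq_Diff_UNIV)
    have "?a + ?b = (\<integral>\<^sup>+x. ennreal (limit_ext x t) * indicator (\<Union>k. D k) x +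
        ennreal (limit_ext x t) * indicator (- (\<Union>k. D k)) x \<partial>limit_law)"
      by (rule nn_integral_add[symmetric]) (use coord DU C in measurable)
    also have "\<dots> = (\<integral>\<^sup>+x. ennreal (limit_ext x t) \<partial>limit_law)"
      by (intro nn_integral_cong) (simp add: indicator_def)
    also have "\<dots> \<le> 1" by (rule expectation_limit_ext_le[OF t])
    finally have "1 + ?b \<le> 1 + 0" using \<open>?a = 1\<close> by simp
    then have "?b \<le> 0" by (subst (asm) ennreal_add_left_cancel_le) auto
    then show "?b = 0" by simp
  qed
  have "(\<lambda>x. ennreal (limit_ext x t) * indicator (- (\<Union>k. D k)) x) \<in> borel_measurable limit_law"
    using coord sets.compl_sets[OF DU] by (simp add: Compl_eq_Diff_UNIV)
  with zero have "AE x in limit_law. ennreal (limit_ext x t) * indicator (- (\<Union>k. D k)) x = 0"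
    by (simp add: nn_integral_0_iff_AE)
  \<comment> \<open>The first factor vanishes off the exhausting events, and then the product
    vanishes even where \<open>g\<close> is infinite, because zero times infinity is zero in
    \<open>ennreal\<close>.\<close>
  then have "AE x in limit_law. ennreal (limit_ext x t) * g (limit_ext x) =
      ennreal (limit_ext x t) * g (limit_ext x) * indicator (\<Union>k. D k) x"
    by eventually_elim (auto simp: indicator_def split: if_splits)
  then have "(\<integral>\<^sup>+x. ennreal (limit_ext x t) * g (limit_ext x) \<partial>limit_law) =
      (\<integral>\<^sup>+x. ennreal (limit_ext x t) * g (limit_ext x) * indicator (\<Union>k. D k) x \<partial>limit_law)"
    by (rule nn_integral_cong_AE)
  then show ?thesis using main[OF g] by simp
qed

end

section \<open>The martingale measure and the reciprocal process\<close>

lemma path_martingaleI: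
  assumes M: "path_prob M"
    and int: "\<And>t. 0 \<le> t \<Longrightarrow> integrable M (coord t)"
    and eq: "\<And>s t A. 0 \<le> s \<Longrightarrow> s \<le> t \<Longrightarrow> A \<in> sets (path_filtration (ennreal s)) \<Longrightarrow>
      (\<integral>w. coord t w * indicator A w \<partial>M) = (\<integral>w. coord s w * indicator A w \<partial>M)"
  shows "martingale M path_filtration coord"
proof -
  interpret prob_space M using M by (simp add: path_prob_def)
  have sets: "sets M = sets path_space" using M by (simp add: path_prob_def)
  have space: "space M = cont_paths" using sets_eq_imp_space_eq[OF sets] by simp
  have sub: "subalgebra M (path_filtration t)" for t
    by (simp add: subalgebra_def space sets sets_path_filtration_subset)
  have meas: "coord t \<in> borel_measurable (path_filtration (ennreal t))" if "0 \<le> t" for t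
    unfolding coord_def[abs_def] using that by (rule measurable_coord_path_filtration) simp
  have "AE w in M. real_cond_exp M (path_filtration (ennreal s)) (coord t) w = coord s w"
    if st: "0 \<le> s" "s \<le> t" for s t
  proof -
    interpret F: sigma_finite_subalgebra M "path_filtration (ennreal s)"
      by (rule finite_measure_subalgebra_is_sigma_finite)
         (simp add: finite_measure_subalgebra_def finite_measure_subalgebra_axioms_def sub finite_measure_axioms)
    show ?thesis
    proof (rule F.real_cond_exp_charact)
      fix A assume "A \<in> sets (path_filtration (ennreal s))"
      then show "(\<integral>x\<in>A. coord t x \<partial>M) = (\<integral>x\<in>A. coord s x \<partial>M)"
        using eq[OF st, of A] by (simp add: set_lebesgue_integral_def mult.commute)
    qed (use int meas st in auto)
  qed
  then show ?thesis
    unfolding martingale_def using filtration_path_filtration sub meas int by (simp add: space)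
qed

lemma path_nonneg_of_rational:
  assumes w: "w \<in> cont_paths" and q: "\<And>q::rat. 0 \<le> q \<Longrightarrow> 0 \<le> w (real_of_rat q)" and t: "0 \<le> t"
  shows "0 \<le> w t"
proof (rule LIMSEQ_le_const)
  show "(\<lambda>k. w (dyadic_floor k t)) \<longlonglongrightarrow> w t"
    by (rule path_tendsto_within[OF w dyadic_floor_nonneg[OF t] dyadic_floor_tendsto t])
  show "\<exists>N. \<forall>n\<ge>N. 0 \<le> w (dyadic_floor n t)"
    using q[OF dyadic_rat_nonneg[OF t]] by (simp add: of_rat_dyadic_rat)
qed

text \<open>Each generating cylinder reads one finite time. The union over finite times serves as
  the intersection-stable generator in the uniqueness proof.\<close>

lemma sets_path_space_generated:
  "sets path_space = sigma_sets cont_paths (\<Union>t\<in>{0..}. sets (path_filtration (ennreal t)))"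
proof
  let ?G = "{coord s -` B \<inter> cont_paths |s B. 0 \<le> s \<and> ennreal s \<le> \<infinity> \<and> B \<in> sets borel}"
  have "sets path_space = sigma_sets cont_paths ?G"
    unfolding path_space_def path_filtration_def by (rule sets_measure_of) auto
  also have "\<dots> \<subseteq> sigma_sets cont_paths (\<Union>t\<in>{0..}. sets (path_filtration (ennreal t)))"
  proof (rule sigma_sets_mono, rule subsetI)
    fix A assume "A \<in> ?G"
    then obtain s B where A: "A = coord s -` B \<inter> cont_paths" "0 \<le> s" "B \<in> sets borel" by auto
    have "coord s -` B \<inter> space (path_filtration (ennreal s)) \<in> sets (path_filtration (ennreal s))"
      unfolding coord_def[abs_def] using A by (intro measurable_sets[OF measurable_coord_path_filtration]) auto
    then show "A \<in> sigma_sets cont_paths (\<Union>t\<in>{0..}. sets (path_filtration (ennreal t)))"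
      using A by (intro sigma_sets.Basic) auto
  qed
  finally show "sets path_space \<subseteq> sigma_sets cont_paths (\<Union>t\<in>{0..}. sets (path_filtration (ennreal t)))" .
  have "sigma_sets (space path_space) (\<Union>t\<in>{0..}. sets (path_filtration (ennreal t))) \<subseteq> sets path_space"
    by (rule sets.sigma_sets_subset) (use sets_path_filtration_subset in auto)
  then show "sigma_sets cont_paths (\<Union>t\<in>{0..}. sets (path_filtration (ennreal t))) \<subseteq> sets path_space" by simp
qed

lemma path_prob_eqI:
  assumes P: "path_prob P" and P': "path_prob P'"
    and eq: "\<And>t A. 0 \<le> t \<Longrightarrow> A \<in> sets (path_filtration (ennreal t)) \<Longrightarrow> measure P A = measure P' A"
  shows "P = P'"
proof -
  interpret P: prob_space P using P by (simp add: path_prob_def)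
  interpret P': prob_space P' using P' by (simp add: path_prob_def)
  let ?E = "\<Union>t\<in>{0..}. sets (path_filtration (ennreal t))"
  show ?thesis
  proof (rule measure_eqI_generator_eq[where E="?E" and \<Omega>=cont_paths and A="\<lambda>_. cont_paths"])
    show "Int_stable ?E"
    proof (rule Int_stableI)
      fix a b assume "a \<in> ?E" "b \<in> ?E"
      then obtain s t where st: "0 \<le> s" "0 \<le> t" "a \<in> sets (path_filtration (ennreal s))"
        "b \<in> sets (path_filtration (ennreal t))" by auto
      have "a \<in> sets (path_filtration (ennreal (max s t)))" "b \<in> sets (path_filtration (ennreal (max s t)))"
        using st sets_path_filtration_mono[of "ennreal s" "ennreal (max s t)"]
          sets_path_filtration_mono[of "ennreal t" "ennreal (max s t)"] by (auto simp: ennreal_leI)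
      then show "a \<inter> b \<in> ?E" using st(1) by (intro UN_I[of "max s t"] sets.Int) auto
    qed
    show "?E \<subseteq> Pow cont_paths"
      using sets.sets_into_space[of _ "path_filtration _"] by fastforce
    show "emeasure P X = emeasure P' X" if "X \<in> ?E" for X
      using that eq by (auto simp: P.emeasure_eq_measure P'.emeasure_eq_measure)
    show "sets P = sigma_sets cont_paths ?E" "sets P' = sigma_sets cont_paths ?E"
      using P P' by (auto simp: path_prob_def sets_path_space_generated)
    show "range (\<lambda>_. cont_paths) \<subseteq> ?E"
      using sets.top[of "path_filtration (ennreal 0)"] by (auto intro!: bexI[of _ 0])
    show "(\<Union>i::nat. cont_paths) = cont_paths" by simp
    show "emeasure P cont_paths \<noteq> \<infinity>" by simp
  qed
qed

text \<open>The infimum of the empty set is the top element of \<open>ennreal\<close>, so finiteness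
  means that the set of zeros is nonempty.\<close>

lemma hitting_time_zero_finite_iff: "hitting_time_zero w < \<infinity> \<longleftrightarrow> (\<exists>t\<ge>0. w t = 0)"
proof
  assume "hitting_time_zero w < \<infinity>"
  then have "{ennreal t | t. 0 \<le> t \<and> coord t w = 0} \<noteq> {}"
    unfolding hitting_time_zero_def by (metis Inf_empty infinity_ennreal_def less_irrefl)
  then show "\<exists>t\<ge>0. w t = 0" by (auto simp: coord_def)
next
  assume "\<exists>t\<ge>0. w t = 0"
  then obtain t where "0 \<le> t" "w t = 0" by auto
  then have "hitting_time_zero w \<le> ennreal t"
    unfolding hitting_time_zero_def by (intro Inf_lower) (auto simp: coord_def)
  then show "hitting_time_zero w < \<infinity>" using ennreal_less_top by (auto intro: le_less_trans)
qed

context positive_path_martingale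
begin

text \<open>Optional stopping gives equality at times cut off at \<open>level_time n\<close>.
  Fatou's lemma handles the later time, where mass may be lost in the limit; at the earlier time the
  cut value is bounded directly.\<close>

lemma supermartingale_R:
  assumes st: "0 \<le> s" "s \<le> t" and A: "A \<in> sets (path_filtration (ennreal s))"
  shows "(\<integral>\<^sup>+w. ennreal (w t * indicator A w) \<partial>R) \<le> (\<integral>\<^sup>+w. ennreal (w s * indicator A w) \<partial>R)"
proof (rule nn_integral_limit_le)
  \<comment> \<open>Intersecting with \<open>s < level_time n w\<close> makes the indicator depend
    on the path only up to \<open>min s (level_time n w)\<close>: on the event the minimum is
    \<open>s\<close>, and off it the indicator vanishes.\<close>
  define B where "B n = {w \<in> A. s < level_time n w}" for n
  define S where "S n w = min s (level_time n w)" for n w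
  define U where "U n w = min t (level_time n w)" for n w
  have S: "path_stopping (S n)" and U: "path_stopping (U n)" for n
    unfolding S_def U_def using st by (auto intro: path_stopping_min_level)
  have A': "A \<in> sets path_space" using A sets_path_filtration_subset by blast
  have Ac: "A \<subseteq> cont_paths" using sets.sets_into_space[OF A'] by simp
  have B: "B n \<in> sets path_space" for n
  proof -
    have "B n = A \<inter> {w \<in> space path_space. s < level_time n w}" using Ac by (auto simp: B_def)
    also have "\<dots> \<in> sets path_space"
      using A' path_stoppingD(1)[OF path_stopping_level_time, of n] by measurable
    finally show ?thesis .
  qed
  have B_det: "determined_by (S n) (indicator (B n) :: _ \<Rightarrow> ennreal)" for n
  proof -
    have step: "w' \<in> B n" if w: "w \<in> cont_paths" "w' \<in> cont_paths" "w \<in> B n"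
      and a: "\<And>r. 0 \<le> r \<Longrightarrow> r \<le> s \<Longrightarrow> w r = w' r" for w w'
    proof -
      have "w' \<in> A"
        using determined_byD[OF determined_by_path_filtration[OF A st(1)] w(1,2) a] w(3) by (simp add: B_def)
      moreover have "s < level_time n w'"
      proof (rule ccontr)
        assume no: "\<not> s < level_time n w'"
        have "level_time n w' = level_time n w"
          by (rule determined_byD[OF path_stoppingD(3)[OF path_stopping_level_time] w(2,1)])
             (use a no in \<open>simp\<close>)
        then show False using no w(3) by (simp add: B_def)
      qed
      ultimately show ?thesis by (simp add: B_def)
    qed
    show ?thesis
    proof (rule determined_byI)
      fix w w' assume w: "w \<in> cont_paths" "w' \<in> cont_paths" and a: "\<And>r. 0 \<le> r \<Longrightarrow> r \<le> S n w \<Longrightarrow> w r = w' r"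
      show "(indicator (B n) w :: ennreal) = indicator (B n) w'"
      proof (cases "s < level_time n w")
        case True
        then have a': "w r = w' r" if "0 \<le> r" "r \<le> s" for r
          using a that by (simp add: S_def)
        have "w \<in> B n \<longleftrightarrow> w' \<in> B n"
          using step[OF w _ a'] step[OF w(2,1) _ a'[symmetric]] by blast
        then show ?thesis by (simp add: indicator_def)
      next
        case False
        then have "level_time n w = level_time n w'"
          using a by (intro determined_byD[OF path_stoppingD(3)[OF path_stopping_level_time] w]) (simp add: S_def)
        then show ?thesis using False by (simp add: B_def indicator_def)
      qed
    qed
  qed
  let ?u = "\<lambda>n w. w (U n w) * indicator (B n) w :: real"
  show "?u n \<in> borel_measurable R" for n
    unfolding measurable_R_eq using measurable_path_at_stopping[OF U] B by measurable
  show "AE w in R. (\<lambda>n. ?u n w) \<longlonglongrightarrow> w t * indicator A w"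
  proof (rule AE_I2)
    fix w assume "w \<in> space R"
    then have "\<forall>\<^sub>F n in sequentially. t < level_time n w"
      using st by (intro level_time_eventually) auto
    then have "\<forall>\<^sub>F n in sequentially. ?u n w = w t * indicator A w"
      by eventually_elim (use st in \<open>auto simp: U_def B_def indicator_def\<close>)
    then show "(\<lambda>n. ?u n w) \<longlonglongrightarrow> w t * indicator A w" by (rule tendsto_eventually)
  qed
  show "(\<integral>\<^sup>+w. ennreal (?u n w) \<partial>R) \<le> (\<integral>\<^sup>+w. ennreal (w s * indicator A w) \<partial>R)" for n
  proof -
    have SU: "S n w \<le> U n w" for w using st by (simp add: S_def U_def min_le_iff_disj)
    have Bm: "indicator (B n) \<in> borel_measurable path_space" using B by simp
    have "(\<integral>\<^sup>+w. ennreal (?u n w) \<partial>R) = (\<integral>\<^sup>+w. ennreal (w (U n w)) * indicator (B n) w \<partial>R)"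
      by (intro nn_integral_cong) (simp add: indicator_def)
    also have "\<dots> = (\<integral>\<^sup>+w. ennreal (w (level_time n w)) * indicator (B n) w \<partial>R)"
      by (rule optional_stopping_level[OF U _ Bm determined_by_mono[OF B_det SU], symmetric]) (simp add: U_def)
    also have "\<dots> = (\<integral>\<^sup>+w. ennreal (w (S n w)) * indicator (B n) w \<partial>R)"
      by (rule optional_stopping_level[OF S _ Bm B_det]) (simp add: S_def)
    also have "\<dots> \<le> (\<integral>\<^sup>+w. ennreal (w s * indicator A w) \<partial>R)"
      by (rule nn_integral_mono) (auto simp: indicator_def B_def S_def)
    finally show ?thesis .
  qed
qed

text \<open>The supermartingale inequality holds on \<open>A\<close> and on its complement; the
  totals are equal, so neither inequality is strict.\<close>

lemma martingale_R_if_expectation_one: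
  assumes one: "\<And>t. 0 \<le> t \<Longrightarrow> (\<integral>\<^sup>+w. ennreal (w t) \<partial>R) = 1"
  shows "martingale R path_filtration coord"
proof (rule path_martingaleI[OF path_prob_R])
  have m: "coord t \<in> borel_measurable R" if "0 \<le> t" for t
    using measurable_coord_path_space[OF that] by (simp add: coord_def[abs_def] measurable_R_eq)
  have nn: "AE w in R. 0 \<le> coord t w" if "0 \<le> t" for t
    using pos by eventually_elim (use that in \<open>simp add: coord_def less_imp_le\<close>)
  show int: "integrable R (coord t)" if "0 \<le> t" for t
    using one[OF that] by (intro integrableI_nonneg m nn that) (simp add: coord_def)
  fix s t A assume st: "(0::real) \<le> s" "s \<le> t" and A: "A \<in> sets (path_filtration (ennreal s))"
  have t: "0 \<le> t" using st by simp
  have expect: "(\<integral>w. coord r w \<partial>R) = 1" if "0 \<le> r" for r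
    using one[OF that] integral_eq_nn_integral[OF m nn, OF that that] by (simp add: coord_def)
  have intA: "integrable R (\<lambda>w. coord r w * indicator C w)" if "0 \<le> r" "C \<in> sets path_space" for r C
    using integrable_mult_indicator[OF _ int[OF that(1)], of C] that(2) by (simp add: mult.commute)
  have le: "(\<integral>w. coord t w * indicator C w \<partial>R) \<le> (\<integral>w. coord s w * indicator C w \<partial>R)"
    if C: "C \<in> sets (path_filtration (ennreal s))" for C
  proof -
    have C': "C \<in> sets path_space" using C sets_path_filtration_subset by blast
    have eq: "(\<integral>\<^sup>+w. ennreal (w r * indicator C w) \<partial>R) = ennreal (\<integral>w. coord r w * indicator C w \<partial>R)"
      if r: "0 \<le> r" for r
    proof -
      have "AE w in R. 0 \<le> coord r w * indicator C w"
        using nn[OF r] by eventually_elim simp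
      then show ?thesis
        using nn_integral_eq_integral[OF intA[OF r C']] by (simp add: coord_def)
    qed
    have "0 \<le> (\<integral>w. coord s w * indicator C w \<partial>R)"
      by (rule integral_nonneg_AE) (use nn[OF st(1)] in eventually_elim, simp)
    then show ?thesis
      using supermartingale_R[OF st C] unfolding eq[OF t] eq[OF st(1)] by (simp add: ennreal_le_iff)
  qed
  have A': "A \<in> sets path_space" using A sets_path_filtration_subset by blast
  have C: "cont_paths - A \<in> sets (path_filtration (ennreal s))"
    using sets.compl_sets[OF A] by simp
  then have C': "cont_paths - A \<in> sets path_space" using sets_path_filtration_subset by blast
  have split: "(\<integral>w. coord r w * indicator A w \<partial>R) + (\<integral>w. coord r w * indicator (cont_paths - A) w \<partial>R) = 1"
    if r: "0 \<le> r" for r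
  proof -
    have "(\<integral>w. coord r w * indicator A w \<partial>R) + (\<integral>w. coord r w * indicator (cont_paths - A) w \<partial>R) =
        (\<integral>w. coord r w * indicator A w + coord r w * indicator (cont_paths - A) w \<partial>R)"
      by (rule Bochner_Integration.integral_add[symmetric]) (use intA r A' C' in auto)
    also have "\<dots> = (\<integral>w. coord r w \<partial>R)"
      by (intro Bochner_Integration.integral_cong) (auto simp: indicator_def)
    finally show ?thesis using expect[OF r] by simp
  qed
  show "(\<integral>w. coord t w * indicator A w \<partial>R) = (\<integral>w. coord s w * indicator A w \<partial>R)"
    using le[OF A] le[OF C] split[OF t] split[OF st(1)] by linarith
qed

text \<open>Positivity has full mass, so restricting \<open>R\<close> to it and using the default
  path off it yield the same image measure.\<close>

lemma reciprocal_law_eq: "reciprocal_law R = distr R path_space recip_path"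
proof (rule measure_eqI)
  let ?P = "{w. \<forall>t\<ge>0. 0 < coord t w}"
  have P: "?P \<inter> space R \<in> sets R"
  proof -
    have "Measurable.pred path_space (\<lambda>w. \<forall>t\<ge>0. 0 < w t)"
      using measurable_everywhere_positive[of "\<lambda>x. x"] by simp
    then have "{w \<in> space path_space. \<forall>t\<ge>0. 0 < w t} \<in> sets path_space" by measurable
    also have "{w \<in> space path_space. \<forall>t\<ge>0. 0 < w t} = ?P \<inter> space R" by (auto simp: coord_def)
    finally show ?thesis by simp
  qed
  have rm: "recip_path \<in> measurable R path_space"
    using measurable_recip_path by (simp only: measurable_R_eq)
  have "reciprocal_law R = distr (restrict_space R ?P) path_space recip_path"
    unfolding reciprocal_law_def
    by (intro distr_cong refl) (auto simp: space_restrict_space reciprocal_path_def recip_path_def coord_def)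
  moreover fix A assume "A \<in> sets (reciprocal_law R)"
  then have A: "A \<in> sets path_space" by (simp add: reciprocal_law_def)
  ultimately have "emeasure (reciprocal_law R) A =
      emeasure (restrict_space R ?P) (recip_path -` A \<inter> space (restrict_space R ?P))"
    using emeasure_distr[OF measurable_restrict_space1[OF rm, of ?P] A] by simp
  also have "\<dots> = emeasure R (recip_path -` A \<inter> space (restrict_space R ?P))"
    by (rule emeasure_restrict_space) (use P in \<open>auto simp: space_restrict_space\<close>)
  also have "\<dots> = emeasure R (recip_path -` A \<inter> space R)"
  proof (rule emeasure_eq_AE)
    show "AE w in R. w \<in> recip_path -` A \<inter> space (restrict_space R ?P) \<longleftrightarrow> w \<in> recip_path -` A \<inter> space R"
      using pos by eventually_elim (auto simp: space_restrict_space coord_def)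
    have "recip_path -` A \<inter> space (restrict_space R ?P) = (recip_path -` A \<inter> space R) \<inter> (?P \<inter> space R)"
      by (auto simp: space_restrict_space)
    then show "recip_path -` A \<inter> space (restrict_space R ?P) \<in> sets R"
      using measurable_sets[OF rm A] P by (simp only: sets.Int)
  qed (rule measurable_sets[OF rm A])
  also have "\<dots> = emeasure (distr R path_space recip_path) A"
    by (rule emeasure_distr[OF rm A, symmetric])
  finally show "emeasure (reciprocal_law R) A = emeasure (distr R path_space recip_path) A" .
qed (simp add: reciprocal_law_def)

text \<open>This is the measure \<open>Q\<close> of the theorem.\<close>

definition martingale_law :: "(real \<Rightarrow> real) measure" where
  "martingale_law = distr limit_law path_space limit_ext"

lemma path_prob_martingale_law: "path_prob martingale_law"
  unfolding path_prob_def martingale_law_def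
  by (simp add: prob_space.prob_space_distr[OF prob_space_limit_law measurable_limit_ext])

lemma sets_martingale_law [simp, measurable_cong]: "sets martingale_law = sets path_space"
  by (simp add: martingale_law_def)

lemma space_martingale_law [simp]: "space martingale_law = cont_paths"
  by (simp add: martingale_law_def)

lemma measurable_martingale_law_eq: "measurable martingale_law N = measurable path_space N"
  by (rule measurable_cong_sets) auto

lemma path_prob_reciprocal_law: "path_prob (reciprocal_law R)"
  unfolding path_prob_def reciprocal_law_eq
  using prob_space_distr[of recip_path path_space] measurable_recip_path by (simp add: measurable_R_eq)

lemma nn_integral_martingale_law:
  assumes t: "0 \<le> t" and g: "g \<in> borel_measurable path_space" "determined_by (\<lambda>_. t) g"
  shows "(\<integral>\<^sup>+w. ennreal (w t) * g w \<partial>martingale_law) = (\<integral>\<^sup>+w. g (recip_path w) \<partial>R)"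
proof -
  have "(\<lambda>w. ennreal (w t) * g w) \<in> borel_measurable path_space"
    using g(1) measurable_coord_path_space[OF t] by measurable
  then have "(\<integral>\<^sup>+w. ennreal (w t) * g w \<partial>martingale_law) =
      (\<integral>\<^sup>+x. ennreal (limit_ext x t) * g (limit_ext x) \<partial>limit_law)"
    unfolding martingale_law_def by (intro nn_integral_distr measurable_limit_ext) simp
  then show ?thesis using nn_integral_limit_ext[OF t g] by simp
qed

text \<open>Nonnegativity is inherited by both limits that define the extension. It is transferred
  to the image measure one rational time at a time, where the event is measurable, and continuity
  covers the remaining times.\<close>

lemma martingale_law_nonneg: "AE w in martingale_law. \<forall>t\<ge>0. 0 \<le> w t"
proof -
  have "AE x in limit_law. \<forall>n. \<forall>q. 0 \<le> x n q"
    unfolding AE_all_countable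
  proof (intro allI)
    fix n q
    have "Measurable.pred (borel \<Otimes>\<^sub>M borel) (\<lambda>p :: (rat \<Rightarrow> real) \<times> (rat \<Rightarrow> real). 0 \<le> fst p q)"
      using measurable_pair_coordinates(1)[of q] by measurable
    moreover have "AE w in R. 0 \<le> stopped_recip n w q"
      using pos by eventually_elim (simp add: stopped_recip_def level_time_bounds less_imp_le)
    ultimately show "AE x in limit_law. 0 \<le> x n q"
      using AE_limit_pair[of n n "\<lambda>p. 0 \<le> fst p q"] by simp
  qed
  then have nn: "AE x in limit_law. \<forall>t\<ge>0. 0 \<le> limit_ext x t"
    using AE_limit_regular
  proof eventually_elim
    case (elim x)
    have lp: "0 \<le> limit_path x q" if "0 \<le> q" for q
      by (rule LIMSEQ_le_const[of "\<lambda>n. x n q"]) (use elim that in auto)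
    show ?case
    proof (intro allI impI)
      fix t :: real assume t: "0 \<le> t"
      show "0 \<le> limit_ext x t"
        unfolding limit_ext_def
        by (rule LIMSEQ_le_const[OF rat_ext_tendsto]) (use elim t lp dyadic_rat_nonneg in auto)
    qed
  qed
  have "AE w in martingale_law. \<forall>q::rat. 0 \<le> q \<longrightarrow> 0 \<le> w (real_of_rat q)"
    unfolding AE_all_countable
  proof
    fix q :: rat
    have "Measurable.pred path_space (\<lambda>w. 0 \<le> q \<longrightarrow> 0 \<le> w (real_of_rat q))"
      by (cases "0 \<le> q") simp_all
    then have "{w \<in> space path_space. 0 \<le> q \<longrightarrow> 0 \<le> w (real_of_rat q)} \<in> sets path_space" by measurable
    then show "AE w in martingale_law. 0 \<le> q \<longrightarrow> 0 \<le> w (real_of_rat q)"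
      unfolding martingale_law_def
      by (subst AE_distr_iff[OF measurable_limit_ext]) (use nn in \<open>auto elim: eventually_mono\<close>)
  qed
  then show ?thesis using AE_space[of martingale_law]
    by eventually_elim (auto intro: path_nonneg_of_rational)
qed

lemma martingale_law_integral:
  assumes t: "0 \<le> t" and A: "A \<in> sets (path_filtration (ennreal t))"
  shows "integrable martingale_law (\<lambda>w. coord t w * indicator A w)"
    "measure (reciprocal_law R) A = (\<integral>w. coord t w * indicator A w \<partial>martingale_law)"
proof -
  interpret P: prob_space "reciprocal_law R" using path_prob_reciprocal_law by (simp add: path_prob_def)
  have A': "A \<in> sets path_space" using A sets_path_filtration_subset by blast
  have m: "(\<lambda>w. coord t w * indicator A w) \<in> borel_measurable martingale_law"
    unfolding measurable_martingale_law_eq coord_def using measurable_coord_path_space[OF t] A' by measurable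
  have nn: "AE w in martingale_law. 0 \<le> coord t w * indicator A w"
    using martingale_law_nonneg by eventually_elim (simp add: coord_def t)
  have "(\<integral>\<^sup>+w. ennreal (coord t w * indicator A w) \<partial>martingale_law) =
      (\<integral>\<^sup>+w. ennreal (w t) * indicator A w \<partial>martingale_law)"
    by (intro nn_integral_cong) (simp add: indicator_def coord_def)
  also have "\<dots> = (\<integral>\<^sup>+w. indicator A (recip_path w) \<partial>R)"
    by (rule nn_integral_martingale_law[OF t])
       (use A' determined_by_comp[OF determined_by_path_filtration[OF A t], of "\<lambda>b. if b then 1 else 0"]
         in \<open>simp_all add: indicator_def of_bool_def\<close>)
  also have "\<dots> = (\<integral>\<^sup>+w. indicator A w \<partial>distr R path_space recip_path)"
    by (rule nn_integral_distr[symmetric]) (use measurable_recip_path A' in \<open>simp_all add: measurable_R_eq\<close>)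
  also have "\<dots> = emeasure (reciprocal_law R) A"
    unfolding reciprocal_law_eq using A' by simp
  finally have eq: "(\<integral>\<^sup>+w. ennreal (coord t w * indicator A w) \<partial>martingale_law) = ennreal (measure (reciprocal_law R) A)"
    by (simp add: P.emeasure_eq_measure)
  show "integrable martingale_law (\<lambda>w. coord t w * indicator A w)"
    by (rule integrableI_nonneg[OF m nn]) (simp add: eq)
  show "measure (reciprocal_law R) A = (\<integral>w. coord t w * indicator A w \<partial>martingale_law)"
    using integral_eq_nn_integral[OF m nn] eq by simp
qed

text \<open>For an event known at time \<open>s\<close> both integrals equal its mass under
  \<open>reciprocal_law R\<close>, which does not depend on the time at which \<open>X\<close> is
  evaluated.\<close>

lemma martingale_martingale_law: "martingale martingale_law path_filtration coord"
proof (rule path_martingaleI[OF path_prob_martingale_law])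
  show "integrable martingale_law (coord t)" if "0 \<le> t" for t
  proof -
    have "integrable martingale_law (\<lambda>w. coord t w * indicator cont_paths w)"
      using sets.top[of "path_filtration (ennreal t)"] by (intro martingale_law_integral that) simp
    also have "?this \<longleftrightarrow> integrable martingale_law (coord t)"
      by (rule Bochner_Integration.integrable_cong) auto
    finally show ?thesis .
  qed
  fix s t A assume st: "(0::real) \<le> s" "s \<le> t" and A: "A \<in> sets (path_filtration (ennreal s))"
  have "A \<in> sets (path_filtration (ennreal t))"
    using A sets_path_filtration_mono[OF ennreal_leI[OF st(2)]] by blast
  then show "(\<integral>w. coord t w * indicator A w \<partial>martingale_law) = (\<integral>w. coord s w * indicator A w \<partial>martingale_law)"
    using martingale_law_integral(2)[OF _ A] martingale_law_integral(2)[of t A] st by simp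
qed

text \<open>The defining identity fixes \<open>P\<close> on all finite-time events, an
  intersection-stable generator; this gives uniqueness together with the identification.\<close>

lemma density_process_measure_iff:
  "density_process_measure martingale_law P \<longleftrightarrow> P = reciprocal_law R"
proof
  assume "P = reciprocal_law R"
  then show "density_process_measure martingale_law P"
    by (simp add: density_process_measure_def path_prob_reciprocal_law martingale_law_integral)
next
  assume "density_process_measure martingale_law P"
  then show "P = reciprocal_law R"
    by (intro path_prob_eqI path_prob_reciprocal_law)
       (auto simp: density_process_measure_def martingale_law_integral)
qed

lemma martingale_law_hits_zero:
  assumes "\<not> martingale R path_filtration coord"
  shows "0 < measure martingale_law {w \<in> space martingale_law. hitting_time_zero w < \<infinity>}"
proof (rule ccontr)
  interpret Q: prob_space martingale_law using path_prob_martingale_law by (simp add: path_prob_def)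
  let ?H = "{w \<in> space martingale_law. hitting_time_zero w < \<infinity>}"
  \<comment> \<open>The absolute value turns avoidance of zero into everywhere positivity, whose
    measurability is already known.\<close>
  have H_eq: "?H = {w \<in> space path_space. \<not> (\<forall>t\<ge>0. 0 < \<bar>w t\<bar>)}"
    unfolding hitting_time_zero_finite_iff by auto
  have [measurable]: "Measurable.pred path_space (\<lambda>w. \<forall>t\<ge>0. 0 < \<bar>w t\<bar>)"
    by (rule measurable_everywhere_positive) (intro continuous_intros)
  have H: "?H \<in> sets martingale_law" unfolding H_eq sets_martingale_law by measurable
  assume "\<not> 0 < measure martingale_law ?H"
  then have "measure martingale_law ?H = 0" using zero_less_measure_iff by auto
  then have "?H \<in> null_sets martingale_law"
    using H by (simp add: null_sets_def Q.emeasure_eq_measure)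
  then have "AE w in martingale_law. w \<notin> ?H" by (rule AE_not_in)
  then have pQ: "AE w in martingale_law. \<forall>t\<ge>0. 0 < w t"
    using martingale_law_nonneg AE_space[of martingale_law] unfolding H_eq
    by eventually_elim (auto simp: less_le)
  have "(\<integral>\<^sup>+w. ennreal (w t) \<partial>R) = 1" if t: "0 \<le> t" for t
  proof -
    have "(\<integral>\<^sup>+w. ennreal (w t) \<partial>R) = (\<integral>\<^sup>+w. ennreal (1 / recip_path w t) \<partial>R)"
    proof (rule nn_integral_cong_AE)
      show "AE w in R. ennreal (w t) = ennreal (1 / recip_path w t)"
        using pos by eventually_elim (simp add: recip_path_apply t)
    qed
    also have "\<dots> = (\<integral>\<^sup>+w. ennreal (w t) * ennreal (1 / w t) \<partial>martingale_law)"
    proof (rule nn_integral_martingale_law[OF t, symmetric])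
      show "(\<lambda>w. ennreal (1 / w t)) \<in> borel_measurable path_space"
        using measurable_coord_path_space[OF t] by measurable
      show "determined_by (\<lambda>_. t) (\<lambda>w. ennreal (1 / w t))"
        using t by (simp add: determined_by_def)
    qed
    \<comment> \<open>Here the assumption that zero is almost surely not hit enters; with
      \<open>1 / 0 = 0\<close> the product is in general the indicator of
      \<open>0 < w t\<close>.\<close>
    also have "\<dots> = (\<integral>\<^sup>+w. 1 \<partial>martingale_law)"
    proof (rule nn_integral_cong_AE)
      show "AE w in martingale_law. ennreal (w t) * ennreal (1 / w t) = 1"
        using pQ
      proof eventually_elim
        case (elim w)
        then have "0 < w t" using t by simp
        then show ?case by (subst ennreal_mult[symmetric]) auto
      qed
    qed
    also have "\<dots> = 1" using Q.emeasure_space_1 by simp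
    finally show ?thesis .
  qed
  then show False using martingale_R_if_expectation_one assms by blast
qed

end

theorem proposition6:
  fixes R :: "(real \<Rightarrow> real) measure"
  assumes "path_prob R"
    and "AE \<omega> in R. \<forall>t\<ge>0. 0 < coord t \<omega>"
    and "AE \<omega> in R. coord 0 \<omega> = 1"
    and "strict_local_martingale R path_filtration coord"
  shows "\<exists>Q. path_prob Q \<and>
           martingale Q path_filtration coord \<and>
           (AE \<omega> in Q. \<forall>t\<ge>0. 0 \<le> coord t \<omega>) \<and>
           ((\<exists>!P. density_process_measure Q P) \<and>
            (\<forall>P. density_process_measure Q P \<longrightarrow> P = reciprocal_law R)) \<and>
           (strict_local_martingale R path_filtration coord \<longleftrightarrow>
            measure Q {\<omega> \<in> space Q. hitting_time_zero \<omega> < \<infinity>} > 0)"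
proof -
  interpret positive_path_martingale R
    by standard (use assms in \<open>simp_all add: coord_def strict_local_martingale_def\<close>)
  have "\<not> martingale R path_filtration coord"
    using assms(4) by (simp add: strict_local_martingale_def)
  \<comment> \<open>Strictness is among the hypotheses, so the equivalence in (ii) amounts to the
    positive probability of hitting zero; (i) is \<open>density_process_measure_iff\<close>.\<close>
  then show ?thesis
    using path_prob_martingale_law martingale_martingale_law martingale_law_nonneg
      martingale_law_hits_zero assms(4)
    by (intro exI[of _ martingale_law]) (simp add: density_process_measure_iff coord_def)
qed

end
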